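(* Let $I=[\alpha,\beta]\subset[0,1]$ with $\alpha<\beta$. For each of the following functions $F$ on $\Omega=\{(x,y)\in(0,1]^2: x+y>1\}$, the limiting distribution $G_F(t)$ has the stated behavior as $t\to\infty$: (1) (Euclidean distance) for $F(x,y)=\frac{1}{2x^2}+\frac{1}{2y^2}$, $G_F(t)\sim\frac1t$; (2) (hyperbolic distance) for $F(x,y)=\frac12\left(\frac yx+\frac xy\right)$, $G_F(t)\sim\frac{1}{2t^2}$; (3) (Euclidean slope) for $F(x,y)=\frac12\left(\frac xy-\frac yx\right)$, $G_F(t)\asymp\frac{1}{t^2}$; (4) (Euclidean area) for $F(x,y)=\frac14\left(\frac{1}{x^3y}+\frac{1}{xy^3}\right)$, $G_F(t)\asymp\frac{1}{t^{2/3}}$; (5) (hyperbolic angle) for $F(x,y)=\frac{4x^5}{y^3}-4xy+\frac{16x^3}{y}$, $G_F(t)\asymp\frac{1}{t^{2/3}}$.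
   Context: For a positive integer $Q$, $\mathcal F(Q)=\{p/q : 0\le p\le q\le Q,\ q\geq 1,\ \gcd(p,q)=1\}$ is the set of Farey fractions of order $Q$. For $I=[\alpha,\beta]\subset[0,1]$, write $\mathcal F(Q)\cap I=\{p_1/q_1<p_2/q_2<\dots<p_{N_I(Q)}/q_{N_I(Q)}\}$ in lowest terms, with $N_I(Q)$ the cardinality of this set. For $1\le j\le N_I(Q)-1$ put $x_j=q_j/Q$ and $y_j=q_{j+1}/Q$; then $(x_j,y_j)\in\Omega$. Given $\delta>0$, set $Q=\lfloor(2\delta)^{-1/2}\rfloor$. For a measurable function $F:\Omega\to\mathbb R$ the limiting distribution of $F$ is $$G_F(t)=\lim_{\delta\to0^+}\frac{\#\{1\le j\le N_I(Q)-1 : F(x_j,y_j)\ge t\}}{N_I(Q)}.$$ Notation: $f(t)\sim g(t)$ as $t\to\infty$ means $\lim_{t\to\infty}f(t)/g(t)=1$; $f(t)\asymp g(t)$ means there exist positive constants $c_1,c_2$ and a constant $t_0$ such that $c_1|g(t)|\le|f(t)|\le c_2|g(t)|$ for all $t>t_0$. *)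

theory Defs
  imports Complex_Main "HOL-Library.Landau_Symbols"
begin

definition farey :: "nat \<Rightarrow> rat set" where
  "farey Q = {Fract p q | p q. 0 \<le> p \<and> p \<le> q \<and> q \<le> int Q \<and> 1 \<le> q \<and> coprime p q}"

lemma finite_farey: "finite (farey Q)"
proof (rule finite_subset)
  show "farey Q \<subseteq> (\<lambda>(p, q). Fract p q) ` ({0..int Q} \<times> {0..int Q})"
    unfolding farey_def by force
qed simp

definition farey_list :: "real \<Rightarrow> real \<Rightarrow> nat \<Rightarrow> rat list" where
  "farey_list \<alpha> \<beta> Q = sorted_list_of_set {r \<in> farey Q. of_rat r \<in> {\<alpha>..\<beta>}}"

text \<open>\<^const>\<open>quotient_of\<close> returns the representation in lowest terms with positive
  denominator; in particular the denominators of 0 and 1 are 1.\<close>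

definition denom :: "rat \<Rightarrow> int" where
  "denom r = snd (quotient_of r)"

text \<open>The mathematical sequence is indexed from 1, lists from 0: the \<open>j\<close>-th fraction is
  \<open>farey_list \<alpha> \<beta> Q ! (j - 1)\<close>.\<close>

definition farey_point :: "real \<Rightarrow> real \<Rightarrow> nat \<Rightarrow> nat \<Rightarrow> real \<times> real" where
  "farey_point \<alpha> \<beta> Q j =
     (of_int (denom (farey_list \<alpha> \<beta> Q ! (j - 1))) / real Q,
      of_int (denom (farey_list \<alpha> \<beta> Q ! j)) / real Q)"

text \<open>A function on \<open>\<Omega> = {(x, y) \<in> (0, 1]\<^sup>2. x + y > 1}\<close> is given by a total function on the
  plane. Its values outside \<open>\<Omega>\<close> are irrelevant, because \<open>farey_point \<alpha> \<beta> Q j\<close> lies in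
  \<open>\<Omega>\<close> for all \<open>j\<close> counted here.\<close>

definition farey_proportion ::
    "real \<Rightarrow> real \<Rightarrow> (real \<times> real \<Rightarrow> real) \<Rightarrow> nat \<Rightarrow> real \<Rightarrow> real" where
  "farey_proportion \<alpha> \<beta> F Q t =
     real (card {j. 1 \<le> j \<and> j \<le> length (farey_list \<alpha> \<beta> Q) - 1 \<and> F (farey_point \<alpha> \<beta> Q j) \<ge> t})
       / real (length (farey_list \<alpha> \<beta> Q))"

definition order_of_delta :: "real \<Rightarrow> nat" where
  "order_of_delta \<delta> = nat \<lfloor>(2 * \<delta>) powr (- 1 / 2)\<rfloor>"

text \<open>\<open>G\<close> is the limiting distribution \<open>G\<^sub>F\<close>: the defining limit exists for every real \<open>t\<close>
  and equals \<open>G t\<close>. Such a \<open>G\<close> is unique, since limits along \<open>at_right 0\<close> are.\<close>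

definition is_limiting_distribution ::
    "real \<Rightarrow> real \<Rightarrow> (real \<times> real \<Rightarrow> real) \<Rightarrow> (real \<Rightarrow> real) \<Rightarrow> bool" where
  "is_limiting_distribution \<alpha> \<beta> F G \<longleftrightarrow>
     (\<forall>t. ((\<lambda>\<delta>. farey_proportion \<alpha> \<beta> F (order_of_delta \<delta>) t) \<longlongrightarrow> G t) (at_right 0))"

end

theory Submission
  imports Defs "HOL-Analysis.Analysis" "HOL-Number_Theory.Number_Theory"
    "HOL-Real_Asymp.Real_Asymp" "HOL-Computational_Algebra.Squarefree"
begin

text \<open>The successor of \<open>p/q\<close> in the Farey sequence of order \<open>Q\<close> has as denominator the
  \<open>q'\<close> in \<open>(Q - q, Q]\<close> with \<open>p q' \<equiv> -1 (mod q)\<close>. Hence the points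
  \<open>((q/Q) e(q'/q), e(p/q))\<close> of the bidisc have moments that are weighted averages over \<open>q \<le> Q\<close> of
  Kloosterman sums. An elementary fourth moment bound (Kloosterman's \<open>q\<close> to the power \<open>3/4\<close>) makes
  all of them negligible except the trivial ones, which are averages of Euler's function. By
  Stone-Weierstrass the triples \<open>(q/Q, q'/Q, p/q)\<close> become equidistributed in
  \<open>\<Omega> \<times> [0, 1]\<close>, so the limiting distribution at \<open>t\<close> is twice the area of
  \<open>{F \<ge> t}\<close>, whatever the interval is. For large \<open>t\<close> this set lies between strips along the legs
  of the triangle, and the strip of width \<open>a\<close> has area \<open>a\<^sup>2/2\<close>.\<close>

section \<open>Kloosterman sums\<close>

text \<open>For fixed q the successor denominators lie in a window of length q that moves with N,
  whereas cancellation is available for complete sums modulo q. Winding the vertical segment of the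
  triangle over x once around the circle of radius x reconciles the two: the window becomes one full
  period and its position is lost. The price is that the two ends of every segment are identified,
  so limits in the bidisc return to the triangle only as upper bounds for compact sets. Such bounds
  suffice because {F \<ge> t}, {F < t} and the fractions outside the interval exhaust a total with
  known asymptotics, while the closed sets {F \<ge> t} and {F \<le> t} overlap in a null set. The
  Kloosterman bound has to beat the trivial one on average over q \<le> N, so a divisor function in
  it costs merely logarithms. The constant \<open>moebius_sum\<close> stands in both numerator and
  denominator of the proportion; what matters is that it is positive.\<close>

text \<open>With \<open>q = 1\<close> the single residue 0 counts as a unit, so every Farey fraction below 1 is covered.\<close>

definition unit_residues :: "int \<Rightarrow> int set" where
  "unit_residues q = {a \<in> {0..<q}. coprime a q}"

definition root_char :: "int \<Rightarrow> int \<Rightarrow> complex" where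
  "root_char q k = cis (2 * pi * of_int k / of_int q)"

definition kloosterman :: "int \<Rightarrow> int \<Rightarrow> int \<Rightarrow> complex" where
  "kloosterman q m n = (\<Sum>a\<in>unit_residues q. root_char q (m * a + n * modular_inverse q a))"

lemma finite_unit_residues [simp]: "finite (unit_residues q)"
  unfolding unit_residues_def by (rule finite_subset[of _ "{0..<q}"]) auto

lemma unit_residues_iff: "a \<in> unit_residues q \<longleftrightarrow> 0 \<le> a \<and> a < q \<and> coprime a q"
  by (auto simp: unit_residues_def)

lemma modular_inverse_unit_residues:
  "a \<in> unit_residues q \<Longrightarrow> modular_inverse q a \<in> unit_residues q"
  by (auto simp: unit_residues_iff modular_inverse_int_nonneg modular_inverse_int_less)

lemma modular_inverse_involution:
  assumes "a \<in> unit_residues q"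
  shows "modular_inverse q (modular_inverse q a) = a"
  using assms by (intro modular_inverse_int_eqI)
    (auto simp: unit_residues_iff cong_modular_inverse2)

lemma root_char_add: "root_char q (a + b) = root_char q a * root_char q b"
  by (simp add: root_char_def cis_mult add_divide_distrib ring_distribs)

lemma root_char_mult_self [simp]: "root_char q (q * k) = 1"
proof (cases "q = 0")
  case False
  then have "2 * pi * of_int (q * k) / of_int q = 2 * pi * of_int k" by simp
  then show ?thesis unfolding root_char_def by (simp add: cis_multiple_2pi)
qed (simp add: root_char_def)

lemma root_char_cong:
  assumes "[a = b] (mod q)"
  shows "root_char q a = root_char q b"
proof -
  from assms obtain k where "b = a + q * k" by (metis cong_iff_lin)
  then show ?thesis by (simp add: root_char_add)
qed

lemma norm_root_char [simp]: "norm (root_char q k) = 1"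
  by (simp add: root_char_def)

lemma cnj_root_char: "cnj (root_char q k) = root_char q (- k)"
  by (simp add: root_char_def cis_cnj)

lemma root_char_power: "root_char q (int j * k) = root_char q k ^ j"
  by (induction j) (simp_all add: root_char_add ring_distribs, simp add: root_char_def)

lemma root_char_eq_1_iff:
  assumes "q > 0"
  shows "root_char q k = 1 \<longleftrightarrow> q dvd k"
proof
  assume "root_char q k = 1"
  then have "cos (2 * pi * of_int k / of_int q) = 1"
    by (simp add: root_char_def complex_eq_iff)
  then obtain x :: int where "2 * pi * of_int k / of_int q = of_int x * 2 * pi"
    by (auto simp: cos_one_2pi_int)
  then have "real_of_int k = of_int (x * q)"
    using assms by (simp add: field_simps)
  then have "k = x * q" by linarith
  then show "q dvd k" by simp
qed auto

text \<open>Orthogonality: off the multiples of q this is a geometric sum whose ratio is a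
  nontrivial q-th root of unity.\<close>

lemma sum_root_char:
  assumes "q > 0"
  shows "(\<Sum>M\<in>{0..<q}. root_char q (M * k)) = (if q dvd k then of_int q else 0)"
proof -
  have "(\<Sum>M\<in>{0..<q}. root_char q (M * k)) = (\<Sum>j<nat q. root_char q k ^ j)"
    by (rule sum.reindex_bij_witness[of _ int nat]) (auto simp: root_char_power[symmetric])
  also have "\<dots> = (if q dvd k then of_int q else 0)"
  proof (cases "q dvd k")
    case True
    then show ?thesis using assms by (simp add: root_char_eq_1_iff[THEN iffD2])
  next
    case False
    then have "root_char q k \<noteq> 1" using assms by (simp add: root_char_eq_1_iff)
    moreover have "root_char q k ^ nat q = 1"
      using assms by (simp flip: root_char_power)
    ultimately show ?thesis using False by (simp add: geometric_sum)
  qed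
  finally show ?thesis .
qed

lemma bij_betw_unit_residues_mult:
  assumes u: "u \<in> unit_residues q"
  shows "bij_betw (\<lambda>a. u * a mod q) (unit_residues q) (unit_residues q)"
proof -
  have "inj_on (\<lambda>a. u * a mod q) (unit_residues q)"
  proof (rule inj_onI)
    fix a b assume a: "a \<in> unit_residues q" and b: "b \<in> unit_residues q"
      and "u * a mod q = u * b mod q"
    then have "[a = b] (mod q)"
      using u by (auto simp: unit_residues_iff cong_mult_lcancel simp flip: cong_def)
    then show "a = b" using a b by (auto simp: unit_residues_iff cong_def)
  qed
  moreover have "(\<lambda>a. u * a mod q) ` unit_residues q \<subseteq> unit_residues q"
    using u by (auto simp: unit_residues_iff)
  ultimately show ?thesis
    by (simp add: bij_betw_def endo_inj_surj)
qed

text \<open>Replacing a by its inverse is an involution of the units that exchanges the two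
  frequencies.\<close>

lemma kloosterman_commute: "kloosterman q m n = kloosterman q n m"
  unfolding kloosterman_def
  by (rule sum.reindex_bij_witness[of _ "modular_inverse q" "modular_inverse q"])
    (auto simp: modular_inverse_involution modular_inverse_unit_residues add.commute)

lemma kloosterman_cong:
  assumes "[m = m'] (mod q)" "[n = n'] (mod q)"
  shows "kloosterman q m n = kloosterman q m' n'"
  unfolding kloosterman_def
  by (intro sum.cong refl root_char_cong cong_add cong_mult assms cong_refl)

text \<open>The substitution of u a for a permutes the units, and inversion modulo q is
  multiplicative. This symmetry lets a single sum be compared with the moment over all
  frequencies.\<close>

lemma kloosterman_unit_twist:
  assumes u: "u \<in> unit_residues q"
  shows "kloosterman q m n = kloosterman q (m * u) (n * modular_inverse q u)"
proof -
  have "kloosterman q m n = (\<Sum>a\<in>unit_residues q.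
      root_char q (m * (u * a mod q) + n * modular_inverse q (u * a mod q)))"
    unfolding kloosterman_def
    by (rule sum.reindex_bij_betw[OF bij_betw_unit_residues_mult[OF u], symmetric])
  also have "\<dots> = kloosterman q (m * u) (n * modular_inverse q u)"
    unfolding kloosterman_def
  proof (intro sum.cong refl root_char_cong)
    fix a assume a: "a \<in> unit_residues q"
    have "modular_inverse q (u * a mod q) = modular_inverse q u * modular_inverse q a mod q"
    proof (rule modular_inverse_int_eqI)
      have "[u * a mod q * (modular_inverse q u * modular_inverse q a mod q) =
          (u * modular_inverse q u) * (a * modular_inverse q a)] (mod q)"
        unfolding cong_def mod_mult_left_eq mod_mult_right_eq by (simp only: mult_ac)
      also have "[(u * modular_inverse q u) * (a * modular_inverse q a) = 1 * 1] (mod q)"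
        using u a by (intro cong_mult cong_modular_inverse1) (auto simp: unit_residues_iff)
      finally show "[u * a mod q * (modular_inverse q u * modular_inverse q a mod q) = 1] (mod q)"
        by simp
    qed (use a in \<open>auto simp: unit_residues_iff\<close>)
    then show "[m * (u * a mod q) + n * modular_inverse q (u * a mod q) =
        m * u * a + n * modular_inverse q u * modular_inverse q a] (mod q)"
      unfolding mult.assoc by (intro cong_add cong_mult cong_refl) (simp_all add: cong_def)
  qed
  finally show ?thesis .
qed

lemma norm_kloosterman_le: "norm (kloosterman q m n) \<le> card (unit_residues q)"
  unfolding kloosterman_def
  by (rule order_trans[OF norm_sum]) simp

section \<open>The complete fourth moment and its solution count\<close>

lemma sum_times: "sum f A * sum g B = (\<Sum>(a, b)\<in>A \<times> B. f a * g b :: 'a :: semiring_0)"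
  by (simp add: sum_product sum.cartesian_product)

text \<open>The quadruples whose characters are trivial in both frequencies when the product of two
  sums and two conjugate sums is expanded.\<close>

definition moment_solutions :: "int \<Rightarrow> (int \<times> int \<times> int \<times> int) set" where
  "moment_solutions q = {(a, b, c, d) \<in> unit_residues q \<times> unit_residues q \<times> unit_residues q \<times> unit_residues q.
     q dvd a + b - c - d \<and>
     q dvd modular_inverse q a + modular_inverse q b - modular_inverse q c - modular_inverse q d}"

text \<open>The fourth power is (K times its conjugate) squared, hence a sum of characters over
  quadruples of units. Summation over M and over N is orthogonality twice; each surviving quadruple
  contributes q from either variable.\<close>

lemma kloosterman_fourth_moment:
  assumes q: "q > 0"
  shows "(\<Sum>(M, N)\<in>{0..<q} \<times> {0..<q}. norm (kloosterman q M N) ^ 4) =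
    of_int q ^ 2 * real (card (moment_solutions q))"
proof -
  let ?U = "unit_residues q" and ?i = "modular_inverse q"
  let ?s = "\<lambda>(a, b, c, d). a + b - c - d"
  let ?t = "\<lambda>(a, b, c, d). ?i a + ?i b - ?i c - ?i d"
  let ?X = "?U \<times> ?U \<times> ?U \<times> ?U"
  have four: "complex_of_real (norm (kloosterman q M N) ^ 4) =
      (\<Sum>x\<in>?X. root_char q (M * ?s x) * root_char q (N * ?t x))" for M N
  proof -
    let ?f = "\<lambda>a. root_char q (M * a + N * ?i a)"
    have "complex_of_real (norm (kloosterman q M N) ^ 4) =
        (complex_of_real (norm (kloosterman q M N)) ^ 2) ^ 2"
      by simp
    also have "\<dots> = (kloosterman q M N * cnj (kloosterman q M N)) ^ 2"
      by (simp flip: complex_norm_square)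
    also have "\<dots> = sum ?f ?U * (sum ?f ?U * (sum (cnj \<circ> ?f) ?U * sum (cnj \<circ> ?f) ?U))"
      by (simp add: kloosterman_def power2_eq_square mult_ac)
    also have "\<dots> = (\<Sum>(a, b, c, d)\<in>?X. ?f a * (?f b * (cnj (?f c) * cnj (?f d))))"
      unfolding sum_times by (intro sum.cong refl) auto
    also have "\<dots> = (\<Sum>x\<in>?X. root_char q (M * ?s x) * root_char q (N * ?t x))"
      by (intro sum.cong refl)
        (auto simp: cnj_root_char root_char_add[symmetric] algebra_simps)
    finally show ?thesis .
  qed
  have "complex_of_real (\<Sum>(M, N)\<in>{0..<q} \<times> {0..<q}. norm (kloosterman q M N) ^ 4) =
      (\<Sum>(M, N)\<in>{0..<q} \<times> {0..<q}. \<Sum>x\<in>?X. root_char q (M * ?s x) * root_char q (N * ?t x))"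
    unfolding of_real_sum by (intro sum.cong refl) (simp only: case_prod_unfold four)
  also have "\<dots> = (\<Sum>x\<in>?X. \<Sum>(M, N)\<in>{0..<q} \<times> {0..<q}. root_char q (M * ?s x) * root_char q (N * ?t x))"
    by (subst sum.swap) (simp add: case_prod_unfold)
  also have "\<dots> = (\<Sum>x\<in>?X. (\<Sum>M\<in>{0..<q}. root_char q (M * ?s x)) * (\<Sum>N\<in>{0..<q}. root_char q (N * ?t x)))"
    by (simp only: sum_product sum.cartesian_product)
  also have "\<dots> = (\<Sum>x\<in>?X. if q dvd ?s x \<and> q dvd ?t x then of_int q ^ 2 else 0)"
    by (intro sum.cong refl) (auto simp: sum_root_char q power2_eq_square)
  also have "\<dots> = (\<Sum>x\<in>{x\<in>?X. q dvd ?s x \<and> q dvd ?t x}. of_int q ^ 2)"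
    by (rule sum.inter_filter[symmetric]) simp
  also have "{x\<in>?X. q dvd ?s x \<and> q dvd ?t x} = moment_solutions q"
    by (auto simp: moment_solutions_def)
  also have "(\<Sum>x\<in>moment_solutions q. of_int q ^ 2) = complex_of_real (of_int q ^ 2 * real (card (moment_solutions q)))"
    by simp
  finally show ?thesis unfolding of_real_eq_iff .
qed

text \<open>Its cardinality is the ternary divisor function of q: a pair (d, e) stands for the
  factorization of q into d, e and q div (d * e).\<close>

definition divisor_pairs :: "int \<Rightarrow> (int \<times> int) set" where
  "divisor_pairs q = {(d, e). 0 < d \<and> 0 < e \<and> d * e dvd q}"

lemma finite_divisor_pairs:
  assumes "q > 0"
  shows "finite (divisor_pairs q)"
proof (rule finite_subset)
  show "divisor_pairs q \<subseteq> {0..q} \<times> {0..q}"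
    using assms by (auto simp: divisor_pairs_def intro!: zdvd_imp_le intro: dvd_mult_left dvd_mult_right)
qed simp

lemma card_multiples:
  fixes d q :: int
  assumes "0 < d" "d dvd q"
  shows "card {x \<in> {0..<q}. d dvd x} = nat (q div d)"
proof -
  have "{x \<in> {0..<q}. d dvd x} = (\<lambda>k. d * k) ` {0..<q div d}"
    using assms by (auto simp: dvd_def zero_le_mult_iff)
  moreover have "inj_on (\<lambda>k. d * k) {0..<q div d}"
    using assms by (auto intro!: inj_onI)
  ultimately show ?thesis by (simp add: card_image)
qed

text \<open>A zero product distributes the factors of q among u, v and w: take d = gcd(u, q), e =
  gcd(v, q/d), and the remaining factor s = q/(d e) must divide w. For a given factorization the
  triples of multiples number (q/d)(q/e)(q/s) = q^2.\<close>

lemma card_product_zero_le: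
  assumes q: "q > 0"
  shows "card {(u, v, w) \<in> {0..<q} \<times> {0..<q} \<times> {0..<q}. q dvd u * v * w} \<le>
    card (divisor_pairs q) * nat (q ^ 2)" (is "card ?S \<le> _")
proof -
  let ?m = "\<lambda>d. {x \<in> {0..<q}. d dvd x}"
  let ?B = "\<lambda>(d, e). ?m d \<times> ?m e \<times> ?m (q div (d * e))"
  have "?S \<subseteq> (\<Union>p\<in>divisor_pairs q. ?B p)"
  proof clarify
    fix u v w assume u: "u \<in> {0..<q}" and v: "v \<in> {0..<q}" and w: "w \<in> {0..<q}"
      and dvd: "q dvd u * v * w"
    define d where "d = gcd u q"
    have d: "d > 0" "d dvd u" "d dvd q" using q by (auto simp: d_def)
    obtain u' r where u': "u = u' * d" and r: "q = r * d" and cop: "coprime u' r"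
      using gcd_coprime_exists[of u q] q unfolding d_def by auto
    have r0: "r > 0" using q d r by (simp add: zero_less_mult_iff)
    have "d * r dvd d * (u' * (v * w))" using dvd unfolding u' r by (simp only: mult_ac)
    then have "r dvd u' * (v * w)" using d by (subst (asm) dvd_mult_cancel_left) auto
    then have vw: "r dvd v * w" using cop by (metis coprime_commute coprime_dvd_mult_right_iff)
    define e where "e = gcd v r"
    have e: "e > 0" "e dvd v" "e dvd r" using r0 by (auto simp: e_def)
    obtain v' s where v': "v = v' * e" and s: "r = s * e" and cop': "coprime v' s"
      using gcd_coprime_exists[of v r] r0 unfolding e_def by auto
    have "e * s dvd e * (v' * w)" using vw unfolding v' s by (simp only: mult_ac)
    then have "s dvd v' * w" using e by (subst (asm) dvd_mult_cancel_left) auto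
    then have sw: "s dvd w" using cop' by (metis coprime_commute coprime_dvd_mult_right_iff)
    have "q div (d * e) = s" using d e r s by simp
    then have "(u, v, w) \<in> ?B (d, e)" using u v w sw d e by simp
    moreover have "(d, e) \<in> divisor_pairs q" using d e r s by (auto simp: divisor_pairs_def)
    ultimately show "(u, v, w) \<in> (\<Union>p\<in>divisor_pairs q. ?B p)" by blast
  qed
  moreover have "finite (\<Union>p\<in>divisor_pairs q. ?B p)"
  proof (rule finite_subset)
    show "(\<Union>p\<in>divisor_pairs q. ?B p) \<subseteq> {0..<q} \<times> {0..<q} \<times> {0..<q}" by auto
  qed simp
  ultimately have "card ?S \<le> card (\<Union>p\<in>divisor_pairs q. ?B p)" by (rule card_mono[rotated])
  also have "\<dots> \<le> (\<Sum>p\<in>divisor_pairs q. card (?B p))"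
    by (rule card_UN_le[OF finite_divisor_pairs[OF q]])
  also have "\<dots> = (\<Sum>p\<in>divisor_pairs q. nat (q ^ 2))"
  proof (intro sum.cong refl)
    fix p assume "p \<in> divisor_pairs q"
    then obtain d e s where p: "p = (d, e)" "d > 0" "e > 0" "q = d * e * s"
      by (auto simp: divisor_pairs_def dvd_def)
    then have "0 < d * e" by simp
    with p q have s: "s > 0" by (metis zero_less_mult_pos)
    have "card (?B p) = nat (e * s) * (nat (d * s) * nat (d * e))"
      using p s card_multiples[of d q] card_multiples[of e q] card_multiples[of s q]
      by (simp add: card_cartesian_product mult_ac)
    also have "\<dots> = nat (q ^ 2)"
      using p s by (simp flip: nat_mult_distrib add: power2_eq_square mult_ac)
    finally show "card (?B p) = nat (q ^ 2)" .
  qed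
  finally show ?thesis by simp
qed

lemma eq_if_dvd_diff:
  fixes x y q :: int
  assumes "0 \<le> x" "x < q" "0 \<le> y" "y < q" "q dvd x - y"
  shows "x = y"
  using assms by (metis mod_eq_dvd_iff mod_pos_pos_trivial)

text \<open>The inverses sum to (a + b)/(a b) and to (c + d)/(c d), and a + b = c + d, so (a + b)(c
  d - a b) vanishes modulo q. Inserting d = a + b - c factors c d - a b as -(c - a)(c - b). The
  count of solutions becomes that of zero products.\<close>

lemma moment_solutions_dvd:
  assumes "(a, b, c, d) \<in> moment_solutions q"
  shows "q dvd (a + b) * (c - a) * (c - b)"
proof -
  let ?i = "modular_inverse q"
  have U: "a \<in> unit_residues q" "b \<in> unit_residues q" "c \<in> unit_residues q" "d \<in> unit_residues q"
    and 1: "[a + b = c + d] (mod q)" and 2: "[?i a + ?i b = ?i c + ?i d] (mod q)"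
    using assms by (auto simp: moment_solutions_def cong_iff_dvd_diff algebra_simps)
  have inv: "[x * ?i x = 1] (mod q)" if "x \<in> unit_residues q" for x
    using that by (intro cong_modular_inverse1) (auto simp: unit_residues_iff)
  have "[(a + b) * (c * d) = a * b * (?i a + ?i b) * (c * d)] (mod q)"
  proof (rule cong_mult[OF _ cong_refl])
    have "[b * (a * ?i a) + a * (b * ?i b) = b * 1 + a * 1] (mod q)"
      using U by (intro cong_add cong_mult inv cong_refl)
    then show "[a + b = a * b * (?i a + ?i b)] (mod q)"
      by (simp add: cong_sym_eq algebra_simps)
  qed
  also have "[a * b * (?i a + ?i b) * (c * d) = a * b * (?i c + ?i d) * (c * d)] (mod q)"
    by (intro cong_mult 2 cong_refl)
  also have "[a * b * (?i c + ?i d) * (c * d) = a * b * (a + b)] (mod q)"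
  proof -
    have "[a * b * (d * (c * ?i c) + c * (d * ?i d)) = a * b * (d * 1 + c * 1)] (mod q)"
      using U by (intro cong_add cong_mult inv cong_refl)
    also have "[a * b * (d * 1 + c * 1) = a * b * (a + b)] (mod q)"
      using 1 by (intro cong_mult) (auto simp: cong_sym_eq add.commute)
    finally show ?thesis by (simp add: algebra_simps)
  qed
  finally have "[(a + b) * (c * d) = a * b * (a + b)] (mod q)" .
  moreover have "[(a + b) * (c * d) = (a + b) * (c * (a + b - c))] (mod q)"
  proof (intro cong_mult cong_refl)
    show "[d = a + b - c] (mod q)"
      using cong_diff[OF 1 cong_refl[of c]] by (simp add: cong_sym_eq)
  qed
  ultimately have "[(a + b) * (c * (a + b - c)) = a * b * (a + b)] (mod q)"
    by (metis cong_sym cong_trans)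
  then have "q dvd (a + b) * (c * (a + b - c)) - a * b * (a + b)"
    by (simp add: cong_iff_dvd_diff)
  also have "(a + b) * (c * (a + b - c)) - a * b * (a + b) = - ((a + b) * (c - a) * (c - b))"
    by (simp add: algebra_simps)
  finally show ?thesis by simp
qed

text \<open>The linear map \<open>(a, b, c) \<mapsto> (a + b, c - a, c - b)\<close> has determinant \<open>\<plusminus>2\<close>; the boolean
  component separates the at most two preimages modulo an even \<open>q\<close>.\<close>

lemma card_moment_solutions_le:
  assumes q: "q > 0"
  shows "card (moment_solutions q) \<le> 2 * (card (divisor_pairs q) * nat (q ^ 2))"
proof -
  let ?S = "{(u, v, w) \<in> {0..<q} \<times> {0..<q} \<times> {0..<q}. q dvd u * v * w}"
  let ?h = "\<lambda>(a, b, c, d). (((a + b) mod q, (c - a) mod q, (c - b) mod q), 2 * c < q)"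
  have fin: "finite ?S" by (rule finite_subset[of _ "{0..<q} \<times> {0..<q} \<times> {0..<q}"]) auto
  have "card (moment_solutions q) \<le> card (?S \<times> (UNIV :: bool set))"
  proof (rule card_inj_on_le[of ?h])
    show "inj_on ?h (moment_solutions q)"
    proof (rule inj_onI)
      fix X Y assume X: "X \<in> moment_solutions q" and Y: "Y \<in> moment_solutions q"
        and eq: "?h X = ?h Y"
      obtain a b c d where X_eq: "X = (a, b, c, d)" by (metis prod.exhaust)
      obtain a' b' c' d' where Y_eq: "Y = (a', b', c', d')" by (metis prod.exhaust)
      note x = X[unfolded X_eq] and y = Y[unfolded Y_eq]
      have 1: "(a + b) mod q = (a' + b') mod q" and 2: "(c - a) mod q = (c' - a') mod q"
        and 3: "(c - b) mod q = (c' - b') mod q" and 4: "(2 * c < q) = (2 * c' < q)"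
        using eq unfolding X_eq Y_eq by simp_all
      have b: "0 \<le> a" "a < q" "0 \<le> b" "b < q" "0 \<le> c" "c < q" "0 \<le> d" "d < q"
        "0 \<le> a'" "a' < q" "0 \<le> b'" "b' < q" "0 \<le> c'" "c' < q" "0 \<le> d'" "d' < q"
        and d: "q dvd a + b - c - d" "q dvd a' + b' - c' - d'"
        using x y by (auto simp: moment_solutions_def unit_residues_iff)
      have 1: "q dvd (a + b) - (a' + b')" and 2: "q dvd (c - a) - (c' - a')"
        and 3: "q dvd (c - b) - (c' - b')" using 1 2 3 by (simp_all add: mod_eq_dvd_iff)
      \<comment> \<open>The three linear forms add up to 2 c. Since c and c' lie on the same side of
        q/2, twice their difference is smaller than q in absolute value, so divisibility by q forces
        it to be 0.\<close>
      have "q dvd ((a + b) - (a' + b')) + ((c - a) - (c' - a')) + ((c - b) - (c' - b'))"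
        by (intro dvd_add 1 2 3)
      then have "q dvd 2 * (c - c')" by (simp add: algebra_simps)
      moreover have "\<bar>2 * (c - c')\<bar> < q" using 4 b by auto
      ultimately have "2 * (c - c') = 0" by (metis dvd_imp_le_int not_less abs_of_pos q)
      then have c: "c = c'" by simp
      have a: "a = a'"
        using 2 b c by (intro eq_if_dvd_diff[of _ q]) (auto simp: dvd_diff_commute)
      have bb: "b = b'"
        using 3 b c by (intro eq_if_dvd_diff[of _ q]) (auto simp: dvd_diff_commute)
      have "q dvd (a + b - c - d) - (a' + b' - c' - d')" by (intro dvd_diff d)
      then have "d = d'"
        using b c a bb by (intro eq_if_dvd_diff[of _ q]) (auto simp: dvd_diff_commute)
      with a bb c show "X = Y" by (simp add: X_eq Y_eq)
    qed
    show "?h ` moment_solutions q \<subseteq> ?S \<times> UNIV"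
    proof (rule image_subsetI)
      fix x assume x: "x \<in> moment_solutions q"
      obtain a b c d where abcd: "x = (a, b, c, d)" by (metis prod.exhaust)
      have "[(a + b) mod q * ((c - a) mod q) * ((c - b) mod q) = (a + b) * (c - a) * (c - b)] (mod q)"
        by (intro cong_mult) (auto simp: cong_def)
      then have "q dvd (a + b) mod q * ((c - a) mod q) * ((c - b) mod q)"
        using moment_solutions_dvd x unfolding abcd by (metis cong_dvd_iff)
      then have "(((a + b) mod q, (c - a) mod q, (c - b) mod q), 2 * c < q) \<in> ?S \<times> UNIV"
        using q by simp
      then show "?h x \<in> ?S \<times> UNIV" by (simp only: abcd prod.case)
    qed
    show "finite (?S \<times> (UNIV :: bool set))" using fin by (intro finite_cartesian_product) auto
  qed
  also have "\<dots> = 2 * card ?S" by (simp add: card_cartesian_product)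
  finally show ?thesis using card_product_zero_le[OF q] by linarith
qed

text \<open>The unit twists \<open>(m u, n u\<inverse>)\<close> leave the sum unchanged and hit each pair at most
  \<open>\<bar>m\<bar>\<close> times, so one Kloosterman sum is bounded by the complete fourth moment.\<close>

lemma kloosterman_fourth_power_le:
  assumes q: "q > 0" and m: "m \<noteq> 0"
  shows "real (card (unit_residues q)) * norm (kloosterman q m n) ^ 4 \<le>
    2 * of_int \<bar>m\<bar> * of_int q ^ 4 * real (card (divisor_pairs q))"
proof -
  let ?U = "unit_residues q" and ?T = "{0..<q} \<times> {0..<q}"
  let ?h = "\<lambda>u. (m * u mod q, n * modular_inverse q u mod q)"
  let ?g = "\<lambda>(M, N). norm (kloosterman q M N) ^ 4"
  \<comment> \<open>Division with remainder of \<open>\<bar>m\<bar> * u\<close> by q: on a fibre the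
    remainder is fixed, so the quotient determines u, and it takes at most
    \<open>\<bar>m\<bar>\<close> values because u < q.\<close>
  have fibre: "card {u \<in> ?U. ?h u = y} \<le> nat \<bar>m\<bar>" for y
  proof -
    have "card {u \<in> ?U. ?h u = y} \<le> card {0..<\<bar>m\<bar>}"
    proof (rule card_inj_on_le[of "\<lambda>u. \<bar>m\<bar> * u div q"])
      show "inj_on (\<lambda>u. \<bar>m\<bar> * u div q) {u \<in> ?U. ?h u = y}"
      proof (rule inj_onI)
        fix u v assume u: "u \<in> {u \<in> ?U. ?h u = y}" and v: "v \<in> {u \<in> ?U. ?h u = y}"
          and div: "\<bar>m\<bar> * u div q = \<bar>m\<bar> * v div q"
        have "m * u mod q = m * v mod q" using u v by auto
        then have "\<bar>m\<bar> * u mod q = \<bar>m\<bar> * v mod q"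
          by (auto simp: abs_if intro: mod_minus_cong)
        with div have "\<bar>m\<bar> * u = \<bar>m\<bar> * v" by (metis mult_div_mod_eq)
        then show "u = v" using m by simp
      qed
      show "(\<lambda>u. \<bar>m\<bar> * u div q) ` {u \<in> ?U. ?h u = y} \<subseteq> {0..<\<bar>m\<bar>}"
      proof clarify
        fix u assume "u \<in> ?U"
        then have u: "0 \<le> u" "u < q" by (auto simp: unit_residues_iff)
        have "\<bar>m\<bar> * u < \<bar>m\<bar> * q" using u m by simp
        then have "\<bar>m\<bar> * u div q < \<bar>m\<bar>"
        proof -
          have "q * (\<bar>m\<bar> * u div q) \<le> \<bar>m\<bar> * u"
            using q mult_div_mod_eq[of q "\<bar>m\<bar> * u"] pos_mod_sign[of q "\<bar>m\<bar> * u"] by linarith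
          also note \<open>\<bar>m\<bar> * u < \<bar>m\<bar> * q\<close>
          finally show ?thesis using q by (simp add: mult.commute)
        qed
        then show "\<bar>m\<bar> * u div q \<in> {0..<\<bar>m\<bar>}"
          using u q by (auto simp: pos_imp_zdiv_nonneg_iff)
      qed
    qed simp
    then show ?thesis by simp
  qed
  have "real (card ?U) * norm (kloosterman q m n) ^ 4 = (\<Sum>u\<in>?U. norm (kloosterman q m n) ^ 4)"
    by simp
  also have "\<dots> = (\<Sum>u\<in>?U. ?g (?h u))"
  proof (intro sum.cong refl)
    fix u assume "u \<in> ?U"
    then have "kloosterman q m n = kloosterman q (m * u) (n * modular_inverse q u)"
      by (rule kloosterman_unit_twist)
    also have "\<dots> = kloosterman q (m * u mod q) (n * modular_inverse q u mod q)"
      by (rule kloosterman_cong) (auto simp: cong_def)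
    finally show "norm (kloosterman q m n) ^ 4 = ?g (?h u)" by simp
  qed
  also have "\<dots> = (\<Sum>y\<in>?T. \<Sum>u\<in>{u \<in> ?U. ?h u = y}. ?g (?h u))"
    using q by (intro sum.group[symmetric]) auto
  also have "\<dots> = (\<Sum>y\<in>?T. real (card {u \<in> ?U. ?h u = y}) * ?g y)"
  proof (rule sum.cong[OF refl])
    fix y
    have "(\<Sum>u\<in>{u \<in> ?U. ?h u = y}. ?g (?h u)) = (\<Sum>u\<in>{u \<in> ?U. ?h u = y}. ?g y)"
      by (rule sum.cong[OF refl]) (simp only: mem_Collect_eq)
    then show "(\<Sum>u\<in>{u \<in> ?U. ?h u = y}. ?g (?h u)) = real (card {u \<in> ?U. ?h u = y}) * ?g y"
      by (simp only: sum_constant)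
  qed
  also have "\<dots> \<le> (\<Sum>y\<in>?T. of_int \<bar>m\<bar> * ?g y)"
  proof (intro sum_mono mult_right_mono)
    fix y show "real (card {u \<in> ?U. ?h u = y}) \<le> of_int \<bar>m\<bar>"
      using fibre[of y] by linarith
  qed (auto simp: case_prod_unfold)
  also have "\<dots> = of_int \<bar>m\<bar> * (of_int q ^ 2 * real (card (moment_solutions q)))"
    unfolding sum_distrib_left[symmetric] kloosterman_fourth_moment[OF q] ..
  also have "\<dots> \<le> of_int \<bar>m\<bar> * (of_int q ^ 2 * (2 * (real (card (divisor_pairs q)) * of_int q ^ 2)))"
  proof (intro mult_left_mono)
    have "real (card (moment_solutions q)) \<le> real (2 * (card (divisor_pairs q) * nat (q ^ 2)))"
      using card_moment_solutions_le[OF q] by (rule of_nat_mono)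
    also have "\<dots> = 2 * (real (card (divisor_pairs q)) * of_int q ^ 2)"
      using q by simp
    finally show "real (card (moment_solutions q)) \<le> 2 * (real (card (divisor_pairs q)) * of_int q ^ 2)" .
  qed auto
  finally show ?thesis by (simp add: power2_eq_square power4_eq_xxxx algebra_simps)
qed


section \<open>Divisor averages and cancellation in the mean over moduli\<close>

lemma of_nat_div_bounds:
  assumes "b > 0"
  shows "real (a div b) \<le> real a / real b" "real a / real b - 1 \<le> real (a div b)"
proof -
  have "real a = real b * real (a div b) + real (a mod b)"
    by (metis mult_div_mod_eq of_nat_add of_nat_mult)
  moreover have "real (a mod b) < real b" using assms by simp
  ultimately show "real (a div b) \<le> real a / real b" "real a / real b - 1 \<le> real (a div b)"
    using assms by (auto simp: field_simps)
qed

text \<open>Exchanging the summations, each pair (d, e) is counted once for every multiple of d e up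
  to N, at most N/(d e) times; the double sum of 1/(d e) is the square of a harmonic number.\<close>

lemma sum_card_divisor_pairs_le:
  "(\<Sum>q=1..N. real (card (divisor_pairs (int q)))) \<le> real N * harm N ^ 2"
proof -
  let ?m = "\<lambda>(d, e). {q \<in> {1..N}. d * e dvd q}"
  have card_dp: "card (divisor_pairs (int q)) = card {p \<in> {1..N} \<times> {1..N}. q \<in> ?m p}"
    if q: "q \<in> {1..N}" for q
  proof (rule bij_betw_same_card[of "\<lambda>(d, e). (nat d, nat e)"],
      rule bij_betw_byWitness[where f' = "\<lambda>(d, e). (int d, int e)"])
    have le: "d \<le> int N" "e \<le> int N" if "d > 0" "e > 0" "d * e dvd int q" for d e :: int
      using that q zdvd_imp_le[of d "int q"] zdvd_imp_le[of e "int q"]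
      by (auto dest: dvd_mult_left dvd_mult_right)
    show "(\<lambda>(d, e). (nat d, nat e)) ` divisor_pairs (int q) \<subseteq> {p \<in> {1..N} \<times> {1..N}. q \<in> ?m p}"
    proof (rule image_subsetI)
      fix x assume x: "x \<in> divisor_pairs (int q)"
      obtain d e where x_eq: "x = (d, e)" by fastforce
      with x have "(d, e) \<in> divisor_pairs (int q)" by simp
      then have de: "d > 0" "e > 0" "d * e dvd int q" by (auto simp: divisor_pairs_def)
      then have "nat d * nat e dvd q" by (simp flip: nat_mult_distrib add: nat_dvd_iff)
      with de le[OF de] q show "(case x of (d, e) \<Rightarrow> (nat d, nat e)) \<in> {p \<in> {1..N} \<times> {1..N}. q \<in> ?m p}"
        by (auto simp: x_eq)
    qed
    show "(\<lambda>(d, e). (int d, int e)) ` {p \<in> {1..N} \<times> {1..N}. q \<in> ?m p} \<subseteq> divisor_pairs (int q)"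
      by (auto simp: divisor_pairs_def simp flip: of_nat_mult)
  qed (auto simp: divisor_pairs_def)
  have "(\<Sum>q=1..N. real (card (divisor_pairs (int q)))) =
      (\<Sum>q=1..N. \<Sum>p\<in>{1..N} \<times> {1..N}. if q \<in> ?m p then 1 else 0)"
  proof (rule sum.cong[OF refl])
    fix q assume q: "q \<in> {1..N}"
    have "(\<Sum>p\<in>{1..N} \<times> {1..N}. if q \<in> ?m p then 1 else 0) =
        (\<Sum>p\<in>{p \<in> {1..N} \<times> {1..N}. q \<in> ?m p}. 1 :: real)"
      by (rule sum.inter_filter[symmetric]) simp
    also have "\<dots> = real (card (divisor_pairs (int q)))"
      by (simp only: card_dp[OF q] sum_constant mult_1_right)
    finally show "real (card (divisor_pairs (int q))) =
        (\<Sum>p\<in>{1..N} \<times> {1..N}. if q \<in> ?m p then 1 else 0)" ..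
  qed
  also have "\<dots> = (\<Sum>p\<in>{1..N} \<times> {1..N}. \<Sum>q=1..N. if q \<in> ?m p then 1 else 0)"
    by (rule sum.swap)
  also have "\<dots> \<le> (\<Sum>p\<in>{1..N} \<times> {1..N}. real N * (inverse (real (fst p)) * inverse (real (snd p))))"
  proof (rule sum_mono)
    fix p :: "nat \<times> nat" assume "p \<in> {1..N} \<times> {1..N}"
    then obtain d e where p: "p = (d, e)" and de: "d \<in> {1..N}" "e \<in> {1..N}" by auto
    have "?m (d, e) \<subseteq> (\<lambda>k. d * e * k) ` {1..N div (d * e)}"
    proof
      fix q assume "q \<in> ?m (d, e)"
      then obtain k where k: "q = d * e * k" "1 \<le> q" "q \<le> N" by (auto elim: dvdE)
      moreover from k have "1 \<le> k" by (cases k) auto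
      moreover from k have "k \<le> N div (d * e)"
        using de by (simp add: less_eq_div_iff_mult_less_eq mult.commute)
      ultimately show "q \<in> (\<lambda>k. d * e * k) ` {1..N div (d * e)}"
        by (intro image_eqI[of _ _ k]) (simp_all only: atLeastAtMost_iff)
    qed
    then have "card (?m (d, e)) \<le> N div (d * e)"
      using surj_card_le[of "{1..N div (d * e)}"] by simp
    then have "real (card (?m (d, e))) \<le> real (N div (d * e))" by simp
    also have "\<dots> \<le> real N / real (d * e)"
      using de by (intro of_nat_div_bounds) auto
    finally show "(\<Sum>q=1..N. if q \<in> ?m p then 1 else 0) \<le>
        real N * (inverse (real (fst p)) * inverse (real (snd p)))"
      by (simp add: p sum.If_cases Int_def field_simps)
  qed
  also have "\<dots> = real N * harm N ^ 2"
    unfolding harm_def power2_eq_square sum_times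
    by (subst sum_distrib_left) (intro sum.cong refl, auto)
  finally show ?thesis .
qed

text \<open>Moduli with fewer than \<open>\<epsilon> q\<close> units are handled by the trivial bound, which avoids any lower
  bound for Euler's function.\<close>

lemma norm_kloosterman_le_powr:
  assumes q: "q > 0" and m: "m \<noteq> 0" and \<epsilon>: "0 < \<epsilon>"
  shows "norm (kloosterman q m n) \<le> \<epsilon> * of_int q +
    (1 + 2 * of_int \<bar>m\<bar> / \<epsilon>) * (of_int q powr (3 / 4) * real (card (divisor_pairs q)))"
    (is "_ \<le> _ + ?C * (?p * ?D)")
proof (cases "real (card (unit_residues q)) \<le> \<epsilon> * of_int q")
  case True
  have "0 \<le> ?C * (?p * ?D)" using \<epsilon> by (intro mult_nonneg_nonneg add_nonneg_nonneg) auto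
  then show ?thesis using norm_kloosterman_le[of q m n] True by linarith
next
  case False
  let ?K = "norm (kloosterman q m n)"
  have "(1, 1) \<in> divisor_pairs q" by (simp add: divisor_pairs_def)
  then have "card (divisor_pairs q) > 0"
    using finite_divisor_pairs[OF q] by (auto simp: card_gt_0_iff)
  then have D: "?D \<ge> 1" by simp
  have C: "?C \<ge> 1" using \<epsilon> by simp
  have "\<epsilon> * of_int q * ?K ^ 4 \<le> real (card (unit_residues q)) * ?K ^ 4"
    using False by (intro mult_right_mono) auto
  also have "\<dots> \<le> 2 * of_int \<bar>m\<bar> * of_int q ^ 4 * ?D"
    by (rule kloosterman_fourth_power_le[OF q m])
  finally have "?K ^ 4 \<le> (2 * of_int \<bar>m\<bar> / \<epsilon>) * (of_int q ^ 3 * ?D)"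
    using q \<epsilon> by (simp add: field_simps power4_eq_xxxx power3_eq_cube)
  also have "\<dots> \<le> ?C * (of_int q ^ 3 * ?D)"
    using q \<epsilon> by (intro mult_right_mono) auto
  \<comment> \<open>Both ?C and ?D are at least 1, the summand 1 in ?C being there for this purpose.
    Raising them to the fourth power makes the right side a perfect fourth power, with q^3 the
    fourth power of q to the 3/4.\<close>
  also have "\<dots> \<le> ?C ^ 4 * (?p ^ 4 * ?D ^ 4)"
  proof (intro mult_mono)
    show "?C \<le> ?C ^ 4" "?D \<le> ?D ^ 4" using C D by (auto intro!: self_le_power)
    have "?p ^ 4 = of_int q powr (3 / 4 * real 4)"
      using q by (subst powr_power) auto
    also have "\<dots> = of_int q ^ 3" using q by (simp add: powr_numeral)
    finally show "of_int q ^ 3 \<le> ?p ^ 4" by simp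
  qed (use q C in auto)
  also have "\<dots> = (?C * (?p * ?D)) ^ 4" by (simp add: power_mult_distrib)
  finally have "?K \<le> ?C * (?p * ?D)"
    by (rule power_le_imp_le_base[of _ 3, simplified]) (use C q in auto)
  moreover have "0 \<le> \<epsilon> * of_int q" using q \<epsilon> by simp
  ultimately show ?thesis by linarith
qed

text \<open>Summed over q \<le> N, the linear term contributes at most \<epsilon> N^2 and the other
  term N to the 7/4 times a squared logarithm, which is o(N^2). The bound requires a nonzero first
  frequency; if m = 0, symmetry exchanges m and n.\<close>

lemma sum_norm_kloosterman_tendsto_0:
  assumes "m \<noteq> 0 \<or> n \<noteq> 0"
  shows "(\<lambda>N. (\<Sum>q=1..N. norm (kloosterman (int q) m n)) / real N ^ 2) \<longlonglongrightarrow> 0"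
proof -
  have main: "(\<lambda>N. (\<Sum>q=1..N. norm (kloosterman (int q) m n)) / real N ^ 2) \<longlonglongrightarrow> 0"
    if m: "m \<noteq> 0" for m n
  proof (rule tendstoI)
    fix r :: real assume r: "r > 0"
    define \<epsilon> where "\<epsilon> = r / 2"
    define C where "C = 1 + 2 * of_int \<bar>m\<bar> / \<epsilon>"
    have \<epsilon>: "\<epsilon> > 0" and C: "C \<ge> 1" using r by (auto simp: \<epsilon>_def C_def)
    have bound: "(\<Sum>q=1..N. norm (kloosterman (int q) m n)) / real N ^ 2 \<le>
        \<epsilon> + C * (real N powr (7 / 4) * (1 + ln (real N)) ^ 2 / real N ^ 2)" if N: "N > 0" for N
    proof -
      \<comment> \<open>The sequence \<open>harm n - ln n\<close> decreases from its value 1 at n =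
        1.\<close>
      have harm: "harm N \<le> 1 + ln (real N)"
        using euler_mascheroni_sequence_decreasing[of 1 N] N by (simp add: harm_def)
      have "(\<Sum>q=1..N. norm (kloosterman (int q) m n)) \<le>
          (\<Sum>q=1..N. \<epsilon> * real N + C * (real N powr (3 / 4) * real (card (divisor_pairs (int q)))))"
      proof (intro sum_mono)
        fix q assume q: "q \<in> {1..N}"
        have "norm (kloosterman (int q) m n) \<le> \<epsilon> * of_int (int q) +
            C * (of_int (int q) powr (3 / 4) * real (card (divisor_pairs (int q))))"
          unfolding C_def by (rule norm_kloosterman_le_powr) (use q m \<epsilon> in auto)
        also have "\<dots> \<le> \<epsilon> * real N + C * (real N powr (3 / 4) * real (card (divisor_pairs (int q))))"
          using q \<epsilon> C by (intro add_mono mult_left_mono mult_right_mono powr_mono2) auto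
        finally show "norm (kloosterman (int q) m n) \<le>
          \<epsilon> * real N + C * (real N powr (3 / 4) * real (card (divisor_pairs (int q))))" .
      qed
      also have "\<dots> = \<epsilon> * real N ^ 2 +
          C * (real N powr (3 / 4) * (\<Sum>q=1..N. real (card (divisor_pairs (int q)))))"
        by (simp add: sum.distrib sum_distrib_left power2_eq_square)
      also have "\<dots> \<le> \<epsilon> * real N ^ 2 + C * (real N powr (3 / 4) * (real N * (1 + ln (real N)) ^ 2))"
        using C harm sum_card_divisor_pairs_le[of N]
        by (intro add_left_mono mult_left_mono order_trans[OF sum_card_divisor_pairs_le]
            power_mono) (auto simp: harm_nonneg)
      also have "real N powr (3 / 4) * (real N * (1 + ln (real N)) ^ 2) =
          real N powr (7 / 4) * (1 + ln (real N)) ^ 2"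
        using N powr_add[of "real N" "3 / 4" 1] by simp
      finally show ?thesis using N by (simp add: divide_simps)
    qed
    have "(\<lambda>N. C * (real N powr (7 / 4) * (1 + ln (real N)) ^ 2 / real N ^ 2)) \<longlonglongrightarrow> C * 0"
      by (intro tendsto_mult_left) real_asymp
    then have "eventually (\<lambda>N. C * (real N powr (7 / 4) * (1 + ln (real N)) ^ 2 / real N ^ 2) < \<epsilon>) sequentially"
      using \<epsilon> by (intro order_tendstoD) auto
    then show "eventually (\<lambda>N. dist ((\<Sum>q=1..N. norm (kloosterman (int q) m n)) / real N ^ 2) 0 < r)
        sequentially"
      using eventually_gt_at_top[of 0]
    proof eventually_elim
      case (elim N)
      have "0 \<le> (\<Sum>q=1..N. norm (kloosterman (int q) m n)) / real N ^ 2"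
        by (intro divide_nonneg_nonneg sum_nonneg) auto
      then show ?case using bound[of N] elim unfolding \<epsilon>_def dist_real_def by linarith
    qed
  qed
  from assms show ?thesis
    using main[of m n] main[of n m] by (auto simp: kloosterman_commute[of _ n m])
qed

section \<open>Averages of Euler's function\<close>

definition moebius :: "nat \<Rightarrow> real" where
  "moebius n = (if squarefree n then (- 1) ^ card (prime_factors n) else 0)"

lemma abs_moebius_le: "\<bar>moebius n\<bar> \<le> 1"
  by (simp add: moebius_def)

lemma prod_prime_factors_squarefree:
  fixes d :: nat
  assumes "squarefree d"
  shows "\<Prod>(prime_factors d) = d"
proof -
  have "d > 0" using assms by (cases d) auto
  then have "d = (\<Prod>p\<in>prime_factors d. p ^ multiplicity p d)"
    by (rule prime_factorization_nat)
  also have "\<dots> = \<Prod>(prime_factors d)"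
  proof (rule prod.cong[OF refl])
    fix p assume p: "p \<in> prime_factors d"
    then have "multiplicity p d = 1"
      using assms \<open>d > 0\<close> by (auto simp: squarefree_factorial_semiring')
    then show "p ^ multiplicity p d = p" by simp
  qed
  finally show ?thesis ..
qed

lemma prime_factors_Prod_primes:
  fixes S :: "nat set"
  assumes "finite S" "\<And>p. p \<in> S \<Longrightarrow> prime p"
  shows "prime_factors (\<Prod>S) = S"
proof -
  have "0 \<notin> S" using assms(2) not_prime_0 by blast
  then show ?thesis
    using assms by (subst prime_factors_prod) (auto simp: prime_prime_factors)
qed

lemma squarefree_Prod_primes:
  fixes S :: "nat set"
  assumes "\<And>p. p \<in> S \<Longrightarrow> prime p"
  shows "squarefree (\<Prod>S)"
  using assms by (intro squarefree_prod_coprime) (auto intro: primes_coprime squarefree_prime)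

text \<open>Expanding the product of the factors 1 - 1/p yields a sum over sets of primes dividing
  q. Taking products identifies these sets with the squarefree divisors of q, and the remaining
  divisors carry the Moebius value 0.\<close>

lemma totient_eq_moebius_sum:
  assumes q: "q > 0"
  shows "real (totient q) = (\<Sum>d | d dvd q. moebius d * (real q / real d))"
proof -
  let ?P = "prime_factors q"
  have "real (totient q) = real q * (\<Prod>p\<in>?P. 1 - 1 / real p)"
    by (rule totient_formula2)
  also have "\<dots> = real q * (\<Sum>S\<in>Pow ?P. (- 1) ^ card S * (\<Prod>p\<in>S. 1 / real p))"
    by (simp add: prod_diff_conv_sum)
  also have "\<dots> = (\<Sum>S\<in>Pow ?P. moebius (\<Prod>S) * (real q / real (\<Prod>S)))"
    unfolding sum_distrib_left
  proof (rule sum.cong[OF refl])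
    fix S assume "S \<in> Pow ?P"
    then have S: "finite S" "\<And>p. p \<in> S \<Longrightarrow> prime p"
      by (auto intro: finite_subset)
    show "real q * ((- 1) ^ card S * (\<Prod>p\<in>S. 1 / real p)) = moebius (\<Prod>S) * (real q / real (\<Prod>S))"
      using S by (simp add: moebius_def squarefree_Prod_primes prime_factors_Prod_primes prod_dividef)
  qed
  also have "\<dots> = (\<Sum>d | d dvd q \<and> squarefree d. moebius d * (real q / real d))"
  proof (rule sum.reindex_bij_witness[of _ prime_factors Prod])
    fix S assume S': "S \<in> Pow ?P"
    then have S: "finite S" "\<And>p. p \<in> S \<Longrightarrow> prime p"
      by (auto intro: finite_subset)
    show "prime_factors (\<Prod>S) = S" using S by (rule prime_factors_Prod_primes)
    have "\<Prod>S dvd \<Prod>?P" using S' by (intro prod_dvd_prod_subset) auto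
    also have "\<Prod>?P dvd (\<Prod>p\<in>?P. p ^ multiplicity p q)"
      by (intro prod_dvd_prod) (auto simp: prime_factors_multiplicity intro: dvd_power)
    also have "\<dots> = q" using q by (rule prime_factorization_nat[symmetric])
    finally show "\<Prod>S \<in> {d. d dvd q \<and> squarefree d}"
      using S by (auto simp: squarefree_Prod_primes)
  next
    fix d assume d: "d \<in> {d. d dvd q \<and> squarefree d}"
    then show "\<Prod>(prime_factors d) = d" by (auto simp: prod_prime_factors_squarefree)
    show "prime_factors d \<in> Pow ?P" using d q by (auto simp: in_prime_factors_iff)
  qed auto
  also have "\<dots> = (\<Sum>d | d dvd q. moebius d * (real q / real d))"
    by (rule sum.mono_neutral_left) (use q in \<open>auto simp: moebius_def\<close>)
  finally show ?thesis .
qed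

text \<open>A discrete form of integrating x^k: the increment of x^(k+1) from n to n + 1 lies
  between (k + 1) n^k and (k + 1) (n + 1)^k, and these increments telescope.\<close>

lemma sum_powers_bounds:
  "real n ^ Suc k \<le> real (Suc k) * (\<Sum>e=1..n. real e ^ k)"
  "real (Suc k) * (\<Sum>e=1..n. real e ^ k) \<le> real n ^ Suc k + real (Suc k) * real n ^ k"
proof -
  have diff: "x ^ Suc k - y ^ Suc k \<le> real (Suc k) * x ^ k"
    "real (Suc k) * y ^ k \<le> x ^ Suc k - y ^ Suc k" if "0 \<le> y" "x = y + 1" for x y :: real
  proof -
    have eq: "x ^ Suc k - y ^ Suc k = (\<Sum>i<Suc k. y ^ (k - i) * x ^ i)"
      using that by (simp add: power_diff_sumr2 del: power_Suc)
    have "(\<Sum>i<Suc k. y ^ (k - i) * x ^ i) \<le> (\<Sum>i<Suc k. x ^ (k - i) * x ^ i)"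
      using that by (intro sum_mono mult_right_mono power_mono) auto
    also have "\<dots> = real (Suc k) * x ^ k" by (simp flip: power_add)
    finally show "x ^ Suc k - y ^ Suc k \<le> real (Suc k) * x ^ k" using eq by simp
    have "real (Suc k) * y ^ k = (\<Sum>i<Suc k. y ^ (k - i) * y ^ i)" by (simp flip: power_add)
    also have "\<dots> \<le> (\<Sum>i<Suc k. y ^ (k - i) * x ^ i)"
      using that by (intro sum_mono mult_left_mono power_mono) auto
    finally show "real (Suc k) * y ^ k \<le> x ^ Suc k - y ^ Suc k" using eq by simp
  qed
  show "real n ^ Suc k \<le> real (Suc k) * (\<Sum>e=1..n. real e ^ k)"
  proof (induction n)
    case (Suc n)
    have "real (Suc k) * (\<Sum>e=1..Suc n. real e ^ k) =
        real (Suc k) * (\<Sum>e=1..n. real e ^ k) + real (Suc k) * real (Suc n) ^ k"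
      by (simp add: ring_distribs)
    then show ?case using Suc diff(1)[of "real n" "real (Suc n)"] by simp
  qed simp
  show "real (Suc k) * (\<Sum>e=1..n. real e ^ k) \<le> real n ^ Suc k + real (Suc k) * real n ^ k"
  proof (induction n)
    case (Suc n)
    have "real (Suc k) * (\<Sum>e=1..Suc n. real e ^ k) =
        real (Suc k) * (\<Sum>e=1..n. real e ^ k) + real (Suc k) * real (Suc n) ^ k"
      by (simp add: ring_distribs)
    then show ?case using Suc diff(2)[of "real n" "real (Suc n)"] by simp
  qed simp
qed

lemma sum_powers_tendsto:
  "(\<lambda>n. (\<Sum>e=1..n. real e ^ k) / real n ^ Suc k) \<longlonglongrightarrow> 1 / real (Suc k)"
proof (rule tendsto_sandwich)
  show "(\<lambda>n. 1 / real (Suc k)) \<longlonglongrightarrow> 1 / real (Suc k)" by simp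
  have "(\<lambda>n. 1 / real (Suc k) + 1 / real n) \<longlonglongrightarrow> 1 / real (Suc k) + 0"
    by (intro tendsto_intros lim_1_over_n)
  then show "(\<lambda>n. 1 / real (Suc k) + 1 / real n) \<longlonglongrightarrow> 1 / real (Suc k)" by simp
  show "eventually (\<lambda>n. 1 / real (Suc k) \<le> (\<Sum>e=1..n. real e ^ k) / real n ^ Suc k) sequentially"
    using eventually_gt_at_top[of 0]
  proof eventually_elim
    case (elim n)
    then show ?case
      using sum_powers_bounds(1)[of n k] by (simp add: divide_simps mult.commute)
  qed
  show "eventually (\<lambda>n. (\<Sum>e=1..n. real e ^ k) / real n ^ Suc k \<le> 1 / real (Suc k) + 1 / real n) sequentially"
    using eventually_gt_at_top[of 0]
  proof eventually_elim
    case (elim n)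
    have "(\<Sum>e=1..n. real e ^ k) \<le> real n ^ Suc k / real (Suc k) + real n ^ k"
      using sum_powers_bounds(2)[of k n]
      by (simp add: field_simps del: power_Suc of_nat_Suc)
    then have "(\<Sum>e=1..n. real e ^ k) / real n ^ Suc k \<le>
        (real n ^ Suc k / real (Suc k) + real n ^ k) / real n ^ Suc k"
      by (rule divide_right_mono) simp
    also have "\<dots> = 1 / real (Suc k) + 1 / real n"
      using elim by (simp add: add_divide_distrib)
    finally show ?case .
  qed
qed

text \<open>Writing q = d e separates the variables, since q^k * (q/d) = d^k * e^(k+1).\<close>

lemma sum_totient_eq_moebius:
  "(\<Sum>q=1..N. real q ^ k * real (totient q)) =
    (\<Sum>d=1..N. moebius d * real d ^ k * (\<Sum>e=1..N div d. real e ^ Suc k))"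
proof -
  have "(\<Sum>q=1..N. real q ^ k * real (totient q)) =
      (\<Sum>q=1..N. \<Sum>d | d dvd q. real q ^ k * (moebius d * (real q / real d)))"
    by (intro sum.cong refl) (simp add: totient_eq_moebius_sum sum_distrib_left)
  also have "\<dots> = (\<Sum>(q, d)\<in>(SIGMA q:{1..N}. {d. d dvd q}). real q ^ k * (moebius d * (real q / real d)))"
    by (rule sum.Sigma) auto
  also have "\<dots> = (\<Sum>(d, e)\<in>(SIGMA d:{1..N}. {1..N div d}). moebius d * real d ^ k * real e ^ Suc k)"
  proof (rule sum.reindex_bij_witness[of _ "\<lambda>(d, e). (d * e, d)" "\<lambda>(q, d). (d, q div d)"])
    fix x assume x: "x \<in> (SIGMA q:{1..N}. {d. d dvd q})"
    then obtain d e where de: "x = (d * e, d)" "1 \<le> d * e" "d * e \<le> N" by (auto elim!: dvdE)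
    then have pos: "1 \<le> d" "1 \<le> e" by (cases d; cases e; simp)+
    then have "d \<le> N" "e \<le> N div d"
      using de by (auto simp: less_eq_div_iff_mult_less_eq mult.commute intro: order_trans[OF _ de(3)])
    then show "(case x of (q, d) \<Rightarrow> (d, q div d)) \<in> (SIGMA d:{1..N}. {1..N div d})"
      using de pos by simp
    show "(case case x of (q, d) \<Rightarrow> (d, q div d) of (d, e) \<Rightarrow> (d * e, d)) = x"
      using de pos by simp
    show "(case case x of (q, d) \<Rightarrow> (d, q div d) of (d, e) \<Rightarrow> moebius d * real d ^ k * real e ^ Suc k) =
        (case x of (q, d) \<Rightarrow> real q ^ k * (moebius d * (real q / real d)))"
      using de pos by (simp add: power_mult_distrib)
  next
    fix x assume x: "x \<in> (SIGMA d:{1..N}. {1..N div d})"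
    then obtain d e where de: "x = (d, e)" "1 \<le> d" "d \<le> N" "1 \<le> e" "e \<le> N div d" by auto
    then have "d * e \<le> N" by (simp add: less_eq_div_iff_mult_less_eq mult.commute)
    then show "(case x of (d, e) \<Rightarrow> (d * e, d)) \<in> (SIGMA q:{1..N}. {d. d dvd q})"
      "(case case x of (d, e) \<Rightarrow> (d * e, d) of (q, d) \<Rightarrow> (d, q div d)) = x"
      using de by auto
  qed
  also have "\<dots> = (\<Sum>d=1..N. \<Sum>e=1..N div d. moebius d * real d ^ k * real e ^ Suc k)"
    by (rule sum.Sigma[symmetric]) auto
  also have "\<dots> = (\<Sum>d=1..N. moebius d * real d ^ k * (\<Sum>e=1..N div d. real e ^ Suc k))"
    by (simp add: sum_distrib_left)
  finally show ?thesis .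
qed

lemma summable_inverse_squares: "summable (\<lambda>d. 1 / real d ^ 2)"
  using inverse_power_summable[of 2, where 'a = real] by (simp add: field_simps)

lemma div_over_tendsto:
  assumes "d > 0"
  shows "(\<lambda>N. real (N div d) / real N) \<longlonglongrightarrow> 1 / real d"
proof (rule tendsto_sandwich)
  have "(\<lambda>N. 1 / real d - 1 / real N) \<longlonglongrightarrow> 1 / real d - 0"
    by (intro tendsto_intros lim_1_over_n)
  then show "(\<lambda>N. 1 / real d - 1 / real N) \<longlonglongrightarrow> 1 / real d" by simp
  show "(\<lambda>N. 1 / real d) \<longlonglongrightarrow> 1 / real d" by simp
  have eq: "real N / real d - 1 \<le> real (N div d)" "real (N div d) \<le> real N / real d" for N
    using of_nat_div_bounds[OF assms] by auto
  show "eventually (\<lambda>N. 1 / real d - 1 / real N \<le> real (N div d) / real N) sequentially"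
    using eventually_gt_at_top[of 0]
  proof eventually_elim
    case (elim N)
    then show ?case using divide_right_mono[OF eq(1)[of N], of "real N"]
      by (simp add: diff_divide_distrib)
  qed
  show "eventually (\<lambda>N. real (N div d) / real N \<le> 1 / real d) sequentially"
    using eventually_gt_at_top[of 0]
  proof eventually_elim
    case (elim N)
    then show ?case using divide_right_mono[OF eq(2)[of N], of "real N"] by simp
  qed
qed

text \<open>Dominated convergence for series. After division by N^(k+2) the d-th term is at most
  1/d^2 uniformly in N, which justifies taking the limit term by term; each inner power sum
  contributes the factor 1/(k + 2).\<close>

lemma sum_totient_tendsto:
  "(\<lambda>N. (\<Sum>q=1..N. real q ^ k * real (totient q)) / real N ^ (k + 2)) \<longlonglongrightarrow>
    (\<Sum>d. moebius d / real d ^ 2) / real (k + 2)"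
proof -
  define P where "P n = (\<Sum>e=1..n. real e ^ Suc k)" for n
  define a where "a d N = moebius d * real d ^ k * P (N div d) / real N ^ (k + 2)" for d N
  define b where "b d = moebius d / real d ^ 2 / real (k + 2)" for d
  have P_le: "P n \<le> real n ^ (k + 2)" for n
  proof -
    have "P n \<le> (\<Sum>e=1..n. real n ^ Suc k)" unfolding P_def by (intro sum_mono power_mono) auto
    then show ?thesis by simp
  qed
  have P_nonneg: "0 \<le> P n" for n unfolding P_def by (intro sum_nonneg) auto
  have a0: "a d N = 0" if "d > N \<or> d = 0" for d N
    using that by (auto simp: a_def P_def moebius_def)
  have "eventually (\<lambda>N. summable (\<lambda>d. norm (a d N))) sequentially \<and> summable (\<lambda>d. norm (b d)) \<and>
      (\<lambda>N. \<Sum>d. a d N) \<longlonglongrightarrow> suminf b"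
  proof (rule tannerys_theorem[OF _ _ summable_inverse_squares])
    fix d show "(\<lambda>N. a d N) \<longlonglongrightarrow> b d"
    proof (cases "d = 0")
      case True
      then show ?thesis by (simp add: a0 b_def)
    next
      case d: False
      have "filterlim (\<lambda>N. N div d) at_top sequentially"
        using d by (intro filterlim_at_top[THEN iffD2] allI)
          (auto simp: eventually_sequentially less_eq_div_iff_mult_less_eq intro!: exI)
      then have "(\<lambda>N. P (N div d) / real (N div d) ^ (k + 2)) \<longlonglongrightarrow> 1 / real (k + 2)"
        using sum_powers_tendsto[of "Suc k"] unfolding P_def[symmetric]
        by (auto dest: filterlim_compose[rotated])
      \<comment> \<open>The quotient is normalized by N div d instead of N, and the correction (N
        div d)/N tends to 1/d. The two forms agree once N \<ge> d, when N div d is nonzero.\<close>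
      then have "(\<lambda>N. moebius d * real d ^ k * (P (N div d) / real (N div d) ^ (k + 2) *
          (real (N div d) / real N) ^ (k + 2))) \<longlonglongrightarrow>
          moebius d * real d ^ k * (1 / real (k + 2) * (1 / real d) ^ (k + 2))"
        by (intro tendsto_mult[OF tendsto_const] tendsto_mult tendsto_power div_over_tendsto)
          (use d in auto)
      also have "moebius d * real d ^ k * (1 / real (k + 2) * (1 / real d) ^ (k + 2)) = b d"
        using d by (simp add: b_def power_add power_divide divide_simps power2_eq_square)
      finally show ?thesis
      proof (rule Lim_transform_eventually)
        show "eventually (\<lambda>N. moebius d * real d ^ k * (P (N div d) / real (N div d) ^ (k + 2) *
          (real (N div d) / real N) ^ (k + 2)) = a d N) sequentially"
          using eventually_ge_at_top[of d]
        proof eventually_elim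
          case (elim N)
          then have "N div d > 0" using d by (simp add: div_greater_zero_iff)
          then show ?case by (simp add: a_def power_divide)
        qed
      qed
    qed
  next
    have "norm (a d N) \<le> 1 / real d ^ 2" for d N
    proof (cases "d = 0 \<or> N = 0")
      case False
      have "norm (a d N) = \<bar>moebius d\<bar> * (real d ^ k * P (N div d) / real N ^ (k + 2))"
        using P_nonneg by (simp add: a_def abs_mult)
      also have "\<dots> \<le> 1 * (real d ^ k * P (N div d) / real N ^ (k + 2))"
        using P_nonneg abs_moebius_le by (intro mult_right_mono) auto
      also have "\<dots> \<le> 1 * (real d ^ k * real (N div d) ^ (k + 2) / real N ^ (k + 2))"
        using P_le by (intro mult_left_mono divide_right_mono) auto
      also have "\<dots> \<le> 1 * (real d ^ k * (real N / real d) ^ (k + 2) / real N ^ (k + 2))"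
        by (intro mult_left_mono divide_right_mono power_mono)
          (use False of_nat_div_bounds(1) in auto)
      also have "\<dots> = 1 / real d ^ 2" using False by (simp add: field_simps power_add power2_eq_square)
      finally show ?thesis .
    next
      case True
      then have "a d N = 0" by (intro a0) auto
      then show ?thesis by simp
    qed
    then show "eventually (\<lambda>(d, N). norm (a d N) \<le> 1 / real d ^ 2) (at_top \<times>\<^sub>F sequentially)"
      by (intro always_eventually) auto
  qed auto
  moreover have "(\<Sum>d. a d N) = (\<Sum>q=1..N. real q ^ k * real (totient q)) / real N ^ (k + 2)" for N
  proof -
    have "(\<Sum>d. a d N) = (\<Sum>d=1..N. a d N)"
      by (rule suminf_finite) (auto intro!: a0)
    then show ?thesis
      by (simp only: sum_totient_eq_moebius a_def P_def sum_divide_distrib)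
  qed
  moreover have "suminf b = (\<Sum>d. moebius d / real d ^ 2) / real (k + 2)"
    unfolding b_def
  proof (rule suminf_divide)
    show "summable (\<lambda>d. moebius d / real d ^ 2)"
      by (rule summable_comparison_test'[OF summable_inverse_squares, of 0])
        (use abs_moebius_le in \<open>auto simp: divide_right_mono\<close>)
  qed
  ultimately show ?thesis by simp
qed

text \<open>This is 1/zeta(2) = 6/pi^2, so that half of it times N^2 is the asymptotic number of
  Farey fractions of order N.\<close>

definition moebius_sum :: real where
  "moebius_sum = (\<Sum>d. moebius d / real d ^ 2)"

text \<open>The term d = 1 contributes 1. The terms from d = 2 on are bounded by 1/d^2 \<le> 1/((d -
  1/2)(d + 1/2)), which telescopes to 1/(3/2) = 2/3; with d = n + 2 this is the series of
  ?g.\<close>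

lemma moebius_sum_pos: "moebius_sum > 0"
proof -
  let ?f = "\<lambda>d. moebius d / real d ^ 2"
  let ?g = "\<lambda>n. 1 / (real n + 3 / 2) - 1 / (real (Suc n) + 3 / 2)"
  have summable: "summable ?f"
    by (rule summable_comparison_test'[OF summable_inverse_squares, of 0])
      (use abs_moebius_le in \<open>auto simp: divide_right_mono\<close>)
  have lim: "(\<lambda>n. 1 / (real n + 3 / 2)) \<longlonglongrightarrow> 0" by real_asymp
  have g: "?g sums (2 / 3)" using telescope_sums'[OF lim] by simp
  have "?f (n + 2) \<ge> - ?g n" for n
  proof -
    have "- ?f (n + 2) \<le> \<bar>?f (n + 2)\<bar>" by (rule abs_ge_minus_self)
    also have "\<dots> \<le> 1 / real (n + 2) ^ 2"
      using abs_moebius_le[of "n + 2"] by (simp add: divide_right_mono)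
    also have "\<dots> \<le> 1 / ((real n + 3 / 2) * (real (Suc n) + 3 / 2))"
      by (intro divide_left_mono mult_pos_pos zero_less_power) (auto simp: algebra_simps power2_eq_square)
    also have "\<dots> = ?g n" by (simp add: divide_simps add_pos_pos)
    finally show ?thesis by simp
  qed
  then have "(\<Sum>n. - ?g n) \<le> (\<Sum>n. ?f (n + 2))"
    using g summable_ignore_initial_segment[OF summable, of 2]
    by (intro suminf_le summable_minus) (auto simp: sums_iff)
  moreover have "(\<Sum>n. - ?g n) = - (2 / 3)"
    using sums_minus[OF g] by (simp add: sums_iff)
  moreover have "suminf ?f = (\<Sum>n. ?f (n + 2)) + (\<Sum>i<2. ?f i)"
    by (rule suminf_split_initial_segment[OF summable])
  moreover have "(\<Sum>i<2. ?f i) = 1"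
    by (simp add: eval_nat_numeral moebius_def)
  ultimately show ?thesis unfolding moebius_sum_def by linarith
qed

section \<open>The limiting measure\<close>

text \<open>All faces are left out, so that \<open>disc_map\<close> identifies no point of this set
  with another point of the set or of its closure. Positivity of y follows from x < 1 < x +
  y.\<close>

definition farey_region :: "(real \<times> real \<times> real) set" where
  "farey_region = {(x, y, h). 0 < x \<and> x < 1 \<and> y < 1 \<and> 1 < x + y \<and> 0 < h \<and> h < 1}"

text \<open>The first component maps the Farey triangle onto the unit disc and multiplies areas by
  \<open>2 * pi\<close>. It carries \<open>(q/Q, q'/Q)\<close> to \<open>(q/Q) e(q'/q)\<close>, which depends on \<open>q'\<close> only modulo \<open>q\<close>; this is
  what makes sums of monomials into Kloosterman sums.\<close>

definition disc_map :: "real \<times> real \<times> real \<Rightarrow> complex \<times> complex" where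
  "disc_map = (\<lambda>(x, y, h). (of_real x * cis (2 * pi * y / x), cis (2 * pi * h)))"

lemma measurable_cis [measurable]: "cis \<in> borel_measurable borel"
  by (intro borel_measurable_continuous_onI continuous_on_cis continuous_on_id)

lemma borel_measurable_fst [measurable (raw)]:
  fixes f :: "'x \<Rightarrow> 'a :: topological_space \<times> 'b :: topological_space"
  assumes "f \<in> borel_measurable M"
  shows "(\<lambda>x. fst (f x)) \<in> borel_measurable M"
  by (rule measurable_compose[OF assms])
    (intro borel_measurable_continuous_onI continuous_on_fst continuous_on_id)

lemma borel_measurable_snd [measurable (raw)]:
  fixes f :: "'x \<Rightarrow> 'a :: topological_space \<times> 'b :: topological_space"
  assumes "f \<in> borel_measurable M"
  shows "(\<lambda>x. snd (f x)) \<in> borel_measurable M"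
  by (rule measurable_compose[OF assms])
    (intro borel_measurable_continuous_onI continuous_on_snd continuous_on_id)

lemma disc_map_measurable [measurable]: "disc_map \<in> borel_measurable borel"
  unfolding disc_map_def case_prod_unfold by measurable

lemma open_farey_region: "open farey_region"
proof -
  have "farey_region = {v. 0 < fst v} \<inter> {v. fst v < 1} \<inter> {v. fst (snd v) < 1} \<inter>
      {v. 1 < fst v + fst (snd v)} \<inter> {v. 0 < snd (snd v)} \<inter> {v. snd (snd v) < 1}"
    by (auto simp: farey_region_def)
  also have "open \<dots>"
    by (intro open_Int open_Collect_less continuous_intros)
  finally show ?thesis .
qed

lemma farey_region_borel [measurable]: "farey_region \<in> sets borel"
  using open_farey_region by simp

lemma farey_region_subset: "farey_region \<subseteq> cbox (0, 0, 0) (1, 1, 1)"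
  by (auto simp: farey_region_def cbox_Pair_eq)

lemma emeasure_farey_region_finite: "emeasure lborel farey_region < \<infinity>"
  using emeasure_bounded_finite[of farey_region] bounded_subset[OF bounded_cbox farey_region_subset]
  by simp

text \<open>For nonzero n the interval consists of full periods, so an antiderivative takes equal
  values at its two ends.\<close>

lemma set_integral_cis:
  fixes a c :: real and n :: int
  assumes c: "c > 0"
  shows "(LINT y:{a<..<a + c}|lborel. cis (2 * pi * of_int n * y / c)) =
    (if n = 0 then of_real c else 0)"
proof -
  have *: "(LINT y:{a<..<a + c}|lborel. cis (2 * pi * of_int n * y / c)) =
      (LBINT y=a..a + c. cis (2 * pi * of_int n * y / c))"
    using c by (simp add: interval_lebesgue_integral_le_eq)
  show ?thesis
  proof (cases "n = 0")
    case True
    have "(LBINT y=a..a + c. (1 :: complex)) = of_real (a + c) - of_real a"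
      by (rule interval_integral_FTC_finite) (auto intro!: derivative_eq_intros)
    then show ?thesis using True * by simp
  next
    case False
    define K where "K = 2 * pi * of_int n / c"
    have K: "K \<noteq> 0" using False c by (simp add: K_def)
    have cis_K: "cis (2 * pi * of_int n * y / c) = exp (\<i> * of_real K * of_real y)" for y
      by (simp add: K_def cis_conv_exp mult_ac)
    define F where "F z = exp (\<i> * of_real K * z) / (\<i> * of_real K)" for z
    have "(LBINT y=a..a + c. exp (\<i> * of_real K * of_real y)) = F (of_real (a + c)) - F (of_real a)"
    proof (rule interval_integral_FTC_finite)
      fix y
      have "(F has_field_derivative exp (\<i> * of_real K * of_real y)) (at (of_real y))"
        unfolding F_def using K by (auto intro!: derivative_eq_intros)
      then show "((\<lambda>y. F (of_real y)) has_vector_derivative exp (\<i> * of_real K * of_real y))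
          (at y within {min a (a + c)..max a (a + c)})"
        by (rule has_vector_derivative_real_field)
    qed (intro continuous_intros)
    also have "cis (2 * pi * of_int n * (a + c) / c) = cis (2 * pi * of_int n * a / c + 2 * pi * of_int n)"
      using c by (intro arg_cong[where f = cis]) (simp add: field_simps)
    then have "cis (2 * pi * of_int n * (a + c) / c) = cis (2 * pi * of_int n * a / c)"
      by (simp add: cis_multiple_2pi flip: cis_mult)
    then have "F (of_real (a + c)) = F (of_real a)" unfolding F_def cis_K by simp
    finally show ?thesis using False * unfolding cis_K by simp
  qed
qed

lemma integral_lborel_product:
  fixes g :: "real \<Rightarrow> complex" and f :: "real \<Rightarrow> complex"
  assumes "integrable lborel (\<lambda>w :: real \<times> real. g (fst w) * f (snd w))"
  shows "(LINT w|lborel. g (fst w) * f (snd w)) = (LINT y|lborel. g y) * (LINT h|lborel. f h)"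
proof -
  have "(LINT w|lborel. g (fst w) * f (snd w)) = (LINT y|lborel. LINT h|lborel. g y * f h)"
    using lborel_pair.integral_fst'[of "\<lambda>w. g (fst w) * f (snd w)"] assms
    unfolding lborel_prod by simp
  then show ?thesis by simp
qed

text \<open>Over a fixed x the variable y runs through an interval of length x, exactly one period
  of e(y/x), and h through one period of e(h). Nontrivial frequencies therefore integrate to 0;
  otherwise the y-integral supplies an extra factor x and the integral of x^(k+1) remains.\<close>

lemma set_integral_farey_monomial:
  fixes k :: nat and m n :: int
  shows "(LINT v:farey_region|lborel. of_real (fst v) ^ k * cis (2 * pi * of_int m * fst (snd v) / fst v)
      * cis (2 * pi * of_int n * snd (snd v))) = (if m = 0 \<and> n = 0 then 1 / of_nat (k + 2) else 0)"
proof -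
  define F :: "real \<times> real \<times> real \<Rightarrow> complex" where
    "F v = indicator farey_region v *\<^sub>R (of_real (fst v) ^ k *
      cis (2 * pi * of_int m * fst (snd v) / fst v) * cis (2 * pi * of_int n * snd (snd v)))" for v
  \<comment> \<open>The right end 1 is written as 1 - x + x to fit the shape of
    \<open>set_integral_cis\<close>.\<close>
  define g where "g x y = indicator {1 - x<..<1 - x + x} y *\<^sub>R cis (2 * pi * of_int m * y / x)" for x y
  define f where "f h = indicator {0<..<0 + 1} h *\<^sub>R cis (2 * pi * of_int n * h / 1)" for h :: real
  have meas [measurable]: "g x \<in> borel_measurable borel" "f \<in> borel_measurable borel" for x
    unfolding g_def f_def by measurable
  have F: "integrable lborel F"
    unfolding F_def
  proof (rule integrableI_bounded_set_indicator[where B = 1])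
    show "AE v in lborel. v \<in> farey_region \<longrightarrow> norm (of_real (fst v) ^ k *
      cis (2 * pi * of_int m * fst (snd v) / fst v) * cis (2 * pi * of_int n * snd (snd v))) \<le> 1"
      by (intro AE_I2) (auto simp: farey_region_def norm_mult norm_power power_le_one)
  qed (use emeasure_farey_region_finite in \<open>measurable\<close>)
  have F_eq: "F (x, w) = (indicator {0<..<1} x * of_real x ^ k) * (g x (fst w) * f (snd w))" for x w
    by (cases w) (auto simp: F_def g_def f_def farey_region_def indicator_def)
  have "(LINT v|lborel. F v) = (LINT x|lborel. LINT w|lborel. F (x, w))"
    using lborel_pair.integral_fst'[of F] F unfolding lborel_prod by simp
  also have "\<dots> = (LINT x|lborel. indicator {0<..<1} x *\<^sub>R (if m = 0 \<and> n = 0 then of_real x ^ Suc k else 0))"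
  proof (rule Bochner_Integration.integral_cong[OF refl])
    fix x :: real
    show "(LINT w|lborel. F (x, w)) =
        indicator {0<..<1} x *\<^sub>R (if m = 0 \<and> n = 0 then of_real x ^ Suc k else 0)"
    proof (cases "0 < x \<and> x < 1")
      case True
      have "integrable lborel (\<lambda>w :: real \<times> real. g x (fst w) * f (snd w))"
      proof (rule integrableI_bounded_set[where A = "cbox (0, 0) (1, 1)" and B = 1])
        show "AE w in lborel. w \<in> cbox (0, 0) (1, 1) \<longrightarrow> norm (g x (fst w) * f (snd w)) \<le> 1"
          by (intro AE_I2) (auto simp: g_def f_def norm_mult indicator_def)
        show "AE w in lborel. w \<notin> cbox (0, 0) (1, 1) \<longrightarrow> g x (fst w) * f (snd w) = 0"
          using True by (intro AE_I2) (auto simp: g_def f_def indicator_def cbox_Pair_eq split: if_splits)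
      qed (auto simp: emeasure_lborel_cbox_eq)
      then have "(LINT w|lborel. F (x, w)) = (of_real x ^ k) * ((LINT y|lborel. g x y) * (LINT h|lborel. f h))"
        unfolding F_eq using True by (simp add: integral_lborel_product)
      moreover have "(LINT y|lborel. g x y) = (if m = 0 then of_real x else 0)"
        using set_integral_cis[of x "1 - x" m] True by (simp add: g_def set_lebesgue_integral_def)
      moreover have "(LINT h|lborel. f h) = (if n = 0 then 1 else 0)"
        using set_integral_cis[of 1 0 n] by (simp add: f_def set_lebesgue_integral_def)
      ultimately show ?thesis using True by simp
    next
      case False
      then show ?thesis unfolding F_eq by auto
    qed
  qed
  also have "\<dots> = (if m = 0 \<and> n = 0 then 1 / of_nat (k + 2) else 0)"
  proof (cases "m = 0 \<and> n = 0")
    case True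
    have "(LINT x|lborel. indicator {0<..<1} x *\<^sub>R (of_real x ^ Suc k :: complex)) =
        (LBINT x=0..1. of_real x ^ Suc k)"
      using interval_lebesgue_integral_le_eq[of 0 1 lborel "\<lambda>x. of_real x ^ Suc k :: complex"]
      by (simp add: set_lebesgue_integral_def zero_ereal_def one_ereal_def)
    also have "\<dots> = of_real 1 ^ (k + 2) / of_nat (k + 2) - of_real 0 ^ (k + 2) / of_nat (k + 2)"
      unfolding zero_ereal_def one_ereal_def
    proof (rule interval_integral_FTC_finite)
      fix x :: real
      have "((\<lambda>z. z ^ (k + 2) / of_nat (k + 2)) has_field_derivative of_real x ^ Suc k) (at (complex_of_real x))"
      proof -
        have "of_nat (k + 2) \<noteq> (0 :: complex)" by (simp only: of_nat_eq_0_iff)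
        then show ?thesis
          using DERIV_cdivide[OF DERIV_power[OF DERIV_ident[of "at (complex_of_real x)"], of "k + 2"], of "of_nat (k + 2)"]
          by simp
      qed
      then show "((\<lambda>x. of_real x ^ (k + 2) / of_nat (k + 2) :: complex) has_vector_derivative of_real x ^ Suc k)
          (at x within {min 0 1..max 0 1})"
        by (rule has_vector_derivative_real_field)
    qed (intro continuous_intros)
    finally show ?thesis using True by simp
  qed auto
  finally show ?thesis by (simp add: F_def set_lebesgue_integral_def)
qed

section \<open>Weak convergence on the bidisc\<close>

text \<open>The successor denominator is represented by its residue modulo q, minus the inverse of
  p; \<open>disc_map_farey_vec\<close> justifies this. In this form no trace of the window (N - q,
  N] is left.\<close>

definition disc_point :: "nat \<Rightarrow> nat \<Rightarrow> int \<Rightarrow> complex \<times> complex" where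
  "disc_point N q p =
    (of_real (real q / real N) * root_char (int q) (- modular_inverse (int q) p), root_char (int q) p)"

text \<open>The codomain is left general: moments are complex, whereas the test functions that
  approximate indicators are real.\<close>

definition farey_sum :: "nat \<Rightarrow> (complex \<times> complex \<Rightarrow> 'a :: comm_monoid_add) \<Rightarrow> 'a" where
  "farey_sum N f = (\<Sum>q=1..N. \<Sum>p\<in>unit_residues (int q). f (disc_point N q p))"

definition limit_integral :: "(complex \<times> complex \<Rightarrow> 'a :: {banach, second_countable_topology}) \<Rightarrow> 'a" where
  "limit_integral f = (LINT v:farey_region|lborel. f (disc_map v))"

text \<open>The representatives differ only for q = 1, where the unit residue is 0 and the totative
  is 1.\<close>

lemma card_unit_residues:
  assumes "q > 0"
  shows "card (unit_residues (int q)) = totient q"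
proof (cases "q = 1")
  case True
  then have "unit_residues (int q) = {0}" by (auto simp: unit_residues_iff)
  then show ?thesis using True by simp
next
  case False
  have "unit_residues (int q) = int ` totatives q"
  proof (intro equalityI subsetI)
    fix a assume "a \<in> unit_residues (int q)"
    then have a: "0 \<le> a" "a < int q" "coprime a (int q)" by (auto simp: unit_residues_iff)
    then have "a \<noteq> 0" using False assms by (auto simp: coprime_0_left_iff)
    then have "nat a \<in> totatives q" "a = int (nat a)"
      using a by (auto simp: in_totatives_iff simp flip: coprime_int_iff)
    then show "a \<in> int ` totatives q" by blast
  next
    fix a assume "a \<in> int ` totatives q"
    then obtain b where b: "a = int b" "0 < b" "b \<le> q" "coprime b q" by (auto simp: in_totatives_iff)
    then have "b \<noteq> q" using False by auto
    then show "a \<in> unit_residues (int q)" using b by (auto simp: unit_residues_iff)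
  qed
  then show ?thesis by (simp add: card_image totient_def)
qed

lemma totient_sum_le: "(\<Sum>q=1..N. real (totient q)) \<le> real N ^ 2"
proof -
  have "(\<Sum>q=1..N. real (totient q)) \<le> (\<Sum>q=1..N. real N)"
    using totient_le by (intro sum_mono) (meson atLeastAtMost_iff le_trans of_nat_le_iff)
  then show ?thesis by (simp add: power2_eq_square)
qed

section \<open>Test functions on the bidisc\<close>

abbreviation bidisc :: "(complex \<times> complex) set" where
  "bidisc \<equiv> cball 0 1 \<times> cball 0 1"

lemma disc_point_in_bidisc: "q \<le> N \<Longrightarrow> disc_point N q p \<in> bidisc"
  by (auto simp: disc_point_def norm_mult norm_divide divide_le_eq_1)

lemma disc_map_in_bidisc: "v \<in> farey_region \<Longrightarrow> disc_map v \<in> bidisc"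
  by (auto simp: disc_map_def farey_region_def norm_mult)

lemma set_integrable_disc_map:
  fixes f :: "complex \<times> complex \<Rightarrow> 'a :: {banach, second_countable_topology}"
  assumes f: "continuous_on UNIV f"
  shows "set_integrable lborel farey_region (\<lambda>v. f (disc_map v))"
proof -
  have "compact (f ` bidisc)"
    by (intro compact_continuous_image compact_Times compact_cball continuous_on_subset[OF f]) auto
  then obtain B where B: "\<And>z. z \<in> bidisc \<Longrightarrow> norm (f z) \<le> B"
    by (meson bounded_iff compact_imp_bounded imageI)
  have [measurable]: "f \<in> borel_measurable borel"
    using f by (rule borel_measurable_continuous_onI)
  show ?thesis
    unfolding set_integrable_def
    by (rule integrableI_bounded_set_indicator[where B = B])
      (use emeasure_farey_region_finite in \<open>auto intro!: AE_I2 B disc_map_in_bidisc\<close>)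
qed

text \<open>Polynomials in the two complex coordinates and their conjugates: the functions whose
  limits can be computed monomial by monomial.\<close>

inductive trig_poly :: "(complex \<times> complex \<Rightarrow> complex) \<Rightarrow> bool" where
  monomial: "trig_poly (\<lambda>v. k * fst v ^ a * cnj (fst v) ^ b * snd v ^ c * cnj (snd v) ^ d)"
| add: "trig_poly f \<Longrightarrow> trig_poly g \<Longrightarrow> trig_poly (\<lambda>v. f v + g v)"

lemma trig_poly_mult:
  assumes "trig_poly f" "trig_poly g"
  shows "trig_poly (\<lambda>v. f v * g v)"
  using assms
proof (induction f)
  case (monomial k a b c d)
  from monomial show ?case
  proof (induction g)
    case (monomial k' a' b' c' d')
    have "(\<lambda>v. (k * fst v ^ a * cnj (fst v) ^ b * snd v ^ c * cnj (snd v) ^ d) *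
        (k' * fst v ^ a' * cnj (fst v) ^ b' * snd v ^ c' * cnj (snd v) ^ d')) =
        (\<lambda>v. (k * k') * fst v ^ (a + a') * cnj (fst v) ^ (b + b') * snd v ^ (c + c') * cnj (snd v) ^ (d + d'))"
      by (simp add: power_add fun_eq_iff mult_ac)
    then show ?case by (simp only: trig_poly.monomial)
  next
    case (add f g)
    from trig_poly.add[OF add.IH] show ?case by (simp add: ring_distribs)
  qed
next
  case (add f g)
  from trig_poly.add[OF add.IH] add.prems show ?case by (simp add: ring_distribs)
qed

lemma trig_poly_continuous: "trig_poly f \<Longrightarrow> continuous_on UNIV f"
  by (induction rule: trig_poly.induct) (auto intro!: continuous_intros)

text \<open>Real and imaginary parts are combinations of a coordinate and its conjugate. Bounded
  linear forms are the generators of \<open>real_polynomial_function\<close>, the class that the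
  Stone-Weierstrass theorem provides.\<close>

lemma trig_poly_bounded_linear:
  fixes f :: "complex \<times> complex \<Rightarrow> real"
  assumes "bounded_linear f"
  shows "trig_poly (\<lambda>v. of_real (f v))"
proof -
  interpret bounded_linear f by fact
  define A B C D where "A = complex_of_real (f (1, 0))" and "B = complex_of_real (f (\<i>, 0))"
    and "C = complex_of_real (f (0, 1))" and "D = complex_of_real (f (0, \<i>))"
  have "of_real (f v) = (A - \<i> * B) / 2 * fst v + ((A + \<i> * B) / 2 * cnj (fst v) +
      ((C - \<i> * D) / 2 * snd v + (C + \<i> * D) / 2 * cnj (snd v)))" for v
  proof -
    have "v = Re (fst v) *\<^sub>R (1, 0) + Im (fst v) *\<^sub>R (\<i>, 0) + Re (snd v) *\<^sub>R (0, 1) + Im (snd v) *\<^sub>R (0, \<i>)"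
      by (simp add: prod_eq_iff complex_eq_iff)
    then have "f v = Re (fst v) * f (1, 0) + Im (fst v) * f (\<i>, 0) + Re (snd v) * f (0, 1) + Im (snd v) * f (0, \<i>)"
      by (metis add scaleR real_scaleR_def)
    then show ?thesis
      by (simp add: A_def B_def C_def D_def complex_eq_iff field_simps)
  qed
  moreover have "trig_poly (\<lambda>v. (A - \<i> * B) / 2 * fst v + ((A + \<i> * B) / 2 * cnj (fst v) +
      ((C - \<i> * D) / 2 * snd v + (C + \<i> * D) / 2 * cnj (snd v))))"
    using monomial[of "(A - \<i> * B) / 2" 1 0 0 0] monomial[of "(A + \<i> * B) / 2" 0 1 0 0]
      monomial[of "(C - \<i> * D) / 2" 0 0 1 0] monomial[of "(C + \<i> * D) / 2" 0 0 0 1]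
    by (intro trig_poly.add) simp_all
  ultimately show ?thesis by simp
qed

lemma trig_poly_real_polynomial:
  assumes "real_polynomial_function f"
  shows "trig_poly (\<lambda>v. of_real (f v))"
  using assms
proof (induction rule: real_polynomial_function.induct)
  case (const c)
  then show ?case using monomial[of "of_real c" 0 0 0 0] by simp
qed (auto simp: trig_poly_bounded_linear intro: trig_poly.add trig_poly_mult)

lemma cis_power_cnj_power:
  "cis x ^ a * cnj (cis x) ^ b = cis (of_int (int a - int b) * x)"
proof -
  have "cis x ^ a * cnj (cis x) ^ b = cis (real a * x + real b * - x)"
    by (simp only: cis_cnj Complex.DeMoivre cis_mult)
  also have "real a * x + real b * - x = of_int (int a - int b) * x"
    by (simp add: algebra_simps)
  finally show ?thesis .
qed

lemma root_char_power_cnj_power: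
  "root_char q k ^ a * cnj (root_char q k) ^ b = root_char q ((int a - int b) * k)"
  unfolding root_char_def cis_power_cnj_power by (simp add: field_simps)

text \<open>Conjugation subtracts exponents in the phases and adds them in the moduli, whence the
  weight (q/N)^(a+b). The minus sign before the inverse in \<open>disc_point\<close> turns a - b
  into b - a.\<close>

lemma farey_sum_monomial:
  "farey_sum N (\<lambda>v. fst v ^ a * cnj (fst v) ^ b * snd v ^ c * cnj (snd v) ^ d) =
    (\<Sum>q=1..N. of_real ((real q / real N) ^ (a + b)) *
      kloosterman (int q) (int c - int d) (int b - int a))"
proof -
  have "fst v ^ a * cnj (fst v) ^ b * snd v ^ c * cnj (snd v) ^ d =
      of_real ((real q / real N) ^ (a + b)) *
      root_char (int q) ((int c - int d) * p + (int b - int a) * modular_inverse (int q) p)"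
    if v: "v = disc_point N q p" for v q p
  proof -
    define x where "x = complex_of_real (real q / real N)"
    define z where "z = root_char (int q) (- modular_inverse (int q) p)"
    define w where "w = root_char (int q) p"
    have "fst v = x * z" "snd v = w" "cnj x = x"
      by (auto simp: v disc_point_def x_def z_def w_def)
    then have "fst v ^ a * cnj (fst v) ^ b * snd v ^ c * cnj (snd v) ^ d =
        x ^ (a + b) * ((z ^ a * cnj z ^ b) * (w ^ c * cnj w ^ d))"
      by (simp add: power_mult_distrib power_add mult_ac)
    also have "\<dots> = x ^ (a + b) * root_char (int q) ((int c - int d) * p + (int b - int a) * modular_inverse (int q) p)"
      unfolding z_def w_def root_char_power_cnj_power root_char_add[symmetric]
      by (simp add: algebra_simps)
    finally show ?thesis by (simp add: x_def)
  qed
  then show ?thesis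
    by (simp add: farey_sum_def kloosterman_def sum_distrib_left)
qed

lemma limit_integral_monomial:
  "limit_integral (\<lambda>v. fst v ^ a * cnj (fst v) ^ b * snd v ^ c * cnj (snd v) ^ d) =
    (if a = b \<and> c = d then 1 / of_nat (a + b + 2) else 0)"
proof -
  have "fst (disc_map v) ^ a * cnj (fst (disc_map v)) ^ b * snd (disc_map v) ^ c * cnj (snd (disc_map v)) ^ d =
      of_real (fst v) ^ (a + b) * cis (2 * pi * of_int (int a - int b) * fst (snd v) / fst v) *
      cis (2 * pi * of_int (int c - int d) * snd (snd v))" for v
  proof -
    obtain x y h where v: "v = (x, y, h)" by (metis prod.exhaust)
    define z where "z = cis (2 * pi * y / x)"
    define w where "w = cis (2 * pi * h)"
    have "fst (disc_map v) = of_real x * z" "snd (disc_map v) = w"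
      by (auto simp: v disc_map_def z_def w_def)
    then have "fst (disc_map v) ^ a * cnj (fst (disc_map v)) ^ b * snd (disc_map v) ^ c * cnj (snd (disc_map v)) ^ d =
        of_real x ^ (a + b) * ((z ^ a * cnj z ^ b) * (w ^ c * cnj w ^ d))"
      by (simp add: power_mult_distrib power_add mult_ac)
    then show ?thesis
      unfolding z_def w_def cis_power_cnj_power by (simp add: v mult_ac)
  qed
  then show ?thesis
    unfolding limit_integral_def using set_integral_farey_monomial[of "a + b" "int a - int b" "int c - int d"]
    by simp
qed

text \<open>If both frequencies vanish, the Kloosterman sum is Euler's function, and the weight of
  exponent a + b produces the denominator a + b + 2 on both sides. Otherwise the weights lie in
  [0, 1] and the sum is dominated by the unweighted sum of norms.\<close>

lemma farey_sum_monomial_tendsto: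
  "(\<lambda>N. farey_sum N (\<lambda>v. fst v ^ a * cnj (fst v) ^ b * snd v ^ c * cnj (snd v) ^ d) / of_nat N ^ 2)
    \<longlonglongrightarrow> of_real moebius_sum * limit_integral (\<lambda>v. fst v ^ a * cnj (fst v) ^ b * snd v ^ c * cnj (snd v) ^ d)"
proof (cases "a = b \<and> c = d")
  case True
  have "kloosterman (int q) 0 0 = of_nat (totient q)" if "q > 0" for q
    using card_unit_residues[OF that] by (simp add: kloosterman_def root_char_def)
  then have eq: "farey_sum N (\<lambda>v. fst v ^ a * cnj (fst v) ^ b * snd v ^ c * cnj (snd v) ^ d) / of_nat N ^ 2 =
      of_real ((\<Sum>q=1..N. real q ^ (a + b) * real (totient q)) / real N ^ (a + b + 2))" for N
    unfolding farey_sum_monomial using True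
    by (simp add: power_divide sum_divide_distrib power_add power2_eq_square mult_ac)
  show ?thesis
    unfolding eq limit_integral_monomial
    using tendsto_of_real[OF sum_totient_tendsto[of "a + b"], where 'a = complex] True
    by (simp add: moebius_sum_def)
next
  case False
  have "(\<lambda>N. farey_sum N (\<lambda>v. fst v ^ a * cnj (fst v) ^ b * snd v ^ c * cnj (snd v) ^ d) / of_nat N ^ 2)
    \<longlonglongrightarrow> 0"
  proof (rule Lim_null_comparison)
    show "(\<lambda>N. (\<Sum>q=1..N. norm (kloosterman (int q) (int c - int d) (int b - int a))) / real N ^ 2) \<longlonglongrightarrow> 0"
      using False by (intro sum_norm_kloosterman_tendsto_0) auto
    have "norm (farey_sum N (\<lambda>v. fst v ^ a * cnj (fst v) ^ b * snd v ^ c * cnj (snd v) ^ d) / of_nat N ^ 2)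
        \<le> (\<Sum>q=1..N. norm (kloosterman (int q) (int c - int d) (int b - int a))) / real N ^ 2" for N
      unfolding farey_sum_monomial norm_divide norm_power norm_of_nat
    proof (intro divide_right_mono order_trans[OF norm_sum] sum_mono)
      fix q assume "q \<in> {1..N}"
      then have "\<bar>(real q / real N) ^ (a + b)\<bar> \<le> 1"
        by (simp add: power_le_one divide_le_eq power_abs)
      then show "norm (of_real ((real q / real N) ^ (a + b)) * kloosterman (int q) (int c - int d) (int b - int a))
          \<le> norm (kloosterman (int q) (int c - int d) (int b - int a))"
        unfolding norm_mult norm_of_real by (intro mult_left_le_one_le) auto
    qed auto
    then show "eventually (\<lambda>N. norm (farey_sum N (\<lambda>v. fst v ^ a * cnj (fst v) ^ b * snd v ^ c * cnj (snd v) ^ d)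
        / of_nat N ^ 2) \<le> (\<Sum>q=1..N. norm (kloosterman (int q) (int c - int d) (int b - int a))) / real N ^ 2)
        sequentially"
      by (intro always_eventually allI)
  qed
  moreover have "limit_integral (\<lambda>v. fst v ^ a * cnj (fst v) ^ b * snd v ^ c * cnj (snd v) ^ d) = 0"
    unfolding limit_integral_monomial using False by auto
  ultimately show ?thesis by simp
qed

lemma farey_sum_add: "farey_sum N (\<lambda>v. f v + g v) = farey_sum N f + farey_sum N g"
  by (simp add: farey_sum_def sum.distrib)

lemma limit_integral_add:
  assumes "continuous_on UNIV f" "continuous_on UNIV g"
  shows "limit_integral (\<lambda>v. f v + g v) = limit_integral f + limit_integral g"
  unfolding limit_integral_def by (intro set_integral_add set_integrable_disc_map assms)

lemma farey_sum_trig_poly_tendsto: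
  assumes "trig_poly f"
  shows "(\<lambda>N. farey_sum N f / of_nat N ^ 2) \<longlonglongrightarrow> of_real moebius_sum * limit_integral f"
  using assms
proof (induction rule: trig_poly.induct)
  case (monomial k a b c d)
  let ?m = "\<lambda>v :: complex \<times> complex. fst v ^ a * cnj (fst v) ^ b * snd v ^ c * cnj (snd v) ^ d"
  have "(\<lambda>N. k * (farey_sum N ?m / of_nat N ^ 2)) \<longlonglongrightarrow> k * (of_real moebius_sum * limit_integral ?m)"
    by (intro tendsto_mult_left farey_sum_monomial_tendsto)
  moreover have "limit_integral (\<lambda>v. k * ?m v) = k * limit_integral ?m"
    by (simp add: limit_integral_def)
  moreover have "farey_sum N (\<lambda>v. k * ?m v) = k * farey_sum N ?m" for N
    by (simp add: farey_sum_def sum_distrib_left)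
  ultimately show ?case by (simp add: mult_ac)
next
  case (add f g)
  from tendsto_add[OF add.IH] show ?case
    using add.hyps
    by (simp add: farey_sum_add limit_integral_add trig_poly_continuous add_divide_distrib ring_distribs)
qed

lemma farey_sum_of_real: "farey_sum N (\<lambda>v. complex_of_real (f v)) = of_real (farey_sum N f)"
  by (simp add: farey_sum_def)

lemma limit_integral_of_real: "limit_integral (\<lambda>v. complex_of_real (f v)) = of_real (limit_integral f)"
  unfolding limit_integral_def by (rule set_integral_complex_of_real)

lemma farey_sum_const: "farey_sum N (\<lambda>v. c :: real) = c * (\<Sum>q=1..N. real (totient q))"
  by (simp add: farey_sum_def card_unit_residues sum_distrib_left mult.commute)

text \<open>The total mass 1/2 is read off from the moment with all exponents 0.\<close>

lemma limit_integral_const: "limit_integral (\<lambda>v. c :: real) = c / 2"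
proof -
  have "complex_of_real (limit_integral (\<lambda>v. 1 :: real)) = of_real (1 / 2)"
    using limit_integral_monomial[of 0 0 0 0] limit_integral_of_real[of "\<lambda>v. 1"] by simp
  then have "limit_integral (\<lambda>v. 1 :: real) = 1 / 2" unfolding of_real_eq_iff .
  moreover have "limit_integral (\<lambda>v. c * 1) = c * limit_integral (\<lambda>v. 1)"
    unfolding limit_integral_def by (rule set_integral_mult_right)
  ultimately show ?thesis by simp
qed

lemma farey_sum_abs_diff_le:
  fixes f g :: "complex \<times> complex \<Rightarrow> real"
  assumes "\<And>z. z \<in> bidisc \<Longrightarrow> \<bar>f z - g z\<bar> \<le> e" "0 \<le> e"
  shows "\<bar>farey_sum N f - farey_sum N g\<bar> \<le> e * real N ^ 2"
proof -
  have "\<bar>farey_sum N f - farey_sum N g\<bar> \<le> farey_sum N (\<lambda>v. e)"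
    unfolding farey_sum_def sum_subtractf[symmetric]
    by (intro order_trans[OF sum_abs] sum_mono assms disc_point_in_bidisc) auto
  also have "\<dots> \<le> e * real N ^ 2"
    unfolding farey_sum_const by (intro mult_left_mono totient_sum_le assms)
  finally show ?thesis .
qed

lemma limit_integral_abs_diff_le:
  fixes f g :: "complex \<times> complex \<Rightarrow> real"
  assumes f: "continuous_on UNIV f" and g: "continuous_on UNIV g"
    and le: "\<And>z. z \<in> bidisc \<Longrightarrow> \<bar>f z - g z\<bar> \<le> e"
  shows "\<bar>limit_integral f - limit_integral g\<bar> \<le> e / 2"
proof -
  note int = set_integrable_disc_map
  have "limit_integral f \<le> limit_integral (\<lambda>v. g v + e)"
    unfolding limit_integral_def using le disc_map_in_bidisc
    by (intro set_integral_mono int f g continuous_intros) (fastforce simp: abs_le_iff)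
  moreover have "limit_integral g \<le> limit_integral (\<lambda>v. f v + e)"
    unfolding limit_integral_def using le disc_map_in_bidisc
    by (intro set_integral_mono int f g continuous_intros) (fastforce simp: abs_le_iff)
  moreover have "limit_integral (\<lambda>v. g v + e) = limit_integral g + e / 2"
    "limit_integral (\<lambda>v. f v + e) = limit_integral f + e / 2"
    using f g by (simp_all add: limit_integral_add limit_integral_const)
  ultimately show ?thesis by linarith
qed

lemma farey_sum_tendsto:
  fixes f :: "complex \<times> complex \<Rightarrow> real"
  assumes f: "continuous_on UNIV f"
  shows "(\<lambda>N. farey_sum N f / real N ^ 2) \<longlonglongrightarrow> moebius_sum * limit_integral f"
proof (rule tendstoI)
  fix r :: real assume r: "r > 0"
  have S: "moebius_sum > 0" by (rule moebius_sum_pos)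
  \<comment> \<open>Replacing f by g costs at most e in the normalized sum and less than
    \<open>moebius_sum * e\<close> in the limit, together less than r/2; the convergence for g takes
    the other half of r.\<close>
  define e where "e = r / (2 * (1 + moebius_sum))"
  have e: "e > 0" using r S by (simp add: e_def)
  obtain g where g: "real_polynomial_function g" "\<And>z. z \<in> bidisc \<Longrightarrow> \<bar>f z - g z\<bar> < e"
    using Stone_Weierstrass_real_polynomial_function[of bidisc f e] e
      continuous_on_subset[OF f subset_UNIV] compact_Times[OF compact_cball compact_cball] by metis
  have gc: "continuous_on UNIV g"
    using g(1) continuous_on_polymonial_function real_polynomial_function_eq by blast
  have "(\<lambda>N. complex_of_real (farey_sum N g / real N ^ 2)) \<longlonglongrightarrow> of_real (moebius_sum * limit_integral g)"
    using farey_sum_trig_poly_tendsto[OF trig_poly_real_polynomial[OF g(1)]]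
    by (simp add: farey_sum_of_real limit_integral_of_real)
  then have "(\<lambda>N. farey_sum N g / real N ^ 2) \<longlonglongrightarrow> moebius_sum * limit_integral g"
    by (rule tendsto_of_real_iff[THEN iffD1])
  then have "eventually (\<lambda>N. dist (farey_sum N g / real N ^ 2) (moebius_sum * limit_integral g) < r / 2) sequentially"
    using r by (intro tendstoD) auto
  then show "eventually (\<lambda>N. dist (farey_sum N f / real N ^ 2) (moebius_sum * limit_integral f) < r) sequentially"
    using eventually_gt_at_top[of 0]
  proof eventually_elim
    case (elim N)
    have "\<bar>farey_sum N f - farey_sum N g\<bar> \<le> e * real N ^ 2"
      using g(2) e by (intro farey_sum_abs_diff_le) (auto simp: less_imp_le)
    then have 1: "\<bar>farey_sum N f / real N ^ 2 - farey_sum N g / real N ^ 2\<bar> \<le> e"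
      using elim by (simp add: divide_le_eq flip: diff_divide_distrib)
    have "\<bar>limit_integral f - limit_integral g\<bar> \<le> e / 2"
      using g(2) by (intro limit_integral_abs_diff_le f gc) (auto simp: less_imp_le)
    then have "moebius_sum * \<bar>limit_integral f - limit_integral g\<bar> \<le> moebius_sum * (e / 2)"
      using S by (intro mult_left_mono) auto
    also have "\<dots> < moebius_sum * e" using S e by simp
    finally have 2: "\<bar>moebius_sum * limit_integral f - moebius_sum * limit_integral g\<bar> < moebius_sum * e"
      using S by (simp add: abs_mult flip: right_diff_distrib)
    have "r / (2 * t) * t = r / 2" if "t > 0" for t :: real using that by simp
    from this[of "1 + moebius_sum"] have "e * (1 + moebius_sum) = r / 2"
      using S unfolding e_def by auto
    then have "e + moebius_sum * e = r / 2" by (simp add: algebra_simps)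
    with 1 2 elim show ?case unfolding dist_real_def by linarith
  qed
qed

section \<open>Counting Farey denominators in closed sets\<close>

text \<open>The unique \<open>q'\<close> with \<open>N - q < q' \<le> N\<close> and \<open>p q' \<equiv> -1 (mod q)\<close>: the denominator of the Farey
  successor of \<open>p/q\<close>.\<close>

definition farey_next :: "nat \<Rightarrow> nat \<Rightarrow> int \<Rightarrow> int" where
  "farey_next N q p = int N - (int N + modular_inverse (int q) p) mod int q"

definition farey_vec :: "nat \<Rightarrow> nat \<Rightarrow> int \<Rightarrow> real \<times> real \<times> real" where
  "farey_vec N q p = (real q / real N, of_int (farey_next N q p) / real N, of_int p / real q)"

text \<open>A pair (q, p) stands for the fraction p/q in [0, 1); the fraction 1 has no successor and
  is left out.\<close>

definition farey_index :: "nat \<Rightarrow> (nat \<times> int) set" where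
  "farey_index N = (SIGMA q:{1..N}. unit_residues (int q))"

definition farey_count :: "nat \<Rightarrow> (real \<times> real \<times> real) set \<Rightarrow> nat" where
  "farey_count N K = card {(q, p) \<in> farey_index N. farey_vec N q p \<in> K}"

text \<open>The closure of \<open>farey_region\<close>. It contains the edge x = 0, y = 1, where y /
  x takes the default value 0.\<close>

definition closed_region :: "(real \<times> real \<times> real) set" where
  "closed_region = {(x, y, h). 0 \<le> x \<and> x \<le> 1 \<and> 0 \<le> y \<and> y \<le> 1 \<and> 1 \<le> x + y \<and> 0 \<le> h \<and> h \<le> 1}"

lemma finite_farey_index [simp]: "finite (farey_index N)"
  by (simp add: farey_index_def)

lemma farey_next_bounds:
  assumes "0 < q"
  shows "int N - int q < farey_next N q p" "farey_next N q p \<le> int N"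
  using assms pos_mod_bound[of "int q" "int N + modular_inverse (int q) p"]
    pos_mod_sign[of "int q" "int N + modular_inverse (int q) p"]
  by (auto simp: farey_next_def)

lemma farey_next_cong: "[farey_next N q p = - modular_inverse (int q) p] (mod int q)"
  unfolding farey_next_def cong_iff_dvd_diff
  by (simp add: algebra_simps minus_mod_eq_mult_div [symmetric])

lemma disc_map_farey_vec:
  assumes "q \<in> {1..N}"
  shows "disc_map (farey_vec N q p) = disc_point N q p"
proof -
  have "cis (2 * pi * (of_int (farey_next N q p) / real N) / (real q / real N)) =
      root_char (int q) (farey_next N q p)"
    using assms by (simp add: root_char_def)
  also have "\<dots> = root_char (int q) (- modular_inverse (int q) p)"
    by (rule root_char_cong[OF farey_next_cong])
  finally show ?thesis
    by (simp add: disc_map_def farey_vec_def disc_point_def) (simp add: root_char_def)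
qed

lemma farey_vec_in_closed_region:
  assumes "(q, p) \<in> farey_index N"
  shows "farey_vec N q p \<in> closed_region"
proof -
  have q: "1 \<le> q" "q \<le> N" and p: "0 \<le> p" "p < int q"
    using assms by (auto simp: farey_index_def unit_residues_iff)
  note b = farey_next_bounds[of q N p]
  have "real_of_int (farey_next N q p) \<le> real N" "real N \<le> real q + real_of_int (farey_next N q p)"
    "0 \<le> real_of_int (farey_next N q p)" "real_of_int p \<le> real q"
    using q p b by linarith+
  then show ?thesis
    using q p by (auto simp: farey_vec_def closed_region_def divide_simps)
qed

lemma cis_eq_imp:
  assumes "cis a = cis b"
  obtains n :: int where "a = b + of_int n * 2 * pi"
proof -
  have "cis (a - b) = 1" using assms by (simp flip: cis_divide)
  then have "cos (a - b) = 1" by (simp add: complex_eq_iff)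
  then show ?thesis using that by (auto simp: cos_one_2pi_int algebra_simps)
qed

lemma int_zero_if_small: "\<bar>of_int n * x\<bar> < x \<Longrightarrow> n = 0" for x :: real
proof (rule ccontr)
  assume "\<bar>of_int n * x\<bar> < x" "n \<noteq> 0"
  then have "1 \<le> \<bar>real_of_int n\<bar>" "0 < x" by auto
  then have "1 * x \<le> \<bar>real_of_int n\<bar> * \<bar>x\<bar>" by (intro mult_mono) auto
  then show False using \<open>\<bar>of_int n * x\<bar> < x\<close> \<open>0 < x\<close> by (simp add: abs_mult)
qed

text \<open>The norm recovers x, and the phases recover y up to a multiple of x and h up to an
  integer. Because v is interior, \<bar>y - y'\<bar> < x and \<bar>h - h'\<bar> < 1, so both
  multiples are 0. Two boundary points can have the same image, hence the asymmetric
  hypotheses.\<close>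

lemma disc_map_eq_imp:
  assumes v: "v \<in> farey_region" and v': "v' \<in> closed_region" and eq: "disc_map v = disc_map v'"
  shows "v = v'"
proof -
  obtain x y h where vv: "v = (x, y, h)" by (metis prod.exhaust)
  obtain x' y' h' where vv': "v' = (x', y', h')" by (metis prod.exhaust)
  have b: "0 < x" "x < 1" "y < 1" "1 < x + y" "0 < h" "h < 1"
    using v by (auto simp: vv farey_region_def)
  have b': "0 \<le> x'" "x' \<le> 1" "0 \<le> y'" "y' \<le> 1" "1 \<le> x' + y'" "0 \<le> h'" "h' \<le> 1"
    using v' by (auto simp: vv' closed_region_def)
  have z: "of_real x * cis (2 * pi * y / x) = of_real x' * cis (2 * pi * y' / x')"
    and w: "cis (2 * pi * h) = cis (2 * pi * h')"
    using eq by (auto simp: vv vv' disc_map_def)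
  have "x = x'" using arg_cong[OF z, of norm] b b' by (simp add: norm_mult)
  then have "cis (2 * pi * y / x) = cis (2 * pi * y' / x)" using z b by simp
  then obtain n where n: "2 * pi * y / x = 2 * pi * y' / x + of_int n * 2 * pi" by (rule cis_eq_imp)
  then have "2 * pi * y = 2 * pi * (y' + of_int n * x)" using b by (simp add: field_simps)
  then have n': "y = y' + of_int n * x" by simp
  then have "\<bar>of_int n * x\<bar> < x" using b b' \<open>x = x'\<close> by linarith
  then have "n = 0" by (rule int_zero_if_small)
  then have "y = y'" using n' by simp
  obtain m where m: "2 * pi * h = 2 * pi * h' + of_int m * 2 * pi" using w by (rule cis_eq_imp)
  then have "2 * pi * h = 2 * pi * (h' + of_int m)" by (simp add: algebra_simps)
  then have m': "h = h' + of_int m" by simp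
  then have "\<bar>of_int m * 1\<bar> < (1 :: real)" using b b' by linarith
  then have "m = 0" by (rule int_zero_if_small)
  then have "h = h'" using m' by simp
  with \<open>x = x'\<close> \<open>y = y'\<close> show ?thesis by (simp add: vv vv')
qed

text \<open>On the edge x = 0 the phase y/x has no limit, but the factor x has norm tending to 0 and
  the phase has norm 1.\<close>

lemma continuous_on_disc_map: "continuous_on closed_region disc_map"
proof -
  have "continuous (at v within closed_region) (\<lambda>v. of_real (fst v) * cis (2 * pi * fst (snd v) / fst v))"
    if v: "v \<in> closed_region" for v
  proof (cases "fst v = 0")
    case True
    have "((\<lambda>v. of_real (fst v) * cis (2 * pi * fst (snd v) / fst v)) \<longlongrightarrow> 0) (at v within closed_region)"
    proof (rule Lim_null_comparison)
      show "eventually (\<lambda>v. norm (of_real (fst v) * cis (2 * pi * fst (snd v) / fst v)) \<le> \<bar>fst v\<bar>)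
          (at v within closed_region)"
        by (intro always_eventually allI) (simp add: norm_mult)
      have "((\<lambda>v. \<bar>fst v\<bar>) \<longlongrightarrow> \<bar>fst v\<bar>) (at v within closed_region)"
        by (intro tendsto_intros)
      then show "((\<lambda>v. \<bar>fst v\<bar>) \<longlongrightarrow> 0) (at v within closed_region)" using True by simp
    qed
    then show ?thesis unfolding continuous_within using True by simp
  next
    case False
    then show ?thesis
      unfolding cis_conv_exp by (intro continuous_intros) auto
  qed
  then have "continuous_on closed_region (\<lambda>v. of_real (fst v) * cis (2 * pi * fst (snd v) / fst v))"
    by (simp add: continuous_on_eq_continuous_within)
  then have "continuous_on closed_region
      (\<lambda>v. (of_real (fst v) * cis (2 * pi * fst (snd v) / fst v), cis (2 * pi * snd (snd v))))"
    by (intro continuous_on_Pair) (auto intro!: continuous_intros)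
  then show ?thesis by (simp add: disc_map_def case_prod_unfold)
qed

lemma farey_sum_index: "farey_sum N f = (\<Sum>(q, p)\<in>farey_index N. f (disc_point N q p))"
  unfolding farey_sum_def farey_index_def by (rule sum.Sigma) auto

text \<open>Upper half of the portmanteau theorem, with the indicator of the compact set \<open>disc_map ` K\<close>
  approximated from above by \<open>max 0 (1 - n * infdist z (disc_map ` K))\<close>.\<close>

lemma eventually_farey_count_le:
  assumes K: "compact K" "K \<subseteq> closed_region" and e: "e > 0"
  shows "eventually (\<lambda>N. real (farey_count N K) / real N ^ 2 \<le>
    moebius_sum * measure lborel (farey_region \<inter> K) + e) sequentially"
proof (cases "K = {}")
  case True
  then show ?thesis using e by (simp add: farey_count_def)
next
  case False
  have S: "moebius_sum > 0" by (rule moebius_sum_pos)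
  let ?C = "disc_map ` K"
  have C: "compact ?C" "closed ?C" "?C \<noteq> {}"
    using K False compact_continuous_image[OF continuous_on_subset[OF continuous_on_disc_map K(2)] K(1)]
    by (auto simp: compact_imp_closed)
  define f where "f n z = max 0 (1 - real n * infdist z ?C)" for n z
  have f01: "0 \<le> f n z" "f n z \<le> 1" for n z by (auto simp: f_def infdist_nonneg)
  have f_cont: "continuous_on UNIV (f n)" for n
    unfolding f_def by (intro continuous_intros)
  have [measurable]: "f n \<in> borel_measurable borel" for n
    using f_cont by (rule borel_measurable_continuous_onI)
  have [measurable]: "K \<in> sets borel" using K(1) by (simp add: compact_imp_closed)
  have "(\<lambda>n. limit_integral (f n)) \<longlonglongrightarrow> (LINT v|lborel. indicator (farey_region \<inter> K) v)"
    unfolding limit_integral_def set_lebesgue_integral_def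
  proof (rule integral_dominated_convergence)
    show "integrable lborel (indicator farey_region :: _ \<Rightarrow> real)"
      using emeasure_farey_region_finite by (intro integrable_real_indicator) auto
    show "AE v in lborel. (\<lambda>n. indicator farey_region v *\<^sub>R f n (disc_map v)) \<longlonglongrightarrow>
        indicator (farey_region \<inter> K) v"
    proof (rule AE_I2)
      fix v
      show "(\<lambda>n. indicator farey_region v *\<^sub>R f n (disc_map v)) \<longlonglongrightarrow> indicator (farey_region \<inter> K) v"
      proof (cases "v \<in> farey_region \<and> v \<notin> K")
        case True
        \<comment> \<open>The boundary identifications are ruled out here: an interior point outside
          K shares its image with no point of K, so its image has positive distance from the compact
          image of K.\<close>
        then have "disc_map v \<notin> ?C" using disc_map_eq_imp K(2) by fastforce
        then have pos: "infdist (disc_map v) ?C > 0"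
          using C by (metis in_closed_iff_infdist_zero infdist_nonneg order_le_less)
        have "eventually (\<lambda>n. 1 / infdist (disc_map v) ?C < real n) sequentially"
          using filterlim_real_sequentially by (simp add: filterlim_at_top_dense)
        then have "eventually (\<lambda>n. indicator farey_region v *\<^sub>R f n (disc_map v) = 0) sequentially"
          by eventually_elim (use pos in \<open>simp add: f_def field_simps\<close>)
        then show ?thesis using True by (simp add: tendsto_eventually)
      next
        case False
        then have "indicator farey_region v *\<^sub>R f n (disc_map v) = indicator (farey_region \<inter> K) v" for n
          by (auto simp: indicator_def f_def)
        then show ?thesis by simp
      qed
    qed
    show "AE v in lborel. norm (indicator farey_region v *\<^sub>R f n (disc_map v)) \<le> indicator farey_region v" for n
      using f01 by (intro AE_I2) (auto simp: indicator_def)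
  qed measurable
  then have "(\<lambda>n. moebius_sum * limit_integral (f n)) \<longlonglongrightarrow> moebius_sum * measure lborel (farey_region \<inter> K)"
    by (intro tendsto_mult_left) simp
  then have "eventually (\<lambda>n. moebius_sum * limit_integral (f n) < moebius_sum * measure lborel (farey_region \<inter> K) + e)
      sequentially"
    using e by (intro order_tendstoD) auto
  then obtain n where n: "moebius_sum * limit_integral (f n) < moebius_sum * measure lborel (farey_region \<inter> K) + e"
    using eventually_happens'[OF sequentially_bot] by blast
  have "eventually (\<lambda>N. farey_sum N (f n) / real N ^ 2 < moebius_sum * measure lborel (farey_region \<inter> K) + e) sequentially"
    using farey_sum_tendsto[OF f_cont] n by (rule order_tendstoD)
  then show ?thesis
  proof eventually_elim
    case (elim N)
    have "real (farey_count N K) = (\<Sum>(q, p)\<in>farey_index N. if farey_vec N q p \<in> K then 1 else 0)"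
      unfolding farey_count_def case_prod_unfold
      by (subst sum.inter_filter[symmetric]) auto
    also have "\<dots> \<le> farey_sum N (f n)"
      unfolding farey_sum_index
    proof (intro sum_mono, clarify)
      fix q p assume "(q, p) \<in> farey_index N"
      then have eq: "disc_map (farey_vec N q p) = disc_point N q p"
        by (intro disc_map_farey_vec) (auto simp: farey_index_def)
      show "(if farey_vec N q p \<in> K then 1 else 0) \<le> f n (disc_point N q p)"
      proof (cases "farey_vec N q p \<in> K")
        case True
        then have "disc_point N q p \<in> ?C" unfolding eq[symmetric] by (rule imageI)
        then show ?thesis by (simp add: f_def)
      qed (simp add: f01)
    qed
    finally have "real (farey_count N K) / real N ^ 2 \<le> farey_sum N (f n) / real N ^ 2"
      by (rule divide_right_mono) simp
    then show ?case using elim by linarith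
  qed
qed


section \<open>Product sets over the triangle\<close>

definition farey_triangle :: "(real \<times> real) set" where
  "farey_triangle = {(x, y). 0 < x \<and> x < 1 \<and> y < 1 \<and> 1 < x + y}"

definition closed_triangle :: "(real \<times> real) set" where
  "closed_triangle = {(x, y). 0 \<le> x \<and> x \<le> 1 \<and> 0 \<le> y \<and> y \<le> 1 \<and> 1 \<le> x + y}"

text \<open>The product of A and J up to reassociation, because triples nest to the right and a set
  of pairs occupies their first two components.\<close>

definition fraction_cylinder :: "(real \<times> real) set \<Rightarrow> real set \<Rightarrow> (real \<times> real \<times> real) set" where
  "fraction_cylinder A J = {(x, y, h). (x, y) \<in> A \<and> h \<in> J}"

lemma open_farey_triangle: "open farey_triangle"
proof -
  have "farey_triangle = {v. 0 < fst v} \<inter> {v. fst v < 1} \<inter> {v. snd v < 1} \<inter> {v. 1 < fst v + snd v}"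
    by (auto simp: farey_triangle_def)
  also have "open \<dots>"
    by (intro open_Int open_Collect_less continuous_intros)
  finally show ?thesis .
qed

lemma farey_triangle_borel [measurable]: "farey_triangle \<in> sets borel"
  using open_farey_triangle by simp

lemma closed_closed_triangle: "closed closed_triangle"
proof -
  have "closed_triangle = {v. 0 \<le> fst v} \<inter> {v. fst v \<le> 1} \<inter> {v. 0 \<le> snd v} \<inter> {v. snd v \<le> 1} \<inter>
      {v. 1 \<le> fst v + snd v}"
    by (auto simp: closed_triangle_def)
  also have "closed \<dots>"
    by (intro closed_Int closed_Collect_le continuous_intros)
  finally show ?thesis .
qed

lemma farey_triangle_subset: "farey_triangle \<subseteq> closed_triangle" "closed_triangle \<subseteq> cbox (0, 0) (1, 1)"
  by (auto simp: farey_triangle_def closed_triangle_def cbox_Pair_eq)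

lemma farey_triangle_fmeasurable: "A \<in> sets borel \<Longrightarrow> farey_triangle \<inter> A \<in> fmeasurable lborel"
proof (rule fmeasurableI2[of "cbox (0, 0) (1, 1)"])
  show "farey_triangle \<inter> A \<subseteq> cbox (0, 0) (1, 1)"
    using farey_triangle_subset by blast
qed auto

lemma sets_fraction_cylinder:
  assumes A: "A \<in> sets borel" and J: "J \<in> sets borel"
  shows "fraction_cylinder A J \<in> sets borel"
proof -
  have eq: "fraction_cylinder A J = {v. (fst v, fst (snd v)) \<in> A} \<inter> {v. snd (snd v) \<in> J}"
    by (auto simp: fraction_cylinder_def)
  have pair: "(\<lambda>v :: real \<times> real \<times> real. (fst v, fst (snd v))) \<in> borel_measurable borel"
    by (intro borel_measurable_continuous_onI continuous_intros)
  have "{v. (fst v, fst (snd v)) \<in> A} \<in> sets (borel :: (real \<times> real \<times> real) measure)"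
    using measurable_sets[OF pair A] by (simp add: vimage_def)
  moreover have "{v. snd (snd v) \<in> J} \<in> sets (borel :: (real \<times> real \<times> real) measure)"
    using measurable_sets[OF _ J, of "\<lambda>v. snd (snd v)" borel] by (simp add: vimage_def)
  ultimately show ?thesis unfolding eq by (rule sets.Int)
qed

lemma emeasure_fraction_cylinder:
  assumes A: "A \<in> sets borel" and J: "J \<in> sets borel"
  shows "emeasure lborel (fraction_cylinder A J) = emeasure lborel A * emeasure lborel J"
proof -
  note meas = sets_fraction_cylinder[OF A J]
  define g where "g = (\<lambda>v. indicator (fraction_cylinder A J) v :: ennreal)"
  have g: "g \<in> borel_measurable (lborel \<Otimes>\<^sub>M lborel)"
    unfolding g_def lborel_prod using meas by simp
  have A': "(\<lambda>w. indicator A w :: ennreal) \<in> borel_measurable (lborel \<Otimes>\<^sub>M lborel)"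
    unfolding lborel_prod using A by simp
  have gx: "(\<lambda>w. g (x, w)) \<in> borel_measurable (lborel \<Otimes>\<^sub>M lborel)" for x
    using measurable_compose[OF measurable_Pair1' g, of x] by (simp add: lborel_prod)
  have "emeasure lborel (fraction_cylinder A J) = (\<integral>\<^sup>+v. g v \<partial>(lborel \<Otimes>\<^sub>M lborel))"
    using meas by (simp add: g_def lborel_prod)
  also have "\<dots> = (\<integral>\<^sup>+x. \<integral>\<^sup>+w. g (x, w) \<partial>lborel \<partial>lborel)"
    by (rule lborel.nn_integral_fst[OF g, symmetric])
  also have "\<dots> = (\<integral>\<^sup>+x. \<integral>\<^sup>+y. \<integral>\<^sup>+h. g (x, y, h) \<partial>lborel \<partial>lborel \<partial>lborel)"
    using lborel.nn_integral_fst[OF gx] by (simp add: lborel_prod)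
  also have "\<dots> = (\<integral>\<^sup>+x. \<integral>\<^sup>+y. indicator A (x, y) * emeasure lborel J \<partial>lborel \<partial>lborel)"
  proof (intro nn_integral_cong)
    fix x y
    have "g (x, y, h) = indicator A (x, y) * indicator J h" for h
      by (auto simp: g_def fraction_cylinder_def indicator_def)
    then show "(\<integral>\<^sup>+h. g (x, y, h) \<partial>lborel) = indicator A (x, y) * emeasure lborel J"
      using J by (simp add: nn_integral_cmult)
  qed
  also have "\<dots> = (\<integral>\<^sup>+w. indicator A w * emeasure lborel J \<partial>(lborel \<Otimes>\<^sub>M lborel))"
    using A' by (intro lborel.nn_integral_fst borel_measurable_times_ennreal borel_measurable_const)
  also have "\<dots> = emeasure lborel A * emeasure lborel J"
    using A by (subst nn_integral_multc) (auto simp: lborel_prod)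
  finally show ?thesis .
qed

lemma measure_cylinder_le:
  assumes A: "A \<in> sets borel" and ab: "a \<le> b"
  shows "measure lborel (farey_region \<inter> fraction_cylinder A {a..b}) \<le>
    measure lborel (farey_triangle \<inter> A) * (b - a)"
proof -
  let ?L = "fraction_cylinder (farey_triangle \<inter> A) {a..b}"
  have fin: "emeasure lborel (farey_triangle \<inter> A) < \<infinity>"
    using farey_triangle_fmeasurable[OF A] by (simp add: fmeasurable_def)
  have em: "emeasure lborel ?L = emeasure lborel (farey_triangle \<inter> A) * ennreal (b - a)"
    using A ab by (subst emeasure_fraction_cylinder) auto
  have "measure lborel (farey_region \<inter> fraction_cylinder A {a..b}) \<le> measure lborel ?L"
  proof (rule measure_mono_fmeasurable)
    show "farey_region \<inter> fraction_cylinder A {a..b} \<subseteq> ?L"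
      by (auto simp: farey_region_def fraction_cylinder_def farey_triangle_def)
    note * = sets_fraction_cylinder[OF _ borel_closed[OF closed_atLeastAtMost]]
    show "farey_region \<inter> fraction_cylinder A {a..b} \<in> sets lborel" using *[OF A] by simp
    show "?L \<in> fmeasurable lborel"
      using * A em fin by (auto simp: fmeasurable_def ennreal_mult_less_top)
  qed
  also have "\<dots> = measure lborel (farey_triangle \<inter> A) * (b - a)"
    using ab by (simp add: measure_def em enn2real_mult)
  finally show ?thesis .
qed

text \<open>The third factor is an interval of length 1, so the area equals the mass of
  \<open>farey_region\<close>, which the trivial moment has given.\<close>

lemma measure_farey_triangle: "measure lborel farey_triangle = 1 / 2"
proof -
  have eq: "farey_region = fraction_cylinder farey_triangle {0<..<1}"
    by (auto simp: farey_region_def fraction_cylinder_def farey_triangle_def)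
  have "emeasure lborel farey_region = emeasure lborel farey_triangle"
    unfolding eq by (subst emeasure_fraction_cylinder) auto
  moreover have "measure lborel farey_region = 1 / 2"
    using limit_integral_const[of 1] by (simp add: limit_integral_def set_lebesgue_integral_def)
  ultimately show ?thesis by (simp add: measure_def)
qed

lemma compact_fraction_cylinder:
  assumes "compact A"
  shows "compact (fraction_cylinder A {a..b})"
proof -
  have "fraction_cylinder A {a..b} = (\<lambda>v. (fst (fst v), snd (fst v), snd v)) ` (A \<times> {a..b})"
    by (auto simp: fraction_cylinder_def image_def) force
  then show ?thesis
    using assms by (auto intro!: compact_continuous_image compact_Times continuous_intros)
qed

lemma fraction_cylinder_subset_closed_region:
  assumes "A \<subseteq> closed_triangle" "0 \<le> a" "b \<le> 1"
  shows "fraction_cylinder A {a..b} \<subseteq> closed_region"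
  using assms by (fastforce simp: fraction_cylinder_def closed_region_def closed_triangle_def)

text \<open>The counted set K may be any subset of the cylinder: half-open intervals and strict
  level sets are enclosed in closed ones before the compact bound is applied.\<close>

lemma eventually_farey_count_cylinder_le:
  assumes A: "closed A" "A \<subseteq> closed_triangle" and ab: "0 \<le> a" "a \<le> b" "b \<le> 1"
    and m: "measure lborel (farey_triangle \<inter> A) \<le> m" and e: "e > 0"
    and K: "K \<subseteq> fraction_cylinder A {a..b}"
  shows "eventually (\<lambda>N. real (farey_count N K) / real N ^ 2 \<le> moebius_sum * (m * (b - a)) + e) sequentially"
proof -
  have S: "moebius_sum > 0" by (rule moebius_sum_pos)
  have "compact A"
    using A farey_triangle_subset(2) by (meson bounded_cbox bounded_subset compact_eq_bounded_closed)
  then have "eventually (\<lambda>N. real (farey_count N (fraction_cylinder A {a..b})) / real N ^ 2 \<le>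
      moebius_sum * measure lborel (farey_region \<inter> fraction_cylinder A {a..b}) + e) sequentially"
    using A ab e by (intro eventually_farey_count_le compact_fraction_cylinder
        fraction_cylinder_subset_closed_region)
  then show ?thesis
  proof eventually_elim
    case (elim N)
    have "farey_count N K \<le> farey_count N (fraction_cylinder A {a..b})"
      unfolding farey_count_def
      using K by (intro card_mono finite_subset[OF _ finite_farey_index[of N]]) auto
    then have "real (farey_count N K) / real N ^ 2 \<le>
        real (farey_count N (fraction_cylinder A {a..b})) / real N ^ 2"
      by (intro divide_right_mono) auto
    moreover have "measure lborel (farey_region \<inter> fraction_cylinder A {a..b}) \<le> m * (b - a)"
      using measure_cylinder_le[of A a b] A ab mult_right_mono[OF m, of "b - a"] by simp
    then have "moebius_sum * measure lborel (farey_region \<inter> fraction_cylinder A {a..b}) \<le> moebius_sum * (m * (b - a))"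
      using S by (intro mult_left_mono) auto
    ultimately show ?case using elim by linarith
  qed
qed

section \<open>Level sets of an observable\<close>

lemma tendsto_if_eventually_le_and_sum_tendsto:
  fixes u v :: "nat \<Rightarrow> real"
  assumes sum: "(\<lambda>n. u n + v n) \<longlonglongrightarrow> l + m"
    and u: "\<And>e. e > 0 \<Longrightarrow> eventually (\<lambda>n. u n \<le> l + e) sequentially"
    and v: "\<And>e. e > 0 \<Longrightarrow> eventually (\<lambda>n. v n \<le> m + e) sequentially"
  shows "u \<longlonglongrightarrow> l"
proof (rule tendstoI)
  fix e :: real assume e: "e > 0"
  from tendstoD[OF sum, of "e / 2"] u[of "e / 2"] v[of "e / 2"]
  have "eventually (\<lambda>n. dist (u n + v n) (l + m) < e / 2) sequentially"
    "eventually (\<lambda>n. u n \<le> l + e / 2) sequentially" "eventually (\<lambda>n. v n \<le> m + e / 2) sequentially"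
    using e by auto
  then show "eventually (\<lambda>n. dist (u n) l < e) sequentially"
  proof eventually_elim
    case (elim n)
    then show ?case using e unfolding dist_real_def by linarith
  qed
qed

text \<open>This is \<Omega> itself, where the points (q/N, q'/N) lie; \<open>farey_triangle\<close>
  is its interior.\<close>

definition half_open_triangle :: "(real \<times> real) set" where
  "half_open_triangle = {(x, y). 0 < x \<and> x \<le> 1 \<and> 0 < y \<and> y \<le> 1 \<and> 1 < x + y}"

lemma farey_vec_in_half_open_triangle:
  assumes "(q, p) \<in> farey_index N"
  shows "farey_vec N q p \<in> fraction_cylinder half_open_triangle {0..1}"
proof -
  have q: "1 \<le> q" "q \<le> N" using assms by (auto simp: farey_index_def)
  note b = farey_next_bounds[of q N p]
  have "real_of_int (farey_next N q p) \<le> real N" "real N < real q + real_of_int (farey_next N q p)"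
    "0 < real_of_int (farey_next N q p)"
    using q b by linarith+
  moreover have "0 \<le> snd (snd (farey_vec N q p))" "snd (snd (farey_vec N q p)) \<le> 1"
    using farey_vec_in_closed_region[OF assms] by (auto simp: closed_region_def)
  ultimately show ?thesis
    using q by (auto simp: farey_vec_def fraction_cylinder_def half_open_triangle_def divide_simps)
qed

lemma half_open_triangle_closure: "closure half_open_triangle \<subseteq> closed_triangle"
  by (rule closure_minimal[OF _ closed_closed_triangle]) (auto simp: half_open_triangle_def closed_triangle_def)

text \<open>At a point of the open triangle F is continuous, so F w outside the closed set P
  persists in a neighbourhood. The closure of the level set thus adds points on the boundary of the
  triangle only.\<close>

lemma farey_triangle_Int_closure_subset:
  fixes F :: "real \<times> real \<Rightarrow> real"
  assumes F: "continuous_on {w. 0 < fst w \<and> 0 < snd w} F" and P: "closed P"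
  shows "farey_triangle \<inter> closure {w \<in> half_open_triangle. F w \<in> P} \<subseteq> {w \<in> farey_triangle. F w \<in> P}"
proof (clarify, rule ccontr)
  fix x y assume w: "(x, y) \<in> farey_triangle" "(x, y) \<in> closure {w \<in> half_open_triangle. F w \<in> P}"
    and notin: "F (x, y) \<notin> P"
  have "open {w :: real \<times> real. 0 < fst w \<and> 0 < snd w}"
    by (intro open_Collect_conj open_Collect_less continuous_intros)
  then have "isCont F (x, y)"
    using F w(1) by (auto simp: farey_triangle_def continuous_on_eq_continuous_at)
  then have "eventually (\<lambda>w. F w \<in> - P) (at (x, y))"
    unfolding isCont_def using topological_tendstoD[OF _ open_Compl[OF P]] notin by blast
  then have "eventually (\<lambda>w. F w \<in> - P) (nhds (x, y))"
    using notin by (auto simp: eventually_nhds_conv_at)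
  then obtain U where U: "open U" "(x, y) \<in> U" "\<And>w. w \<in> U \<Longrightarrow> F w \<notin> P"
    by (auto simp: eventually_nhds)
  then obtain z where "z \<in> U" "z \<in> {w \<in> half_open_triangle. F w \<in> P}"
    using w(2) by (meson disjoint_iff open_Int_closure_eq_empty)
  then show False using U(3) by auto
qed

lemma sublevel_borel:
  fixes F :: "real \<times> real \<Rightarrow> real"
  assumes F_cont: "continuous_on {w. 0 < fst w \<and> 0 < snd w} F" and P: "closed P"
  shows "{w \<in> farey_triangle. F w \<in> P} \<in> sets borel"
proof -
  have "F \<in> borel_measurable (restrict_space borel {w. 0 < fst w \<and> 0 < snd w})"
    by (rule borel_measurable_continuous_on_restrict[OF F_cont])
  then have "F \<in> borel_measurable (restrict_space borel farey_triangle)"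
    by (rule measurable_restrict_mono) (auto simp: farey_triangle_def)
  then have "F -` P \<inter> space (restrict_space borel farey_triangle) \<in> sets (restrict_space borel farey_triangle)"
    using P by (intro measurable_sets) auto
  moreover have "F -` P \<inter> space (restrict_space borel farey_triangle) = {w \<in> farey_triangle. F w \<in> P}"
    by (auto simp: space_restrict_space)
  ultimately show ?thesis by (simp add: sets_restrict_space_iff)
qed

text \<open>Continuity is asked on the open quadrant, since the observables may blow up at the axes.
  The null level set makes {F \<ge> t} and {F \<le> t}, which are both relatively closed,
  complementary up to measure 0.\<close>

locale farey_observable =
  fixes F :: "real \<times> real \<Rightarrow> real" and t :: real and \<alpha> \<beta> :: real
  assumes F_cont: "continuous_on {w. 0 < fst w \<and> 0 < snd w} F"
    and level_null: "measure lborel {w \<in> farey_triangle. F w = t} = 0"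
    and interval: "0 \<le> \<alpha>" "\<alpha> < \<beta>" "\<beta> \<le> 1"
begin

definition upper_area :: real where
  "upper_area = measure lborel {w \<in> farey_triangle. t \<le> F w}"

definition lower_area :: real where
  "lower_area = measure lborel {w \<in> farey_triangle. F w \<le> t}"

lemma areas_sum: "upper_area + lower_area = 1 / 2"
proof -
  let ?A = "{w \<in> farey_triangle. F w \<in> {t..}}" and ?B = "{w \<in> farey_triangle. F w \<in> {..t}}"
  have fm: "{w \<in> farey_triangle. F w \<in> P} \<in> fmeasurable lborel" if "closed P" for P
  proof -
    have "{w \<in> farey_triangle. F w \<in> P} = farey_triangle \<inter> {w \<in> farey_triangle. F w \<in> P}" by auto
    then show ?thesis using farey_triangle_fmeasurable[OF sublevel_borel[OF F_cont that]] by simp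
  qed
  have "measure lborel (?A \<union> ?B) = measure lborel ?A + measure lborel ?B - measure lborel (?A \<inter> ?B)"
    by (rule measure_Un3[OF fm[OF closed_atLeast] fm[OF closed_atMost]])
  moreover have "?A \<union> ?B = farey_triangle" by auto
  moreover have "?A \<inter> ?B = {w \<in> farey_triangle. F w = t}" by auto
  ultimately show ?thesis
    using level_null measure_farey_triangle by (simp add: upper_area_def lower_area_def)
qed

definition upper_count :: "nat \<Rightarrow> nat" where
  "upper_count N = farey_count N (fraction_cylinder {w. t \<le> F w} {\<alpha>..\<beta>})"

text \<open>The inequality is strict so that the counts form a partition, whereas
  \<open>lower_area\<close> is taken with \<le> because the upper bound concerns closed
  sets.\<close>

definition lower_count :: "nat \<Rightarrow> nat" where
  "lower_count N = farey_count N (fraction_cylinder {w. F w < t} {\<alpha>..\<beta>})"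

definition outer_count :: "nat \<Rightarrow> nat" where
  "outer_count N = farey_count N (fraction_cylinder UNIV {0..<\<alpha>}) + farey_count N (fraction_cylinder UNIV {\<beta><..1})"

lemma farey_count_restrict:
  "farey_count N K = farey_count N (K \<inter> fraction_cylinder half_open_triangle {0..1})"
  unfolding farey_count_def using farey_vec_in_half_open_triangle
  by (intro arg_cong[where f = card]) auto

lemma counts_sum:
  "real (upper_count N) + real (lower_count N) + real (outer_count N) = (\<Sum>q=1..N. real (totient q))"
proof -
  let ?C = "\<lambda>K. {(q, p) \<in> farey_index N. farey_vec N q p \<in> K}"
  let ?K = "fraction_cylinder {w. t \<le> F w} {\<alpha>..\<beta>}" and ?L = "fraction_cylinder {w. F w < t} {\<alpha>..\<beta>}"
    and ?M = "fraction_cylinder UNIV {0..<\<alpha>}" and ?O = "fraction_cylinder UNIV {\<beta><..1}"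
  have fin: "finite (?C K)" for K by (rule finite_subset[OF _ finite_farey_index[of N]]) auto
  have "farey_index N = ?C ?K \<union> (?C ?L \<union> (?C ?M \<union> ?C ?O))"
  proof (intro equalityI subsetI)
    fix x assume x: "x \<in> farey_index N"
    obtain q p where x_eq: "x = (q, p)" by fastforce
    obtain X Y H where v: "farey_vec N q p = (X, Y, H)" by (metis prod.exhaust)
    have "0 \<le> H" "H \<le> 1"
      using farey_vec_in_half_open_triangle[of q p N] x by (auto simp: x_eq v fraction_cylinder_def)
    then have "farey_vec N q p \<in> ?K \<union> (?L \<union> (?M \<union> ?O))"
      by (auto simp: v fraction_cylinder_def)
    then show "x \<in> ?C ?K \<union> (?C ?L \<union> (?C ?M \<union> ?C ?O))" using x by (auto simp: x_eq)
  qed auto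
  then have "card (farey_index N) = card (?C ?K \<union> (?C ?L \<union> (?C ?M \<union> ?C ?O)))" by simp
  also have "\<dots> = card (?C ?K) + (card (?C ?L) + (card (?C ?M) + card (?C ?O)))"
  proof -
    have d1: "?C ?M \<inter> ?C ?O = {}" and d2: "?C ?L \<inter> (?C ?M \<union> ?C ?O) = {}"
      and d3: "?C ?K \<inter> (?C ?L \<union> (?C ?M \<union> ?C ?O)) = {}"
      using interval by (auto simp: fraction_cylinder_def)
    show ?thesis
      by (simp only: card_Un_disjoint[OF fin fin d1] card_Un_disjoint[OF fin finite_UnI[OF fin fin] d2]
          card_Un_disjoint[OF fin finite_UnI[OF fin finite_UnI[OF fin fin]] d3])
  qed
  also have "\<dots> = upper_count N + lower_count N + outer_count N"
    by (simp add: upper_count_def lower_count_def outer_count_def farey_count_def)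
  finally have "upper_count N + lower_count N + outer_count N = card (farey_index N)" ..
  also have "\<dots> = (\<Sum>q=1..N. totient q)"
    by (simp add: farey_index_def card_unit_residues)
  finally show ?thesis by (metis of_nat_add of_nat_sum)
qed

text \<open>The level set inside \<open>half_open_triangle\<close> is enlarged to its closure, a
  compact set. By \<open>farey_triangle_Int_closure_subset\<close> the part of the closure in the
  open triangle still satisfies the condition, so the area does not grow.\<close>

lemma eventually_level_count_le:
  assumes P: "closed P" and e: "e > 0"
    and m: "measure lborel {w \<in> farey_triangle. F w \<in> P} = m"
    and K: "K \<inter> fraction_cylinder half_open_triangle {0..1} \<subseteq>
      fraction_cylinder {w \<in> half_open_triangle. F w \<in> P} {\<alpha>..\<beta>}"
  shows "eventually (\<lambda>N. real (farey_count N K) / real N ^ 2 \<le> moebius_sum * (m * (\<beta> - \<alpha>)) + e) sequentially"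
proof -
  let ?A = "closure {w \<in> half_open_triangle. F w \<in> P}"
  have "measure lborel (farey_triangle \<inter> ?A) \<le> measure lborel {w \<in> farey_triangle. F w \<in> P}"
  proof (rule measure_mono_fmeasurable)
    show "farey_triangle \<inter> ?A \<subseteq> {w \<in> farey_triangle. F w \<in> P}"
      by (rule farey_triangle_Int_closure_subset[OF F_cont P])
    have "{w \<in> farey_triangle. F w \<in> P} = farey_triangle \<inter> {w \<in> farey_triangle. F w \<in> P}" by auto
    then show "{w \<in> farey_triangle. F w \<in> P} \<in> fmeasurable lborel"
      using farey_triangle_fmeasurable[OF sublevel_borel[OF F_cont P]] by simp
  qed auto
  moreover have "?A \<subseteq> closed_triangle"
    using half_open_triangle_closure closure_mono[of "{w \<in> half_open_triangle. F w \<in> P}" half_open_triangle]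
    by blast
  moreover have "K \<inter> fraction_cylinder half_open_triangle {0..1} \<subseteq> fraction_cylinder ?A {\<alpha>..\<beta>}"
    using K closure_subset[of "{w \<in> half_open_triangle. F w \<in> P}"]
    by (fastforce simp: fraction_cylinder_def)
  ultimately have "eventually (\<lambda>N. real (farey_count N (K \<inter> fraction_cylinder half_open_triangle {0..1})) / real N ^ 2
      \<le> moebius_sum * (m * (\<beta> - \<alpha>)) + e) sequentially"
    using interval e m by (intro eventually_farey_count_cylinder_le[of ?A]) auto
  then show ?thesis by (simp flip: farey_count_restrict)
qed

lemma eventually_upper_count_le:
  "e > 0 \<Longrightarrow> eventually (\<lambda>N. real (upper_count N) / real N ^ 2 \<le>
    moebius_sum * (upper_area * (\<beta> - \<alpha>)) + e) sequentially"
  unfolding upper_count_def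
  by (rule eventually_level_count_le[of "{t..}"]) (auto simp: upper_area_def fraction_cylinder_def)

lemma eventually_lower_count_le:
  "e > 0 \<Longrightarrow> eventually (\<lambda>N. real (lower_count N) / real N ^ 2 \<le>
    moebius_sum * (lower_area * (\<beta> - \<alpha>)) + e) sequentially"
  unfolding lower_count_def
  by (rule eventually_level_count_le[of "{..t}"]) (auto simp: lower_area_def fraction_cylinder_def)

lemma eventually_outer_count_le:
  assumes e: "e > 0"
  shows "eventually (\<lambda>N. real (outer_count N) / real N ^ 2 \<le>
    moebius_sum * (1 / 2 * (1 - (\<beta> - \<alpha>))) + e) sequentially"
proof -
  have tri: "measure lborel (farey_triangle \<inter> closed_triangle) \<le> 1 / 2"
    using measure_farey_triangle farey_triangle_subset(1) by (simp add: Int_absorb2)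
  have 1: "eventually (\<lambda>N. real (farey_count N (fraction_cylinder UNIV {0..<\<alpha>} \<inter> fraction_cylinder half_open_triangle {0..1}))
      / real N ^ 2 \<le> moebius_sum * (1 / 2 * (\<alpha> - 0)) + e / 2) sequentially"
    using interval e tri closed_closed_triangle
    by (intro eventually_farey_count_cylinder_le[of closed_triangle])
      (auto simp: fraction_cylinder_def half_open_triangle_def closed_triangle_def)
  have 2: "eventually (\<lambda>N. real (farey_count N (fraction_cylinder UNIV {\<beta><..1} \<inter> fraction_cylinder half_open_triangle {0..1}))
      / real N ^ 2 \<le> moebius_sum * (1 / 2 * (1 - \<beta>)) + e / 2) sequentially"
    using interval e tri closed_closed_triangle
    by (intro eventually_farey_count_cylinder_le[of closed_triangle])
      (auto simp: fraction_cylinder_def half_open_triangle_def closed_triangle_def)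
  from 1 2 show ?thesis
    unfolding farey_count_restrict[symmetric]
  proof eventually_elim
    case (elim N)
    have "moebius_sum * (1 / 2 * (1 - (\<beta> - \<alpha>))) + e =
        (moebius_sum * (1 / 2 * (\<alpha> - 0)) + e / 2) + (moebius_sum * (1 / 2 * (1 - \<beta>)) + e / 2)"
      by (simp add: field_simps)
    then show ?case using elim unfolding outer_count_def of_nat_add add_divide_distrib by linarith
  qed
qed

text \<open>The upper bounds for all pieces add up to the limit of the total, so each of them is attained.\<close>

lemma counts_tendsto:
  "(\<lambda>N. real (upper_count N) / real N ^ 2) \<longlonglongrightarrow> moebius_sum * (upper_area * (\<beta> - \<alpha>))"
  "(\<lambda>N. real (lower_count N) / real N ^ 2) \<longlonglongrightarrow> moebius_sum * (lower_area * (\<beta> - \<alpha>))"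
proof -
  let ?u = "\<lambda>N. real (upper_count N) / real N ^ 2" and ?l = "\<lambda>N. real (lower_count N) / real N ^ 2"
    and ?o = "\<lambda>N. real (outer_count N) / real N ^ 2"
  let ?U = "moebius_sum * (upper_area * (\<beta> - \<alpha>))" and ?L = "moebius_sum * (lower_area * (\<beta> - \<alpha>))"
    and ?O = "moebius_sum * (1 / 2 * (1 - (\<beta> - \<alpha>)))"
  have "?U + ?L + ?O = moebius_sum * ((upper_area + lower_area) * (\<beta> - \<alpha>) + 1 / 2 * (1 - (\<beta> - \<alpha>)))"
    by (simp add: algebra_simps)
  also have "\<dots> = moebius_sum / 2" unfolding areas_sum by (simp add: field_simps)
  finally have lim: "?U + ?L + ?O = moebius_sum / 2" .
  have "?u N + ?l N + ?o N = (\<Sum>q=1..N. real q ^ 0 * real (totient q)) / real N ^ (0 + 2)" for N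
    using counts_sum[of N] by (simp add: power2_eq_square flip: add_divide_distrib)
  then have sum: "(\<lambda>N. ?u N + ?l N + ?o N) \<longlonglongrightarrow> ?U + ?L + ?O"
    unfolding lim using sum_totient_tendsto[of 0] by (simp add: moebius_sum_def)
  have add: "eventually (\<lambda>N. f N + ?o N \<le> c + ?O + e) sequentially"
    if "\<And>e. e > 0 \<Longrightarrow> eventually (\<lambda>N. f N \<le> c + e) sequentially" "e > 0" for f c e
  proof -
    have "e / 2 > 0" using that(2) by simp
    from that(1)[OF this] eventually_outer_count_le[OF this] show ?thesis
    proof eventually_elim
      case (elim N)
      then show ?case using field_sum_of_halves[of e] by (simp only: add.assoc)
    qed
  qed
  show "?u \<longlonglongrightarrow> ?U"
  proof (rule tendsto_if_eventually_le_and_sum_tendsto)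
    show "(\<lambda>N. ?u N + (?l N + ?o N)) \<longlonglongrightarrow> ?U + (?L + ?O)"
      using sum by (simp only: add.assoc)
    show "eventually (\<lambda>N. ?u N \<le> ?U + e) sequentially" if "e > 0" for e
      using that by (rule eventually_upper_count_le)
    show "eventually (\<lambda>N. ?l N + ?o N \<le> ?L + ?O + e) sequentially" if "e > 0" for e
      by (rule add[OF eventually_lower_count_le that])
  qed
  show "?l \<longlonglongrightarrow> ?L"
  proof (rule tendsto_if_eventually_le_and_sum_tendsto)
    show "(\<lambda>N. ?l N + (?u N + ?o N)) \<longlonglongrightarrow> ?L + (?U + ?O)"
      using sum by (simp only: add.assoc add.left_commute[of "real (upper_count _) / _"]
          add.left_commute[of ?U])
    show "eventually (\<lambda>N. ?l N \<le> ?L + e) sequentially" if "e > 0" for e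
      using that by (rule eventually_lower_count_le)
    show "eventually (\<lambda>N. ?u N + ?o N \<le> ?U + ?O + e) sequentially" if "e > 0" for e
      by (rule add[OF eventually_upper_count_le that])
  qed
qed

end

section \<open>Farey successors\<close>

text \<open>Since p q' is -1 modulo q, the integer p q' + 1 is a multiple of q; the quotient p' is
  the numerator of the successor.\<close>

lemma farey_next_determinant:
  assumes "(q, p) \<in> farey_index N"
  obtains p' where "p' * int q - p * farey_next N q p = 1"
proof -
  have q: "1 \<le> q" and p: "coprime p (int q)"
    using assms by (auto simp: farey_index_def unit_residues_iff)
  have "[p * farey_next N q p = p * (- modular_inverse (int q) p)] (mod int q)"
    by (intro cong_mult cong_refl farey_next_cong)
  also have "p * (- modular_inverse (int q) p) = - (p * modular_inverse (int q) p)" by simp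
  also have "[- (p * modular_inverse (int q) p) = - 1] (mod int q)"
    using cong_modular_inverse1[OF p] by (simp add: cong_minus_minus_iff)
  finally have "int q dvd p * farey_next N q p + 1" by (simp add: cong_iff_dvd_diff)
  then obtain p' where "p * farey_next N q p + 1 = int q * p'" by (auto elim: dvdE)
  then show ?thesis by (intro that[of p']) (simp add: mult.commute)
qed

lemma quotient_of_Fract_coprime: "0 < q \<Longrightarrow> coprime p q \<Longrightarrow> quotient_of (Fract p q) = (p, q)"
  by (simp add: quotient_of_Fract normalize_stable)

lemma farey_index_Fract:
  assumes "(q, p) \<in> farey_index N"
  shows "Fract p (int q) \<in> farey N" "Fract p (int q) < 1" "quotient_of (Fract p (int q)) = (p, int q)"
    "of_rat (Fract p (int q)) = (of_int p / of_nat q :: real)"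
proof -
  have q: "1 \<le> q" "q \<le> N" and p: "0 \<le> p" "p < int q" "coprime p (int q)"
    using assms by (auto simp: farey_index_def unit_residues_iff)
  then show "Fract p (int q) \<in> farey N"
    unfolding farey_def by (intro CollectI exI[of _ p] exI[of _ "int q"]) auto
  show "Fract p (int q) < 1" using p q by (simp add: One_rat_def)
  show "quotient_of (Fract p (int q)) = (p, int q)" using p q by (simp add: quotient_of_Fract_coprime)
  show "of_rat (Fract p (int q)) = (of_int p / of_nat q :: real)" using q by (simp add: of_rat_rat)
qed

lemma farey_eq_Fract_index:
  assumes "r \<in> farey N" "r < 1"
  obtains q p where "(q, p) \<in> farey_index N" "r = Fract p (int q)"
proof -
  obtain p q where pq: "r = Fract p q" "0 \<le> p" "p \<le> q" "q \<le> int N" "1 \<le> q" "coprime p q"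
    using assms(1) by (auto simp: farey_def)
  then have "p < q" using assms(2) by (simp add: One_rat_def)
  then have "(nat q, p) \<in> farey_index N" using pq by (auto simp: farey_index_def unit_residues_iff)
  then show ?thesis using pq by (intro that[of "nat q" p]) auto
qed

text \<open>A fraction a/b strictly between p/q and p'/q' makes both a q - p b and p' b - a q' at
  least 1. By the determinant relation b = q (p' b - a q') + q' (a q - p b) \<ge> q + q' > N, so a/b
  does not have order N.\<close>

lemma farey_successor:
  assumes index: "(q, p) \<in> farey_index N"
  obtains r where "r \<in> farey N" "denom r = farey_next N q p" "Fract p (int q) < r"
    "\<And>s. s \<in> farey N \<Longrightarrow> Fract p (int q) < s \<Longrightarrow> r \<le> s"
proof -
  have q: "1 \<le> q" "q \<le> N" and p: "0 \<le> p" "p < int q"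
    using index by (auto simp: farey_index_def unit_residues_iff)
  let ?q' = "farey_next N q p"
  have q': "int N < int q + ?q'" "?q' \<le> int N" "1 \<le> ?q'"
    using farey_next_bounds[of q N p] q by auto
  obtain p' where det: "p' * int q - p * ?q' = 1" using farey_next_determinant[OF index] .
  have cop: "coprime p' ?q'"
  proof (rule coprimeI)
    fix c assume "c dvd p'" "c dvd ?q'"
    then have "c dvd p' * int q - p * ?q'" by (intro dvd_diff dvd_mult dvd_mult2)
    then show "is_unit c" by (simp only: det)
  qed
  have "0 \<le> p * ?q'" using p q' by simp
  then have "0 < p' * int q" using det by linarith
  then have p'0: "0 \<le> p'" by (simp add: zero_less_mult_iff)
  \<comment> \<open>From p \<le> q - 1 and q' \<ge> 1 it follows that p' q = 1 + p q' \<le> q q',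
    which keeps the successor at most 1.\<close>
  have "p * ?q' \<le> (int q - 1) * ?q'" using p q' by (intro mult_right_mono) auto
  then have "p' * int q \<le> ?q' * int q" using det q' by (simp add: algebra_simps)
  then have p'le: "p' \<le> ?q'" using q by simp
  show ?thesis
  proof (rule that[of "Fract p' ?q'"])
    show "Fract p' ?q' \<in> farey N"
      unfolding farey_def using p'0 p'le q' cop by (intro CollectI exI[of _ p'] exI[of _ ?q']) auto
    show "denom (Fract p' ?q') = ?q'"
      using q' cop by (simp add: denom_def quotient_of_Fract_coprime)
    show "Fract p (int q) < Fract p' ?q'" using q q' det by simp
  next
    fix s assume s: "s \<in> farey N" "Fract p (int q) < s"
    show "Fract p' ?q' \<le> s"
    proof (rule ccontr)
      assume "\<not> Fract p' ?q' \<le> s"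
      then have lt: "s < Fract p' ?q'" by simp
      obtain a b where ab: "s = Fract a b" "1 \<le> b" "b \<le> int N"
        using s(1) by (auto simp: farey_def)
      have "p * b < a * int q" using s(2) ab q by simp
      then have 1: "1 \<le> a * int q - p * b" by simp
      have "a * ?q' < p' * b" using lt ab q' by simp
      then have 2: "1 \<le> p' * b - a * ?q'" by simp
      have "b = b * (p' * int q - p * ?q')" by (simp add: det)
      also have "\<dots> = int q * (p' * b - a * ?q') + ?q' * (a * int q - p * b)"
        by (simp add: algebra_simps)
      also have "\<dots> \<ge> int q * 1 + ?q' * 1"
        using 1 2 q q' by (intro add_mono mult_left_mono) auto
      finally show False using ab q' by simp
    qed
  qed
qed

section \<open>Consecutive entries of the list\<close>

lemma set_farey_list:
  "set (farey_list \<alpha> \<beta> N) = {r \<in> farey N. of_rat r \<in> {\<alpha>..\<beta>}}"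
  unfolding farey_list_def by (rule set_sorted_list_of_set) (simp add: finite_farey)

lemma farey_list_sorted: "sorted_wrt (<) (farey_list \<alpha> \<beta> N)"
  unfolding farey_list_def by simp

text \<open>Restriction to the interval preserves successors: the successor r' of r in the whole
  sequence satisfies r < r' \<le> s for the next listed fraction s, so r' lies in the interval, is
  itself listed, and equals s.\<close>

lemma farey_point_eq_farey_vec:
  assumes j: "1 \<le> j" "j \<le> length (farey_list \<alpha> \<beta> N) - 1"
    and \<beta>: "\<beta> \<le> 1"
  obtains q p where "(q, p) \<in> farey_index N" "farey_list \<alpha> \<beta> N ! (j - 1) = Fract p (int q)"
    "farey_point \<alpha> \<beta> N j = (fst (farey_vec N q p), fst (snd (farey_vec N q p)))"
proof -
  let ?L = "farey_list \<alpha> \<beta> N"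
  define r s where "r = ?L ! (j - 1)" and "s = ?L ! j"
  have mem: "r \<in> set ?L" "s \<in> set ?L" and lt: "r < s"
    using j farey_list_sorted[of \<alpha> \<beta> N] by (auto simp: r_def s_def sorted_wrt_iff_nth_less)
  have r: "r \<in> farey N" "\<alpha> \<le> of_rat r" and s: "s \<in> farey N" "of_rat s \<le> \<beta>"
    using mem by (auto simp: set_farey_list)
  have "real_of_rat s \<le> 1" using s \<beta> by linarith
  then have "s \<le> 1" by (metis of_rat_1 of_rat_less_eq)
  then have "r < 1" using lt by simp
  then obtain q p where qp: "(q, p) \<in> farey_index N" "r = Fract p (int q)"
    using farey_eq_Fract_index[OF r(1)] by metis
  obtain r' where r': "r' \<in> farey N" "denom r' = farey_next N q p" "r < r'"
      "\<And>s. s \<in> farey N \<Longrightarrow> r < s \<Longrightarrow> r' \<le> s"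
    using farey_successor[OF qp(1)] unfolding qp(2)[symmetric] by metis
  have "r' \<le> s" using r'(4) s lt by blast
  have "real_of_rat r < of_rat r'" "real_of_rat r' \<le> of_rat s"
    using r'(3) \<open>r' \<le> s\<close> by (simp_all add: of_rat_less of_rat_less_eq)
  then have "r' \<in> set ?L"
    using r'(1) r s by (simp add: set_farey_list)
  then obtain k where k: "k < length ?L" "r' = ?L ! k" by (auto simp: in_set_conv_nth)
  have "\<not> k < j"
  proof
    assume "k < j"
    then have "?L ! k \<le> ?L ! (j - 1)"
      using j farey_list_sorted[of \<alpha> \<beta> N]
      by (cases "k = j - 1") (auto simp: sorted_wrt_iff_nth_less less_imp_le)
    then show False using r'(3) k by (simp add: r_def)
  qed
  then have "s \<le> r'"
    using k farey_list_sorted[of \<alpha> \<beta> N] unfolding s_def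
    by (cases "k = j") (auto simp: sorted_wrt_iff_nth_less less_imp_le)
  then have "s = r'" using \<open>r' \<le> s\<close> by simp
  then have "farey_point \<alpha> \<beta> N j = (fst (farey_vec N q p), fst (snd (farey_vec N q p)))"
    using r'(2) farey_index_Fract(3)[OF qp(1)] qp(2)
    unfolding farey_point_def r_def[symmetric] s_def[symmetric] by (simp add: farey_vec_def denom_def)
  then show ?thesis using that qp by (simp add: r_def)
qed

text \<open>Index j is sent to the (j - 1)-th fraction in zero-based numbering. The one fraction
  that can be missed is the last of the list: it has no next entry to form a point with, yet its
  successor beyond the interval may satisfy P.\<close>

lemma card_farey_points_bounds:
  fixes P :: "real \<times> real \<Rightarrow> bool" and \<alpha> \<beta> :: real and N :: nat
  assumes \<beta>: "\<beta> \<le> 1"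
  defines "J \<equiv> {j. 1 \<le> j \<and> j \<le> length (farey_list \<alpha> \<beta> N) - 1 \<and> P (farey_point \<alpha> \<beta> N j)}"
  shows "card J \<le> farey_count N (fraction_cylinder {w. P w} {\<alpha>..\<beta>})"
    "farey_count N (fraction_cylinder {w. P w} {\<alpha>..\<beta>}) \<le> card J + 1"
proof -
  let ?L = "farey_list \<alpha> \<beta> N"
  let ?C = "{(q, p) \<in> farey_index N. farey_vec N q p \<in> fraction_cylinder {w. P w} {\<alpha>..\<beta>}}"
  define g where "g r = (nat (snd (quotient_of r)), fst (quotient_of r))" for r
  have g: "g (Fract p (int q)) = (q, p)" if "(q, p) \<in> farey_index N" for q p
    using farey_index_Fract(3)[OF that] by (simp add: g_def)
  have fin: "finite ?C" by (rule finite_subset[OF _ finite_farey_index[of N]]) auto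
  have finJ: "finite J" by (rule finite_subset[of _ "{..length ?L}"]) (auto simp: J_def)
  have distinct: "distinct ?L" unfolding farey_list_def by simp
  have J: "\<exists>q p. (q, p) \<in> farey_index N \<and> ?L ! (j - 1) = Fract p (int q) \<and> (q, p) \<in> ?C" if "j \<in> J" for j
  proof -
    have j: "1 \<le> j" "j \<le> length ?L - 1" "P (farey_point \<alpha> \<beta> N j)" using that by (auto simp: J_def)
    obtain q p where qp: "(q, p) \<in> farey_index N" "?L ! (j - 1) = Fract p (int q)"
      "farey_point \<alpha> \<beta> N j = (fst (farey_vec N q p), fst (snd (farey_vec N q p)))"
      using farey_point_eq_farey_vec[OF j(1,2) \<beta>] by metis
    have "j - 1 < length ?L" using j by linarith
    then have "Fract p (int q) \<in> set ?L" unfolding qp(2)[symmetric] by (rule nth_mem)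
    then have "of_int p / real q \<in> {\<alpha>..\<beta>}"
      using farey_index_Fract(4)[OF qp(1)] by (simp add: set_farey_list)
    then have "(q, p) \<in> ?C" using qp j(3) by (simp add: fraction_cylinder_def farey_vec_def)
    then show ?thesis using qp by blast
  qed
  show "card J \<le> farey_count N (fraction_cylinder {w. P w} {\<alpha>..\<beta>})"
    unfolding farey_count_def
  proof (rule card_inj_on_le[OF _ _ fin])
    show "(\<lambda>j. g (?L ! (j - 1))) ` J \<subseteq> ?C"
    proof (rule image_subsetI)
      fix j assume "j \<in> J"
      then obtain q p where "(q, p) \<in> farey_index N" "?L ! (j - 1) = Fract p (int q)" "(q, p) \<in> ?C"
        using J by blast
      then show "g (?L ! (j - 1)) \<in> ?C" by (simp only: g)
    qed
    show "inj_on (\<lambda>j. g (?L ! (j - 1))) J"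
    proof (rule inj_onI)
      fix i j assume i: "i \<in> J" and j: "j \<in> J" and eq: "g (?L ! (i - 1)) = g (?L ! (j - 1))"
      obtain q p where 1: "(q, p) \<in> farey_index N" "?L ! (i - 1) = Fract p (int q)" using J[OF i] by blast
      obtain q' p' where 2: "(q', p') \<in> farey_index N" "?L ! (j - 1) = Fract p' (int q')" using J[OF j] by blast
      have "(q, p) = (q', p')" using eq 1 2 by (simp only: g)
      then have "?L ! (i - 1) = ?L ! (j - 1)" using 1 2 by simp
      then have "i - 1 = j - 1" using i j distinct by (subst (asm) nth_eq_iff_index_eq) (auto simp: J_def)
      then show "i = j" using i j by (auto simp: J_def)
    qed
  qed
  have "?C \<subseteq> insert (g (last ?L)) ((\<lambda>j. g (?L ! (j - 1))) ` J)"
  proof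
    fix x assume x: "x \<in> ?C"
    obtain q p where x_eq: "x = (q, p)" by fastforce
    have qp: "(q, p) \<in> farey_index N" and v: "farey_vec N q p \<in> fraction_cylinder {w. P w} {\<alpha>..\<beta>}"
      using x by (auto simp: x_eq)
    have "of_int p / real q \<in> {\<alpha>..\<beta>}" using v by (simp add: fraction_cylinder_def farey_vec_def)
    then have "Fract p (int q) \<in> set ?L"
      using farey_index_Fract[OF qp] by (simp add: set_farey_list)
    then obtain i where i: "i < length ?L" "?L ! i = Fract p (int q)" by (auto simp: in_set_conv_nth)
    show "x \<in> insert (g (last ?L)) ((\<lambda>j. g (?L ! (j - 1))) ` J)"
    proof (cases "Suc i < length ?L")
      case False
      then have "i = length ?L - 1" "?L \<noteq> []" using i by auto
      then have "last ?L = Fract p (int q)" using i by (simp add: last_conv_nth)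
      then show ?thesis by (simp only: g[OF qp] x_eq insert_iff simp_thms)
    next
      case True
      then have j: "1 \<le> Suc i" "Suc i \<le> length ?L - 1" by auto
      obtain q' p' where qp': "(q', p') \<in> farey_index N" "?L ! (Suc i - 1) = Fract p' (int q')"
        "farey_point \<alpha> \<beta> N (Suc i) = (fst (farey_vec N q' p'), fst (snd (farey_vec N q' p')))"
        using farey_point_eq_farey_vec[OF j \<beta>] by metis
      have "Fract p' (int q') = Fract p (int q)" using qp'(2) i(2) unfolding diff_Suc_1 by metis
      then have "g (Fract p' (int q')) = g (Fract p (int q))" by (rule arg_cong)
      then have "(q', p') = (q, p)" unfolding g[OF qp] g[OF qp'(1)] .
      then have "P (farey_point \<alpha> \<beta> N (Suc i))"
        using qp'(3) v by (auto simp: fraction_cylinder_def case_prod_unfold)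
      then have "Suc i \<in> J" using j by (simp add: J_def)
      moreover have "x = g (?L ! (Suc i - 1))" using i g[OF qp] by (simp add: x_eq)
      ultimately show ?thesis by blast
    qed
  qed
  then have "card ?C \<le> card (insert (g (last ?L)) ((\<lambda>j. g (?L ! (j - 1))) ` J))"
    using finJ by (intro card_mono) auto
  also have "\<dots> \<le> Suc (card ((\<lambda>j. g (?L ! (j - 1))) ` J))"
    using finJ by (simp add: card_insert_if)
  also have "\<dots> \<le> card J + 1" using card_image_le[OF finJ] by simp
  finally show "farey_count N (fraction_cylinder {w. P w} {\<alpha>..\<beta>}) \<le> card J + 1"
    unfolding farey_count_def .
qed

lemma tendsto_of_bounded_difference:
  fixes u v :: "nat \<Rightarrow> real"
  assumes "(\<lambda>N. u N / real N ^ 2) \<longlonglongrightarrow> l" "\<And>N. \<bar>v N - u N\<bar> \<le> 1"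
  shows "(\<lambda>N. v N / real N ^ 2) \<longlonglongrightarrow> l"
proof -
  have "(\<lambda>N. (v N - u N) / real N ^ 2) \<longlonglongrightarrow> 0"
  proof (rule Lim_null_comparison)
    show "(\<lambda>N. 1 / real N ^ 2) \<longlonglongrightarrow> 0" by real_asymp
    show "eventually (\<lambda>N. norm ((v N - u N) / real N ^ 2) \<le> 1 / real N ^ 2) sequentially"
      using assms(2) by (intro always_eventually allI) (simp add: divide_right_mono)
  qed
  from tendsto_add[OF assms(1) this] show ?thesis by (simp flip: add_divide_distrib)
qed

context farey_observable
begin

text \<open>Numerator and denominator are each within 1 of a count whose quotient by N^2 converges.
  In the ratio \<open>moebius_sum\<close> and the interval length \<beta> - \<alpha> cancel, which
  is why the limit does not depend on the interval; the area 1/2 of the triangle leaves the factor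
  2.\<close>

lemma farey_proportion_tendsto:
  "(\<lambda>N. farey_proportion \<alpha> \<beta> F N t) \<longlonglongrightarrow> 2 * upper_area"
proof -
  let ?len = "\<lambda>N. length (farey_list \<alpha> \<beta> N)"
  define c where "c N = card {j. 1 \<le> j \<and> j \<le> ?len N - 1 \<and> F (farey_point \<alpha> \<beta> N j) \<ge> t}" for N
  have c: "\<bar>real (c N) - real (upper_count N)\<bar> \<le> 1" for N
    using card_farey_points_bounds[OF interval(3), where \<alpha> = \<alpha> and N = N and P = "\<lambda>w. t \<le> F w"]
    unfolding c_def upper_count_def by linarith
  have total: "farey_count N (fraction_cylinder UNIV {\<alpha>..\<beta>}) = upper_count N + lower_count N" for N
  proof -
    let ?C = "\<lambda>K. {(q, p) \<in> farey_index N. farey_vec N q p \<in> K}"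
    have fin: "finite (?C K)" for K by (rule finite_subset[OF _ finite_farey_index[of N]]) auto
    have "?C (fraction_cylinder UNIV {\<alpha>..\<beta>}) =
        ?C (fraction_cylinder {w. t \<le> F w} {\<alpha>..\<beta>}) \<union> ?C (fraction_cylinder {w. F w < t} {\<alpha>..\<beta>})"
      by (auto simp: fraction_cylinder_def)
    moreover have "?C (fraction_cylinder {w. t \<le> F w} {\<alpha>..\<beta>}) \<inter> ?C (fraction_cylinder {w. F w < t} {\<alpha>..\<beta>}) = {}"
      by (auto simp: fraction_cylinder_def)
    ultimately show ?thesis
      unfolding farey_count_def upper_count_def lower_count_def using fin by (simp only: card_Un_disjoint)
  qed
  have len: "\<bar>real (?len N) - (real (upper_count N) + real (lower_count N))\<bar> \<le> 1" for N
  proof -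
    \<comment> \<open>With P constantly true the same bounds compare the length of the list with the
      number of indexed fractions in the interval.\<close>
    have "{j. 1 \<le> j \<and> j \<le> ?len N - 1 \<and> True} = {1..?len N - 1}" by auto
    then have "card {j. 1 \<le> j \<and> j \<le> ?len N - 1 \<and> True} = ?len N - 1" by simp
    then show ?thesis
      using card_farey_points_bounds[OF interval(3), where \<alpha> = \<alpha> and N = N and P = "\<lambda>w. True"] total[of N]
      by (simp add: UNIV_def[symmetric])
  qed
  have 1: "(\<lambda>N. real (c N) / real N ^ 2) \<longlonglongrightarrow> moebius_sum * (upper_area * (\<beta> - \<alpha>))"
    by (rule tendsto_of_bounded_difference[OF counts_tendsto(1) c])
  have eq: "moebius_sum * (upper_area * (\<beta> - \<alpha>)) + moebius_sum * (lower_area * (\<beta> - \<alpha>)) =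
      moebius_sum * ((\<beta> - \<alpha>) / 2)"
  proof -
    have "moebius_sum * (upper_area * (\<beta> - \<alpha>)) + moebius_sum * (lower_area * (\<beta> - \<alpha>)) =
      moebius_sum * ((upper_area + lower_area) * (\<beta> - \<alpha>))" by (simp only: ring_distribs)
    then show ?thesis unfolding areas_sum by simp
  qed
  have "(\<lambda>N. (real (upper_count N) + real (lower_count N)) / real N ^ 2) \<longlonglongrightarrow> moebius_sum * ((\<beta> - \<alpha>) / 2)"
    using tendsto_add[OF counts_tendsto] unfolding eq by (simp add: add_divide_distrib)
  then have 2: "(\<lambda>N. real (?len N) / real N ^ 2) \<longlonglongrightarrow> moebius_sum * ((\<beta> - \<alpha>) / 2)"
    by (rule tendsto_of_bounded_difference[OF _ len])
  have pos: "moebius_sum > 0" "\<beta> - \<alpha> > 0" using moebius_sum_pos interval by auto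
  then have "(\<lambda>N. (real (c N) / real N ^ 2) / (real (?len N) / real N ^ 2)) \<longlonglongrightarrow>
      moebius_sum * (upper_area * (\<beta> - \<alpha>)) / (moebius_sum * ((\<beta> - \<alpha>) / 2))"
    by (intro tendsto_divide 1 2) auto
  also have "moebius_sum * (upper_area * (\<beta> - \<alpha>)) / (moebius_sum * ((\<beta> - \<alpha>) / 2)) = 2 * upper_area"
  proof -
    have "s * (u * d) / (s * (d / 2)) = 2 * u" if "s > 0" "d > 0" for s u d :: real
      using that by simp
    then show ?thesis using pos by metis
  qed
  finally show ?thesis
  proof (rule Lim_transform_eventually)
    show "eventually (\<lambda>N. (real (c N) / real N ^ 2) / (real (?len N) / real N ^ 2) = farey_proportion \<alpha> \<beta> F N t) sequentially"
      using eventually_gt_at_top[of 0]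
    proof eventually_elim
      case (elim N)
      then show ?case by (simp add: farey_proportion_def c_def)
    qed
  qed
qed

end

section \<open>From the order N to the parameter \<delta>\<close>

lemma filterlim_order_of_delta: "filterlim order_of_delta sequentially (at_right 0)"
proof -
  have "filterlim (\<lambda>\<delta>. (2 * \<delta>) powr (- 1 / 2)) at_top (at_right (0 :: real))" by real_asymp
  then have "filterlim (\<lambda>\<delta>. nat \<lfloor>(2 * \<delta>) powr (- 1 / 2)\<rfloor>) sequentially (at_right (0 :: real))"
    by (intro filterlim_compose[OF filterlim_nat_sequentially] filterlim_compose[OF filterlim_floor_sequentially])
  then show ?thesis by (simp add: order_of_delta_def[abs_def])
qed

text \<open>The factor 2 normalizes the area 1/2 of the triangle to total mass 1.\<close>

definition tail_area :: "(real \<times> real \<Rightarrow> real) \<Rightarrow> real \<Rightarrow> real" where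
  "tail_area F t = 2 * measure lborel {w \<in> farey_triangle. t \<le> F w}"

text \<open>By Tonelli the area is the integral of the lengths of vertical slices, and finite slices
  have length 0.\<close>

lemma level_set_null:
  fixes F :: "real \<times> real \<Rightarrow> real"
  assumes F: "continuous_on {w. 0 < fst w \<and> 0 < snd w} F"
    and fin: "\<And>x. 0 < x \<Longrightarrow> finite {y. 0 < y \<and> F (x, y) = t}"
  shows "measure lborel {w \<in> farey_triangle. F w = t} = 0"
proof -
  let ?M = "{w \<in> farey_triangle. F w = t}"
  have "?M \<in> sets borel" using sublevel_borel[OF F, of "{t}"] by simp
  then have "?M \<in> sets (lborel \<Otimes>\<^sub>M lborel)" by (simp only: lborel_prod sets_lborel)
  then have "emeasure (lborel \<Otimes>\<^sub>M lborel) ?M = (\<integral>\<^sup>+x. emeasure lborel (Pair x -` ?M) \<partial>lborel)"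
    by (rule lborel.emeasure_pair_measure_alt)
  also have "\<dots> = (\<integral>\<^sup>+x. 0 \<partial>(lborel :: real measure))"
  proof (rule nn_integral_cong)
    fix x :: real
    have "finite (Pair x -` ?M)"
    proof (cases "0 < x")
      case True
      show ?thesis by (rule finite_subset[OF _ fin[OF True]]) (auto simp: farey_triangle_def)
    next
      case False
      then have "Pair x -` ?M = {}" by (auto simp: farey_triangle_def)
      then show ?thesis by (simp only: finite.emptyI)
    qed
    then show "emeasure lborel (Pair x -` ?M) = 0" by (rule emeasure_lborel_countable[OF countable_finite])
  qed
  finally show ?thesis by (simp add: lborel_prod measure_def)
qed

lemma is_limiting_distribution_tail_area:
  assumes F: "continuous_on {w. 0 < fst w \<and> 0 < snd w} F"
    and fin: "\<And>t x. 0 < x \<Longrightarrow> finite {y. 0 < y \<and> F (x, y) = t}"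
    and "0 \<le> \<alpha>" "\<alpha> < \<beta>" "\<beta> \<le> 1"
  shows "is_limiting_distribution \<alpha> \<beta> F (tail_area F)"
  unfolding is_limiting_distribution_def
proof
  fix t
  interpret farey_observable F t \<alpha> \<beta>
    using assms level_set_null[OF F fin] by unfold_locales auto
  show "((\<lambda>\<delta>. farey_proportion \<alpha> \<beta> F (order_of_delta \<delta>) t) \<longlongrightarrow> tail_area F t) (at_right 0)"
    using filterlim_compose[OF farey_proportion_tendsto filterlim_order_of_delta]
    by (simp add: tail_area_def upper_area_def)
qed

section \<open>Tail areas\<close>

lemma farey_strip_borel:
  "{w \<in> farey_triangle. fst w \<le> a} \<in> sets borel" "{w \<in> farey_triangle. snd w \<le> a} \<in> sets borel"
proof -
  have "{w \<in> farey_triangle. fst w \<le> a} = farey_triangle \<inter> {w. fst w \<le> a}"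
    "{w \<in> farey_triangle. snd w \<le> a} = farey_triangle \<inter> {w. snd w \<le> a}" by auto
  moreover have "closed {w :: real \<times> real. fst w \<le> a}" "closed {w :: real \<times> real. snd w \<le> a}"
    by (intro closed_Collect_le continuous_intros)+
  ultimately show "{w \<in> farey_triangle. fst w \<le> a} \<in> sets borel" "{w \<in> farey_triangle. snd w \<le> a} \<in> sets borel"
    by auto
qed

text \<open>The slice at distance x \<le> a from the vertex is the interval (1 - x, 1) of length x,
  and the integral of x over [0, a] is a^2/2.\<close>

lemma measure_farey_strip:
  assumes a: "0 < a" "a < 1"
  shows "measure lborel {w \<in> farey_triangle. fst w \<le> a} = a ^ 2 / 2"
    "measure lborel {w \<in> farey_triangle. snd w \<le> a} = a ^ 2 / 2"
proof -
  let ?X = "{w \<in> farey_triangle. fst w \<le> a}" and ?Y = "{w \<in> farey_triangle. snd w \<le> a}"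
  have meas: "?X \<in> sets (lborel \<Otimes>\<^sub>M lborel)" "?Y \<in> sets (lborel \<Otimes>\<^sub>M lborel)"
    using farey_strip_borel[of a] by (simp_all only: lborel_prod sets_lborel)
  have slice: "emeasure lborel (if 0 < x \<and> x \<le> a then {1 - x<..<1} else {}) = ennreal x * indicator {0..a} x" for x :: real
    by (auto simp: indicator_def)
  have integral: "(\<integral>\<^sup>+x. ennreal x * indicator {0..a} x \<partial>lborel) = ennreal (a ^ 2 / 2)"
  proof -
    have "(\<integral>\<^sup>+x. ennreal x * indicator {0..a} x \<partial>lborel) = ennreal (a ^ 2 / 2 - 0 ^ 2 / 2)"
      by (rule nn_integral_FTC_Icc) (use a in \<open>auto intro!: derivative_eq_intros\<close>)
    then show ?thesis by simp
  qed
  have "Pair x -` ?X = (if 0 < x \<and> x \<le> a then {1 - x<..<1} else {})" for x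
    using a by (auto simp: farey_triangle_def)
  then have "emeasure (lborel \<Otimes>\<^sub>M lborel) ?X = ennreal (a ^ 2 / 2)"
    unfolding lborel.emeasure_pair_measure_alt[OF meas(1)] by (simp only: slice integral)
  then show "measure lborel ?X = a ^ 2 / 2" by (simp add: measure_def lborel_prod)
  have "(\<lambda>x. (x, y)) -` ?Y = (if 0 < y \<and> y \<le> a then {1 - y<..<1} else {})" for y
    using a by (auto simp: farey_triangle_def)
  then have "emeasure (lborel \<Otimes>\<^sub>M lborel) ?Y = ennreal (a ^ 2 / 2)"
    unfolding lborel_pair.emeasure_pair_measure_alt2[OF meas(2)] by (simp only: slice integral)
  then show "measure lborel ?Y = a ^ 2 / 2" by (simp add: measure_def lborel_prod)
qed

lemma farey_subset_fmeasurable: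
  assumes "B \<in> sets borel" "B \<subseteq> farey_triangle"
  shows "B \<in> fmeasurable lborel"
  using farey_triangle_fmeasurable[OF assms(1)] assms(2) by (simp add: Int_absorb1)

text \<open>For a \<le> 1/2 the two strips are disjoint, because x \<le> a and y \<le> a contradict
  x + y > 1.\<close>

lemma measure_farey_strips:
  assumes a: "0 < a" "a \<le> 1 / 2"
  shows "measure lborel {w \<in> farey_triangle. fst w \<le> a \<or> snd w \<le> a} = a ^ 2"
proof -
  let ?X = "{w \<in> farey_triangle. fst w \<le> a}" and ?Y = "{w \<in> farey_triangle. snd w \<le> a}"
  have "measure lborel (?X \<union> ?Y) = measure lborel ?X + measure lborel ?Y - measure lborel (?X \<inter> ?Y)"
    by (rule measure_Un3) (use farey_strip_borel in \<open>auto intro!: farey_subset_fmeasurable\<close>)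
  also have "?X \<inter> ?Y = {}" using a by (auto simp: farey_triangle_def)
  also have "measure lborel ?X + measure lborel ?Y - measure lborel {} = a ^ 2"
    using a by (simp add: measure_farey_strip)
  also have "?X \<union> ?Y = {w \<in> farey_triangle. fst w \<le> a \<or> snd w \<le> a}" by auto
  finally show ?thesis .
qed

context
  fixes F :: "real \<times> real \<Rightarrow> real"
  assumes F: "continuous_on {w. 0 < fst w \<and> 0 < snd w} F"
begin

lemma superlevel_fmeasurable: "{w \<in> farey_triangle. t \<le> F w} \<in> fmeasurable lborel"
  using sublevel_borel[OF F, of "{t..}"] by (intro farey_subset_fmeasurable) auto

lemma tail_area_ge:
  assumes "B \<in> sets borel" "B \<subseteq> farey_triangle" "\<And>x y. (x, y) \<in> B \<Longrightarrow> t \<le> F (x, y)"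
  shows "2 * measure lborel B \<le> tail_area F t"
proof -
  have "measure lborel B \<le> measure lborel {w \<in> farey_triangle. t \<le> F w}"
    using assms by (intro measure_mono_fmeasurable superlevel_fmeasurable) auto
  then show ?thesis by (simp add: tail_area_def)
qed

lemma tail_area_le:
  assumes "B \<in> sets borel" "B \<subseteq> farey_triangle"
    "\<And>x y. (x, y) \<in> farey_triangle \<Longrightarrow> t \<le> F (x, y) \<Longrightarrow> (x, y) \<in> B"
  shows "tail_area F t \<le> 2 * measure lborel B"
proof -
  have "measure lborel {w \<in> farey_triangle. t \<le> F w} \<le> measure lborel B"
    using assms superlevel_fmeasurable
    by (intro measure_mono_fmeasurable farey_subset_fmeasurable) (auto simp: fmeasurable_def)
  then show ?thesis by (simp add: tail_area_def)
qed

lemma strips_borel: "{w \<in> farey_triangle. fst w \<le> a \<or> snd w \<le> a} \<in> sets borel"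
proof -
  have "{w \<in> farey_triangle. fst w \<le> a \<or> snd w \<le> a} =
      {w \<in> farey_triangle. fst w \<le> a} \<union> {w \<in> farey_triangle. snd w \<le> a}" by auto
  then show ?thesis using farey_strip_borel by simp
qed

lemma tail_area_strips_ge:
  assumes "0 < a" "a \<le> 1 / 2"
    "\<And>x y. (x, y) \<in> farey_triangle \<Longrightarrow> x \<le> a \<or> y \<le> a \<Longrightarrow> t \<le> F (x, y)"
  shows "2 * a ^ 2 \<le> tail_area F t"
  using tail_area_ge[OF strips_borel[of a], of t] assms by (auto simp: measure_farey_strips)

lemma tail_area_strips_le:
  assumes "0 < a" "a \<le> 1 / 2"
    "\<And>x y. (x, y) \<in> farey_triangle \<Longrightarrow> t \<le> F (x, y) \<Longrightarrow> x \<le> a \<or> y \<le> a"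
  shows "tail_area F t \<le> 2 * a ^ 2"
  using tail_area_le[OF strips_borel[of a], of t] assms by (auto simp: measure_farey_strips)

lemma tail_area_strip_ge:
  assumes "0 < a" "a < 1"
    "\<And>x y. (x, y) \<in> farey_triangle \<Longrightarrow> y \<le> a \<Longrightarrow> t \<le> F (x, y)"
  shows "a ^ 2 \<le> tail_area F t"
  using tail_area_ge[OF farey_strip_borel(2)[of a], of t] assms by (auto simp: measure_farey_strip)

lemma tail_area_strip_le:
  assumes "0 < a" "a < 1"
    "\<And>x y. (x, y) \<in> farey_triangle \<Longrightarrow> t \<le> F (x, y) \<Longrightarrow> y \<le> a"
  shows "tail_area F t \<le> a ^ 2"
  using tail_area_le[OF farey_strip_borel(2)[of a], of t] assms by (auto simp: measure_farey_strip)

end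

section \<open>The five observables\<close>

lemma farey_triangleD:
  assumes "(x, y) \<in> farey_triangle"
  shows "0 < x" "x < 1" "0 < y" "y < 1" "1 < x + y"
  using assms by (auto simp: farey_triangle_def)

lemma asymp_equiv_sandwich:
  fixes f g :: "real \<Rightarrow> real"
  assumes "eventually (\<lambda>t. l t \<le> f t / g t) at_top" "eventually (\<lambda>t. f t / g t \<le> u t) at_top"
    "(l \<longlongrightarrow> 1) at_top" "(u \<longlongrightarrow> 1) at_top"
  shows "f \<sim>[at_top] g"
  by (rule asymp_equivI') (rule tendsto_sandwich[OF assms])

lemma bigtheta_sandwich:
  fixes f g :: "real \<Rightarrow> real"
  assumes "0 < c" "0 < d" "eventually (\<lambda>t. c * g t \<le> f t \<and> f t \<le> d * g t \<and> 0 \<le> g t) at_top"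
  shows "f \<in> \<Theta>[at_top](g)"
proof (rule bigthetaI)
  show "f \<in> O[at_top](g)"
  proof (rule bigoI[of _ d], rule eventually_mono[OF assms(3)])
    fix t assume t: "c * g t \<le> f t \<and> f t \<le> d * g t \<and> 0 \<le> g t"
    then have "0 \<le> c * g t" using assms(1) by simp
    then show "norm (f t) \<le> d * norm (g t)" using t by simp
  qed
  show "f \<in> \<Omega>[at_top](g)"
    by (rule landau_omega.bigI[of c, OF assms(1)], rule eventually_mono[OF assms(3)])
      (use assms(1,2) in auto)
qed

text \<open>Abbreviations, so that the lemmas about these functions are literally about the lambda
  terms of the theorem.\<close>

abbreviation (input) "euclidean_distance \<equiv> (\<lambda>(x, y). 1 / (2 * x^2) + 1 / (2 * y^2)) :: real \<times> real \<Rightarrow> real"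
abbreviation (input) "hyperbolic_distance \<equiv> (\<lambda>(x, y). 1 / 2 * (y / x + x / y)) :: real \<times> real \<Rightarrow> real"
abbreviation (input) "euclidean_slope \<equiv> (\<lambda>(x, y). 1 / 2 * (x / y - y / x)) :: real \<times> real \<Rightarrow> real"
abbreviation (input) "euclidean_area \<equiv> (\<lambda>(x, y). 1 / 4 * (1 / (x^3 * y) + 1 / (x * y^3))) :: real \<times> real \<Rightarrow> real"
abbreviation (input) "hyperbolic_angle \<equiv> (\<lambda>(x, y). 4 * x^5 / y^3 - 4 * x * y + 16 * x^3 / y) :: real \<times> real \<Rightarrow> real"

lemma continuous_observables:
  "continuous_on {w. 0 < fst w \<and> 0 < snd w} euclidean_distance"
  "continuous_on {w. 0 < fst w \<and> 0 < snd w} hyperbolic_distance"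
  "continuous_on {w. 0 < fst w \<and> 0 < snd w} euclidean_slope"
  "continuous_on {w. 0 < fst w \<and> 0 < snd w} euclidean_area"
  "continuous_on {w. 0 < fst w \<and> 0 < snd w} hyperbolic_angle"
  unfolding case_prod_unfold by (intro continuous_intros; auto)+

lemma finite_if_poly_root:
  fixes p :: "real poly"
  assumes "p \<noteq> 0" "\<And>y. 0 < y \<Longrightarrow> f y = t \<Longrightarrow> poly p y = 0"
  shows "finite {y. 0 < y \<and> f y = t}"
  by (rule finite_subset[OF _ poly_roots_finite[OF assms(1)]]) (use assms(2) in auto)

text \<open>Clearing denominators turns F (x, y) = t into a polynomial equation in y. Its constant
  coefficient, x^2 or 4 x^5, is nonzero for x > 0, so the polynomial is not zero for any t.\<close>

lemma finite_level_slices: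
  fixes x t :: real
  assumes x: "0 < x"
  shows "finite {y. 0 < y \<and> euclidean_distance (x, y) = t}"
    "finite {y. 0 < y \<and> hyperbolic_distance (x, y) = t}"
    "finite {y. 0 < y \<and> euclidean_slope (x, y) = t}"
    "finite {y. 0 < y \<and> euclidean_area (x, y) = t}"
    "finite {y. 0 < y \<and> hyperbolic_angle (x, y) = t}"
proof -
  show "finite {y. 0 < y \<and> euclidean_distance (x, y) = t}"
    by (rule finite_if_poly_root[of "[:x^2, 0, 1 - 2 * t * x^2:]"])
      (use x in \<open>auto simp: field_simps power2_eq_square\<close>)
  show "finite {y. 0 < y \<and> hyperbolic_distance (x, y) = t}"
    by (rule finite_if_poly_root[of "[:x^2, - 2 * t * x, 1:]"])
      (use x in \<open>auto simp: field_simps power2_eq_square\<close>)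
  show "finite {y. 0 < y \<and> euclidean_slope (x, y) = t}"
    by (rule finite_if_poly_root[of "[:x^2, - 2 * t * x, - 1:]"])
      (use x in \<open>auto simp: field_simps power2_eq_square\<close>)
  show "finite {y. 0 < y \<and> euclidean_area (x, y) = t}"
    by (rule finite_if_poly_root[of "[:x^2, 0, 1, - 4 * t * x^3:]"])
      (use x in \<open>auto simp: field_simps power2_eq_square power3_eq_cube\<close>)
  show "finite {y. 0 < y \<and> hyperbolic_angle (x, y) = t}"
    by (rule finite_if_poly_root[of "[:4 * x^5, 0, 16 * x^3, - t, - 4 * x:]"])
      (use x in \<open>auto simp: field_simps power2_eq_square power3_eq_cube\<close>)
qed

text \<open>One of the coordinates is at least 1/2 and its term at most 2, so a value t forces the
  other term to be at least t - 2. The set lies between the strips of widths 1/sqrt(2 t) and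
  1/sqrt(2 (t - 2)); t \<ge> 4 keeps both widths at most 1/2.\<close>

lemma tail_area_euclidean_distance: "tail_area euclidean_distance \<sim>[at_top] (\<lambda>t. 1 / t)"
proof (rule asymp_equiv_sandwich)
  note F = continuous_observables(1)
  have le: "1 / (2 * x^2) \<ge> s" if "0 < x" "x \<le> 1 / sqrt (2 * s)" "0 < s" for x s :: real
  proof -
    have "x ^ 2 \<le> (1 / sqrt (2 * s)) ^ 2" using that by (intro power_mono) auto
    then show ?thesis using that by (simp add: field_simps)
  qed
  have ge: "x \<le> 1 / sqrt (2 * s)" if "0 < x" "s \<le> 1 / (2 * x^2)" "0 < s" for x s :: real
  proof (rule power2_le_imp_le)
    show "x ^ 2 \<le> (1 / sqrt (2 * s)) ^ 2" using that by (simp add: field_simps)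
  qed (use that in auto)
  show "eventually (\<lambda>t. 1 \<le> tail_area euclidean_distance t / (1 / t)) at_top"
    using eventually_ge_at_top[of 4]
  proof eventually_elim
    case (elim t)
    have "2 * (1 / sqrt (2 * t)) ^ 2 \<le> tail_area euclidean_distance t"
    proof (rule tail_area_strips_ge[OF F])
      have "sqrt 4 \<le> sqrt (2 * t)" using elim by (intro real_sqrt_le_mono) auto
      then show "1 / sqrt (2 * t) \<le> 1 / 2" using elim by (simp add: field_simps)
      fix x y assume xy: "(x, y) \<in> farey_triangle" "x \<le> 1 / sqrt (2 * t) \<or> y \<le> 1 / sqrt (2 * t)"
      note pos = farey_triangleD[OF xy(1)]
      have "0 \<le> 1 / (2 * x^2)" "0 \<le> 1 / (2 * y^2)" by auto
      moreover have "t \<le> 1 / (2 * x^2) \<or> t \<le> 1 / (2 * y^2)"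
        using xy(2) le[of x t] le[of y t] pos elim by auto
      ultimately show "t \<le> euclidean_distance (x, y)"
        by (simp only: prod.case) (elim disjE; linarith)
    qed (use elim in auto)
    then show ?case using elim by (simp add: field_simps)
  qed
  show "eventually (\<lambda>t. tail_area euclidean_distance t / (1 / t) \<le> t / (t - 2)) at_top"
    using eventually_ge_at_top[of 4]
  proof eventually_elim
    case (elim t)
    have "tail_area euclidean_distance t \<le> 2 * (1 / sqrt (2 * (t - 2))) ^ 2"
    proof (rule tail_area_strips_le[OF F])
      have "sqrt 4 \<le> sqrt (2 * (t - 2))" using elim by (intro real_sqrt_le_mono) auto
      then show "1 / sqrt (2 * (t - 2)) \<le> 1 / 2" using elim by (simp add: field_simps)
      have small: "1 / (2 * z^2) \<le> 2" if "1 / 2 \<le> z" for z :: real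
      proof -
        have "(1 / 2) ^ 2 \<le> z ^ 2" using that by (intro power_mono) auto
        then show ?thesis using that by (simp add: field_simps power2_eq_square)
      qed
      fix x y assume xy: "(x, y) \<in> farey_triangle" "t \<le> euclidean_distance (x, y)"
      note pos = farey_triangleD[OF xy(1)]
      have le: "t \<le> 1 / (2 * x^2) + 1 / (2 * y^2)" using xy(2) by simp
      have "t - 2 \<le> 1 / (2 * x^2) \<or> t - 2 \<le> 1 / (2 * y^2)"
      proof (cases "1 / 2 \<le> x")
        case True
        then show ?thesis using le small[of x] by linarith
      next
        case False
        then have "1 / 2 \<le> y" using pos by linarith
        then show ?thesis using le small[of y] by linarith
      qed
      then show "x \<le> 1 / sqrt (2 * (t - 2)) \<or> y \<le> 1 / sqrt (2 * (t - 2))"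
        using ge[of x "t - 2"] ge[of y "t - 2"] pos elim by auto
    qed (use elim in auto)
    also have "\<dots> = 1 / (t - 2)" using elim by (simp add: power_divide field_simps)
    finally have "tail_area euclidean_distance t * t \<le> 1 / (t - 2) * t"
      using elim by (intro mult_right_mono) auto
    then show ?case by simp
  qed
  show "((\<lambda>t :: real. t / (t - 2)) \<longlongrightarrow> 1) at_top" by real_asymp
qed simp

text \<open>Let u be one coordinate and v the other. If u \<le> 1/(2 t + 1), then v > 1 - u gives
  v/u \<ge> 2 t. Conversely, for u \<le> v the ratio u/v is at most 1, so v/u \<ge> 2 t - 1, and v <
  1 gives u \<le> 1/(2 t - 1). Both strip pairs have area asymptotic to 1/(4 t^2).\<close>

lemma tail_area_hyperbolic_distance: "tail_area hyperbolic_distance \<sim>[at_top] (\<lambda>t. 1 / (2 * t^2))"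
proof (rule asymp_equiv_sandwich)
  note F = continuous_observables(2)
  show "eventually (\<lambda>t. 4 * t^2 / (2 * t + 1)^2 \<le> tail_area hyperbolic_distance t / (1 / (2 * t^2))) at_top"
    using eventually_ge_at_top[of 4]
  proof eventually_elim
    case (elim t)
    have *: "2 * t \<le> v / u" if "0 < u" "1 < u + v" "u \<le> 1 / (2 * t + 1)" for u v :: real
    proof -
      have "u * (2 * t + 1) \<le> 1" using that elim by (simp add: field_simps)
      then have "2 * t * u \<le> v" using that by (simp add: algebra_simps)
      then show ?thesis using that by (simp add: field_simps)
    qed
    have "2 * (1 / (2 * t + 1)) ^ 2 \<le> tail_area hyperbolic_distance t"
    proof (rule tail_area_strips_ge[OF F])
      fix x y assume xy: "(x, y) \<in> farey_triangle" "x \<le> 1 / (2 * t + 1) \<or> y \<le> 1 / (2 * t + 1)"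
      note pos = farey_triangleD[OF xy(1)]
      have "2 * t \<le> y / x \<or> 2 * t \<le> x / y" using xy(2) *[of x y] *[of y x] pos by auto
      moreover have "0 \<le> y / x" "0 \<le> x / y" using pos by auto
      ultimately have "2 * t \<le> y / x + x / y" by (elim disjE) (rule add_increasing2 add_increasing; assumption)+
      then show "t \<le> hyperbolic_distance (x, y)" by simp
    qed (use elim in auto)
    then have "2 * (1 / (2 * t + 1)) ^ 2 * (2 * t^2) \<le> tail_area hyperbolic_distance t * (2 * t^2)"
      by (intro mult_right_mono) auto
    then show ?case by (simp add: power_divide)
  qed
  show "eventually (\<lambda>t. tail_area hyperbolic_distance t / (1 / (2 * t^2)) \<le> 4 * t^2 / (2 * t - 1)^2) at_top"
    using eventually_ge_at_top[of 4]
  proof eventually_elim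
    case (elim t)
    have *: "u \<le> 1 / (2 * t - 1)" if "0 < u" "u \<le> v" "v < 1" "2 * t \<le> u / v + v / u" for u v :: real
    proof -
      have "u / v \<le> 1" using that by simp
      then have "2 * t - 1 \<le> v / u" using that by linarith
      then have "(2 * t - 1) * u \<le> v" using that by (simp add: field_simps)
      then have "(2 * t - 1) * u \<le> 1" using that by linarith
      then show ?thesis using elim by (simp add: field_simps)
    qed
    have "tail_area hyperbolic_distance t \<le> 2 * (1 / (2 * t - 1)) ^ 2"
    proof (rule tail_area_strips_le[OF F])
      fix x y assume xy: "(x, y) \<in> farey_triangle" "t \<le> hyperbolic_distance (x, y)"
      note pos = farey_triangleD[OF xy(1)]
      have "2 * t \<le> x / y + y / x" using xy(2) by (simp add: add.commute)
      then show "x \<le> 1 / (2 * t - 1) \<or> y \<le> 1 / (2 * t - 1)"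
        using *[of x y] *[of y x] pos by (cases "x \<le> y") (auto simp: add.commute)
    qed (use elim in auto)
    then have "tail_area hyperbolic_distance t * (2 * t^2) \<le> 2 * (1 / (2 * t - 1)) ^ 2 * (2 * t^2)"
      by (intro mult_right_mono) auto
    then show ?case by (simp add: power_divide)
  qed
  show "((\<lambda>t :: real. 4 * t^2 / (2 * t + 1)^2) \<longlongrightarrow> 1) at_top" by real_asymp
  show "((\<lambda>t :: real. 4 * t^2 / (2 * t - 1)^2) \<longlongrightarrow> 1) at_top" by real_asymp
qed

text \<open>Large values require y small compared with x, so a single leg contributes. The strip of
  width 1/(4 t) lies inside the set and that of width 1/(2 t) contains it; the squares of the widths
  give the constants 1/16 and 1/4.\<close>

lemma tail_area_euclidean_slope: "tail_area euclidean_slope \<in> \<Theta>[at_top](\<lambda>t. 1 / t^2)"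
proof (rule bigtheta_sandwich[of "1 / 16" "1 / 4"])
  note F = continuous_observables(3)
  show "eventually (\<lambda>t. 1 / 16 * (1 / t^2) \<le> tail_area euclidean_slope t \<and>
      tail_area euclidean_slope t \<le> 1 / 4 * (1 / t^2) \<and> 0 \<le> 1 / t^2) at_top"
    using eventually_ge_at_top[of 4]
  proof eventually_elim
    case (elim t)
    have "(1 / (4 * t)) ^ 2 \<le> tail_area euclidean_slope t"
    proof (rule tail_area_strip_ge[OF F])
      fix x y assume xy: "(x, y) \<in> farey_triangle" "y \<le> 1 / (4 * t)"
      note pos = farey_triangleD[OF xy(1)]
      have y: "4 * (t * y) \<le> 1" using xy(2) elim by (simp add: field_simps)
      have "1 * y \<le> t * y" using elim pos by (intro mult_right_mono) auto
      then have "2 * (t * y) + y \<le> x" using y pos by linarith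
      then have "(2 * t + 1) * y \<le> x" by (simp add: algebra_simps)
      then have 1: "2 * t + 1 \<le> x / y" using pos by (simp add: field_simps)
      have "y \<le> x" using y \<open>1 * y \<le> t * y\<close> pos by linarith
      then have "y / x \<le> 1" using pos by simp
      with 1 have "2 * t \<le> x / y - y / x" by linarith
      then show "t \<le> euclidean_slope (x, y)" by simp
    qed (use elim in auto)
    moreover have "tail_area euclidean_slope t \<le> (1 / (2 * t)) ^ 2"
    proof (rule tail_area_strip_le[OF F])
      fix x y assume xy: "(x, y) \<in> farey_triangle" "t \<le> euclidean_slope (x, y)"
      note pos = farey_triangleD[OF xy(1)]
      have "0 \<le> y / x" using pos by simp
      moreover have "2 * t \<le> x / y - y / x" using xy(2) by simp
      ultimately have "2 * t \<le> x / y" by linarith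
      then have "2 * t * y \<le> x" using pos by (simp add: field_simps)
      then have "2 * t * y \<le> 1" using pos by linarith
      then show "y \<le> 1 / (2 * t)" using elim by (simp add: field_simps)
    qed (use elim in auto)
    ultimately show ?case by (simp add: power_divide)
  qed
qed auto

lemma cube_root_powr:
  fixes c t :: real
  assumes "0 < c" "0 < t"
  shows "0 < (c / t) powr (1 / 3)" "((c / t) powr (1 / 3)) ^ 3 = c / t"
    "((c / t) powr (1 / 3)) ^ 2 = c powr (2 / 3) * (1 / t powr (2 / 3))"
proof -
  have pow: "((c / t) powr (1 / 3)) ^ n = (c / t) powr (1 / 3 * real n)" for n
    using assms by (subst powr_power) auto
  show "0 < (c / t) powr (1 / 3)" "((c / t) powr (1 / 3)) ^ 3 = c / t"
    "((c / t) powr (1 / 3)) ^ 2 = c powr (2 / 3) * (1 / t powr (2 / 3))"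
    using assms unfolding pow by (simp_all add: powr_divide)
qed

text \<open>For the lower bound the term 1/(x y^3) alone reaches 4 t when y^3 \<le> 1/(4 t), hence
  the width a. For the upper bound let u be the smaller coordinate and v \<ge> 1/2 the other: 1/(u^3
  v) is the larger term, so 4 t \<le> 2/(u^3 v) \<le> 4/u^3, hence the width b with b^3 =
  1/t.\<close>

lemma tail_area_euclidean_area: "tail_area euclidean_area \<in> \<Theta>[at_top](\<lambda>t. 1 / t powr (2 / 3))"
proof (rule bigtheta_sandwich[of "(1 / 4) powr (2 / 3)" 2])
  note F = continuous_observables(4)
  show "eventually (\<lambda>t. (1 / 4) powr (2 / 3) * (1 / t powr (2 / 3)) \<le> tail_area euclidean_area t \<and>
      tail_area euclidean_area t \<le> 2 * (1 / t powr (2 / 3)) \<and> 0 \<le> 1 / t powr (2 / 3)) at_top"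
    using eventually_ge_at_top[of 8]
  proof eventually_elim
    case (elim t)
    define a where "a = (1 / 4 / t) powr (1 / 3)"
    define b where "b = (1 / t) powr (1 / 3)"
    have a: "0 < a" "a ^ 3 = 1 / 4 / t" "a ^ 2 = (1 / 4) powr (2 / 3) * (1 / t powr (2 / 3))"
      unfolding a_def using elim by (intro cube_root_powr; simp)+
    have b: "0 < b" "b ^ 3 = 1 / t" "b ^ 2 = 1 powr (2 / 3) * (1 / t powr (2 / 3))"
      unfolding b_def using elim by (intro cube_root_powr; simp)+
    have a1: "a < 1" by (rule power_less_imp_less_base[of _ 3]) (use a elim in auto)
    have b1: "b \<le> 1 / 2"
    proof (rule power_le_imp_le_base)
      have "b ^ 3 \<le> (1 / 2) ^ 3"
        unfolding b(2) using elim by (simp add: power3_eq_cube field_simps)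
      then show "b ^ Suc 2 \<le> (1 / 2) ^ Suc 2" by (simp add: eval_nat_numeral)
    qed simp
    have "a ^ 2 \<le> tail_area euclidean_area t"
    proof (rule tail_area_strip_ge[OF F a(1) a1])
      fix x y assume xy: "(x, y) \<in> farey_triangle" "y \<le> a"
      note pos = farey_triangleD[OF xy(1)]
      have "y ^ 3 \<le> 1 / 4 / t" using xy(2) pos power_mono[of y a 3] a(2) by simp
      moreover have "x * y ^ 3 \<le> 1 * y ^ 3" using pos by (intro mult_right_mono) auto
      ultimately have "x * y ^ 3 \<le> 1 / 4 / t" by linarith
      then have "4 * t \<le> 1 / (x * y ^ 3)" using pos elim by (simp add: field_simps)
      moreover have "0 \<le> 1 / (x ^ 3 * y)" using pos by simp
      ultimately have "4 * t \<le> 1 / (x ^ 3 * y) + 1 / (x * y ^ 3)" by linarith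
      then show "t \<le> euclidean_area (x, y)" by simp
    qed
    moreover have "tail_area euclidean_area t \<le> 2 * b ^ 2"
    proof (rule tail_area_strips_le[OF F b(1) b1])
      fix x y assume xy: "(x, y) \<in> farey_triangle" "t \<le> euclidean_area (x, y)"
      note pos = farey_triangleD[OF xy(1)]
      have *: "u \<le> b" if u: "0 < u" "u \<le> v" "1 / 2 \<le> v" and le: "4 * t \<le> 1 / (u ^ 3 * v) + 1 / (u * v ^ 3)" for u v
      proof -
        have "u ^ 3 * v \<le> u * v ^ 3"
          using u mult_left_mono[OF power_mono[of u v 2], of "u * v"]
          by (simp add: power2_eq_square power3_eq_cube mult_ac)
        then have "1 / (u * v ^ 3) \<le> 1 / (u ^ 3 * v)" using u by (intro divide_left_mono) auto
        then have "2 * t \<le> 1 / (u ^ 3 * v)" using le by linarith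
        moreover have "u ^ 3 * (1 / 2) \<le> u ^ 3 * v" using u by (intro mult_left_mono) auto
        then have "1 / (u ^ 3 * v) \<le> 1 / (u ^ 3 * (1 / 2))" using u by (intro divide_left_mono) auto
        ultimately have "t \<le> 1 / u ^ 3" by simp
        then have "u ^ 3 \<le> b ^ 3" using u elim by (simp add: b(2) field_simps)
        then show "u \<le> b" using power_le_imp_le_base[of u 2 b] b(1) by (simp add: eval_nat_numeral)
      qed
      have le: "4 * t \<le> 1 / (x ^ 3 * y) + 1 / (x * y ^ 3)"
        using xy(2) by simp
      show "x \<le> b \<or> y \<le> b"
        using *[of x y] *[of y x] le pos by (cases "x \<le> y") (auto simp: mult.commute add.commute)
    qed
    ultimately show ?case using a(3) b(3) elim by simp
  qed
qed auto

text \<open>The term 4 x^5/y^3 governs the behavior near y = 0. If y \<le> a with a^3 = 1/(16 t),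
  then x \<ge> 1/2 and 4 x^5 \<ge> 1/8 make it at least 2 t, which absorbs the term -4 x y \<ge> -4.
  Conversely 4/y^3 + 16/y \<le> 20/y^3 gives the width b with b^3 = 20/t, and t > 20 keeps it below
  1.\<close>

lemma tail_area_hyperbolic_angle: "tail_area hyperbolic_angle \<in> \<Theta>[at_top](\<lambda>t. 1 / t powr (2 / 3))"
proof (rule bigtheta_sandwich[of "(1 / 16) powr (2 / 3)" "20 powr (2 / 3)"])
  note F = continuous_observables(5)
  show "eventually (\<lambda>t. (1 / 16) powr (2 / 3) * (1 / t powr (2 / 3)) \<le> tail_area hyperbolic_angle t \<and>
      tail_area hyperbolic_angle t \<le> 20 powr (2 / 3) * (1 / t powr (2 / 3)) \<and> 0 \<le> 1 / t powr (2 / 3)) at_top"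
    using eventually_gt_at_top[of 20]
  proof eventually_elim
    case (elim t)
    define a where "a = (1 / 16 / t) powr (1 / 3)"
    define b where "b = (20 / t) powr (1 / 3)"
    have a: "0 < a" "a ^ 3 = 1 / 16 / t" "a ^ 2 = (1 / 16) powr (2 / 3) * (1 / t powr (2 / 3))"
      unfolding a_def using elim by (intro cube_root_powr; simp)+
    have b: "0 < b" "b ^ 3 = 20 / t" "b ^ 2 = 20 powr (2 / 3) * (1 / t powr (2 / 3))"
      unfolding b_def using elim by (intro cube_root_powr; simp)+
    have a1: "a \<le> 1 / 2"
    proof (rule power_le_imp_le_base)
      have "a ^ 3 \<le> (1 / 2) ^ 3"
        unfolding a(2) using elim by (simp add: power3_eq_cube field_simps)
      then show "a ^ Suc 2 \<le> (1 / 2) ^ Suc 2" by (simp add: eval_nat_numeral)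
    qed simp
    have b1: "b < 1" by (rule power_less_imp_less_base[of _ 3]) (use b elim in auto)
    have "a ^ 2 \<le> tail_area hyperbolic_angle t"
    proof (rule tail_area_strip_ge[OF F a(1)])
      fix x y assume xy: "(x, y) \<in> farey_triangle" "y \<le> a"
      note pos = farey_triangleD[OF xy(1)]
      have "1 / 2 \<le> x" using xy(2) a1 pos by linarith
      then have x5: "1 / 8 \<le> 4 * x ^ 5" using power_mono[of "1 / 2" x 5] by (simp add: power_divide)
      have "y ^ 3 \<le> 1 / 16 / t" using xy(2) pos power_mono[of y a 3] a(2) by simp
      then have "2 * t * y ^ 3 \<le> 1 / 8" using elim by (simp add: field_simps)
      then have "2 * t * y ^ 3 \<le> 4 * x ^ 5" using x5 by linarith
      then have "2 * t \<le> 4 * x ^ 5 / y ^ 3" using pos by (simp add: field_simps)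
      moreover have "x * y \<le> 1" using pos by (intro mult_le_one) auto
      moreover have "0 \<le> 16 * x ^ 3 / y" using pos by simp
      ultimately show "t \<le> hyperbolic_angle (x, y)" using elim by simp
    qed (use a1 in auto)
    moreover have "tail_area hyperbolic_angle t \<le> b ^ 2"
    proof (rule tail_area_strip_le[OF F b(1) b1])
      fix x y assume xy: "(x, y) \<in> farey_triangle" "t \<le> hyperbolic_angle (x, y)"
      note pos = farey_triangleD[OF xy(1)]
      have "x ^ 5 \<le> 1" "x ^ 3 \<le> 1" using pos by (auto intro: power_le_one)
      then have 1: "4 * x ^ 5 / y ^ 3 \<le> 4 / y ^ 3" and "16 * x ^ 3 / y \<le> 16 / y"
        using pos by (auto intro!: divide_right_mono)
      moreover have "y ^ 3 \<le> y ^ 1" using pos by (intro power_decreasing) auto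
      then have "16 / y \<le> 16 / y ^ 3" using pos by (intro divide_left_mono) auto
      moreover have "0 \<le> 4 * x * y" using pos by simp
      ultimately have "t \<le> 20 / y ^ 3" using xy(2) by simp
      then have "y ^ 3 \<le> b ^ 3" using pos elim by (simp add: b(2) field_simps)
      then show "y \<le> b" using power_le_imp_le_base[of y 2 b] b(1) by (simp add: eval_nat_numeral)
    qed
    ultimately show ?case using a(3) b(3) elim by simp
  qed
qed auto

theorem theorem1p5:
  fixes \<alpha> \<beta> :: real
  assumes "0 \<le> \<alpha>" and "\<alpha> < \<beta>" and "\<beta> \<le> 1"
  shows
    "(\<exists>G. is_limiting_distribution \<alpha> \<beta> (\<lambda>(x, y). 1 / (2 * x^2) + 1 / (2 * y^2)) G \<and>
          G \<sim>[at_top] (\<lambda>t. 1 / t)) \<and>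
     (\<exists>G. is_limiting_distribution \<alpha> \<beta> (\<lambda>(x, y). 1 / 2 * (y / x + x / y)) G \<and>
          G \<sim>[at_top] (\<lambda>t. 1 / (2 * t^2))) \<and>
     (\<exists>G. is_limiting_distribution \<alpha> \<beta> (\<lambda>(x, y). 1 / 2 * (x / y - y / x)) G \<and>
          G \<in> \<Theta>[at_top](\<lambda>t. 1 / t^2)) \<and>
     (\<exists>G. is_limiting_distribution \<alpha> \<beta> (\<lambda>(x, y). 1 / 4 * (1 / (x^3 * y) + 1 / (x * y^3))) G \<and>
          G \<in> \<Theta>[at_top](\<lambda>t. 1 / t powr (2 / 3))) \<and>
     (\<exists>G. is_limiting_distribution \<alpha> \<beta>
            (\<lambda>(x, y). 4 * x^5 / y^3 - 4 * x * y + 16 * x^3 / y) G \<and>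
          G \<in> \<Theta>[at_top](\<lambda>t. 1 / t powr (2 / 3)))"
proof (intro conjI)
  note limiting = is_limiting_distribution_tail_area[OF _ _ assms]
  show "\<exists>G. is_limiting_distribution \<alpha> \<beta> euclidean_distance G \<and> G \<sim>[at_top] (\<lambda>t. 1 / t)"
    using limiting[OF continuous_observables(1) finite_level_slices(1)] tail_area_euclidean_distance by blast
  show "\<exists>G. is_limiting_distribution \<alpha> \<beta> hyperbolic_distance G \<and> G \<sim>[at_top] (\<lambda>t. 1 / (2 * t^2))"
    using limiting[OF continuous_observables(2) finite_level_slices(2)] tail_area_hyperbolic_distance by blast
  show "\<exists>G. is_limiting_distribution \<alpha> \<beta> euclidean_slope G \<and> G \<in> \<Theta>[at_top](\<lambda>t. 1 / t^2)"
    using limiting[OF continuous_observables(3) finite_level_slices(3)] tail_area_euclidean_slope by blast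
  show "\<exists>G. is_limiting_distribution \<alpha> \<beta> euclidean_area G \<and> G \<in> \<Theta>[at_top](\<lambda>t. 1 / t powr (2 / 3))"
    using limiting[OF continuous_observables(4) finite_level_slices(4)] tail_area_euclidean_area by blast
  show "\<exists>G. is_limiting_distribution \<alpha> \<beta> hyperbolic_angle G \<and> G \<in> \<Theta>[at_top](\<lambda>t. 1 / t powr (2 / 3))"
    using limiting[OF continuous_observables(5) finite_level_slices(5)] tail_area_hyperbolic_angle by blast
qed

end
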